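(* For every $d\ge 0$ let $\mathscr{D}_d$ be the class of graphs of maximum degree at most $d$. Then for every $d\ge 0$ the problem $\mathrm{MC}(\mathrm{FO}[{+1}],\mathscr{D}_d)$ is fixed-parameter tractable. Moreover, for every fixed $d\ge 0$ and every fixed number $s\ge 1$, first-order model checking remains fixed-parameter tractable (parameterised by the length of the formula) on inputs consisting of a graph from $\mathscr{D}_d$ together with $s$ successor relations on its vertex set.
   Context: A successor relation on a finite set $V$ is a binary relation $S\subseteq V\times V$ such that $(V,S)$ is a directed path of length $|V|-1$. The parameterised problem $\mathrm{MC}(\mathrm{FO}[{+1}],\mathscr{C})$ has as input a graph $G\in\mathscr{C}$, a successor relation $S$ on $V(G)$, and a first-order sentence $\phi$ over the signature $\{E,S\}$; the parameter is $|\phi|$; the question is whether $(G,S)\models\phi$. The problem is fixed-parameter tractable if it can be decided in time $f(|\phi|)\cdot \|G\|^{O(1)}$ for some function $f$, where $\|G\|$ is the size of the input structure. *)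

theory Defs
  imports Main
begin

section \<open>Graphs and successor relations\<close>

record 'v graph =
  verts :: "'v set"
  edges :: "('v \<times> 'v) set"

text \<open>Finite simple undirected graphs, given as structures over the signature of one binary
  relation: each undirected edge is present in both orientations. As usual for first-order
  structures the universe is non-empty.\<close>

definition is_graph :: "'v graph \<Rightarrow> bool" where
  "is_graph G \<longleftrightarrow>
     finite (verts G) \<and> verts G \<noteq> {} \<and> edges G \<subseteq> verts G \<times> verts G \<and>
     sym (edges G) \<and> irrefl (edges G)"

definition degree :: "'v graph \<Rightarrow> 'v \<Rightarrow> nat" where
  "degree G v = card {u. (v, u) \<in> edges G}"

definition max_degree_class :: "nat \<Rightarrow> 'v graph set" where
  "max_degree_class d = {G. is_graph G \<and> (\<forall>v\<in>verts G. degree G v \<le> d)}"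

text \<open>The list \<open>p\<close> is the sequence of vertices along the directed path \<open>(V, S)\<close>.\<close>

definition successor_relation :: "'v set \<Rightarrow> ('v \<times> 'v) set \<Rightarrow> bool" where
  "successor_relation V S \<longleftrightarrow>
     (\<exists>p. p \<noteq> [] \<and> distinct p \<and> set p = V \<and> S = {(p ! i, p ! Suc i) | i. Suc i < length p})"


section \<open>First-order logic over an edge relation and several successor relations\<close>

datatype fm =
    Equal nat nat
  | Edge nat nat
  | Succ nat nat nat  \<comment> \<open>\<open>Succ i x y\<close>: the pair \<open>(x, y)\<close> is in the \<open>i\<close>-th successor relation\<close>
  | Neg fm
  | Conj fm fm
  | Disj fm fm
  | Exists nat fm
  | Forall nat fm

fun free_vars :: "fm \<Rightarrow> nat set" where
  "free_vars (Equal x y) = {x, y}"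
| "free_vars (Edge x y) = {x, y}"
| "free_vars (Succ i x y) = {x, y}"
| "free_vars (Neg \<phi>) = free_vars \<phi>"
| "free_vars (Conj \<phi> \<psi>) = free_vars \<phi> \<union> free_vars \<psi>"
| "free_vars (Disj \<phi> \<psi>) = free_vars \<phi> \<union> free_vars \<psi>"
| "free_vars (Exists x \<phi>) = free_vars \<phi> - {x}"
| "free_vars (Forall x \<phi>) = free_vars \<phi> - {x}"

fun succ_symbols :: "fm \<Rightarrow> nat set" where
  "succ_symbols (Equal x y) = {}"
| "succ_symbols (Edge x y) = {}"
| "succ_symbols (Succ i x y) = {i}"
| "succ_symbols (Neg \<phi>) = succ_symbols \<phi>"
| "succ_symbols (Conj \<phi> \<psi>) = succ_symbols \<phi> \<union> succ_symbols \<psi>"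
| "succ_symbols (Disj \<phi> \<psi>) = succ_symbols \<phi> \<union> succ_symbols \<psi>"
| "succ_symbols (Exists x \<phi>) = succ_symbols \<phi>"
| "succ_symbols (Forall x \<phi>) = succ_symbols \<phi>"

text \<open>Sentences over the signature \<open>{E, S\<^sub>0, \<dots>, S\<^sub>s\<^sub>-\<^sub>1}\<close>.\<close>

definition sentence :: "nat \<Rightarrow> fm \<Rightarrow> bool" where
  "sentence s \<phi> \<longleftrightarrow> free_vars \<phi> = {} \<and> succ_symbols \<phi> \<subseteq> {..<s}"

fun sat :: "'v graph \<Rightarrow> ('v \<times> 'v) set list \<Rightarrow> (nat \<Rightarrow> 'v) \<Rightarrow> fm \<Rightarrow> bool" where
  "sat G Ss \<sigma> (Equal x y) \<longleftrightarrow> \<sigma> x = \<sigma> y"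
| "sat G Ss \<sigma> (Edge x y) \<longleftrightarrow> (\<sigma> x, \<sigma> y) \<in> edges G"
| "sat G Ss \<sigma> (Succ i x y) \<longleftrightarrow> (\<sigma> x, \<sigma> y) \<in> Ss ! i"
| "sat G Ss \<sigma> (Neg \<phi>) \<longleftrightarrow> \<not> sat G Ss \<sigma> \<phi>"
| "sat G Ss \<sigma> (Conj \<phi> \<psi>) \<longleftrightarrow> sat G Ss \<sigma> \<phi> \<and> sat G Ss \<sigma> \<psi>"
| "sat G Ss \<sigma> (Disj \<phi> \<psi>) \<longleftrightarrow> sat G Ss \<sigma> \<phi> \<or> sat G Ss \<sigma> \<psi>"
| "sat G Ss \<sigma> (Exists x \<phi>) \<longleftrightarrow> (\<exists>a\<in>verts G. sat G Ss (\<sigma>(x := a)) \<phi>)"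
| "sat G Ss \<sigma> (Forall x \<phi>) \<longleftrightarrow> (\<forall>a\<in>verts G. sat G Ss (\<sigma>(x := a)) \<phi>)"

definition models :: "'v graph \<Rightarrow> ('v \<times> 'v) set list \<Rightarrow> fm \<Rightarrow> bool" where
  "models G Ss \<phi> \<longleftrightarrow> (\<forall>\<sigma>. range \<sigma> \<subseteq> verts G \<longrightarrow> sat G Ss \<sigma> \<phi>)"


section \<open>Random access machines\<close>

text \<open>
  The random access machine of Cook and Reckhow over the natural numbers, with uniform cost:
  registers \<open>X\<^sub>0, X\<^sub>1, \<dots>\<close>, addition and truncated subtraction as the only arithmetic
  (so that time is polynomially related to Turing machine time), indirect addressing,
  conditional jumps and a read-only one-way input tape. In order, the instructions are
  \<open>X\<^sub>i \<leftarrow> c\<close>, \<open>X\<^sub>i \<leftarrow> X\<^sub>j + X\<^sub>k\<close>, \<open>X\<^sub>i \<leftarrow> X\<^sub>j - X\<^sub>k\<close>,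
  \<open>X\<^sub>i \<leftarrow> X\<close> with index \<open>X\<^sub>j\<close>, \<open>X\<close> with index \<open>X\<^sub>i\<close> \<open>\<leftarrow> X\<^sub>j\<close>,
  \<open>if X\<^sub>i > 0 goto m\<close>, and reading the next input number into \<open>X\<^sub>i\<close>
  (which yields 0 once the input is exhausted).
\<close>

datatype instr =
    Const nat nat
  | Add nat nat nat
  | Sub nat nat nat
  | Load nat nat
  | Store nat nat
  | JumpPos nat nat
  | Read nat

type_synonym program = "instr list"

record config =
  pc :: nat
  reg :: "nat \<Rightarrow> nat"
  input :: "nat list"

definition set_reg :: "nat \<Rightarrow> nat \<Rightarrow> config \<Rightarrow> config" where
  "set_reg i a c = c\<lparr>pc := Suc (pc c), reg := (reg c)(i := a)\<rparr>"

fun exec_instr :: "instr \<Rightarrow> config \<Rightarrow> config" where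
  "exec_instr (Const i a) c = set_reg i a c"
| "exec_instr (Add i j k) c = set_reg i (reg c j + reg c k) c"
| "exec_instr (Sub i j k) c = set_reg i (reg c j - reg c k) c"
| "exec_instr (Load i j) c = set_reg i (reg c (reg c j)) c"
| "exec_instr (Store i j) c = set_reg (reg c i) (reg c j) c"
| "exec_instr (JumpPos i m) c = c\<lparr>pc := if reg c i > 0 then m else Suc (pc c)\<rparr>"
| "exec_instr (Read i) c =
     (case input c of
        [] \<Rightarrow> set_reg i 0 c
      | a # w \<Rightarrow> (set_reg i a c)\<lparr>input := w\<rparr>)"

definition halted :: "program \<Rightarrow> config \<Rightarrow> bool" where
  "halted P c \<longleftrightarrow> length P \<le> pc c"

definition step :: "program \<Rightarrow> config \<Rightarrow> config" where
  "step P c = (if halted P c then c else exec_instr (P ! pc c) c)"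

definition init_config :: "nat list \<Rightarrow> config" where
  "init_config w = \<lparr>pc = 0, reg = (\<lambda>_. 0), input = w\<rparr>"

text \<open>The machine answers ``yes'' by halting with a non-zero number in register 0.\<close>

definition answers_within :: "program \<Rightarrow> nat list \<Rightarrow> nat \<Rightarrow> bool \<Rightarrow> bool" where
  "answers_within P w T b \<longleftrightarrow>
     (\<exists>t\<le>T. let c = (step P ^^ t) (init_config w) in halted P c \<and> (reg c 0 \<noteq> 0 \<longleftrightarrow> b))"


section \<open>Fixed-parameter tractability\<close>

text \<open>\<open>encodes x w\<close> means that the word \<open>w\<close> is an encoding of the instance \<open>x\<close>; an instance may
  have several encodings, all of which have to be answered correctly.\<close>

record 'i problem =
  instances :: "'i set"
  yes :: "'i \<Rightarrow> bool"
  parameter :: "'i \<Rightarrow> nat"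
  input_size :: "'i \<Rightarrow> nat"
  encodes :: "'i \<Rightarrow> nat list \<Rightarrow> bool"

definition fixed_parameter_tractable :: "'i problem \<Rightarrow> bool" where
  "fixed_parameter_tractable Q \<longleftrightarrow>
     (\<exists>(P :: program) (f :: nat \<Rightarrow> nat) (k :: nat).
        \<forall>x\<in>instances Q. \<forall>w. encodes Q x w \<longrightarrow>
          answers_within P w (f (parameter Q x) * input_size Q x ^ k) (yes Q x))"


section \<open>Model checking with successor relations\<close>

text \<open>Prefix notation, one number per symbol.\<close>

fun fm_code :: "fm \<Rightarrow> nat list" where
  "fm_code (Equal x y) = [0, x, y]"
| "fm_code (Edge x y) = [1, x, y]"
| "fm_code (Succ i x y) = [2, i, x, y]"
| "fm_code (Neg \<phi>) = 3 # fm_code \<phi>"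
| "fm_code (Conj \<phi> \<psi>) = 4 # fm_code \<phi> @ fm_code \<psi>"
| "fm_code (Disj \<phi> \<psi>) = 5 # fm_code \<phi> @ fm_code \<psi>"
| "fm_code (Exists x \<phi>) = 6 # x # fm_code \<phi>"
| "fm_code (Forall x \<phi>) = 7 # x # fm_code \<phi>"

definition fm_length :: "fm \<Rightarrow> nat" where
  "fm_length \<phi> = length (fm_code \<phi>)"

definition pairs_code :: "(nat \<times> nat) list \<Rightarrow> nat list" where
  "pairs_code ps = length ps # concat (map (\<lambda>(a, b). [a, b]) ps)"

text \<open>A binary relation is encoded by any repetition-free listing of its pairs, where each vertex
  \<open>v\<close> is represented by its number \<open>\<nu> v\<close>.\<close>

definition relation_code :: "('v \<Rightarrow> nat) \<Rightarrow> ('v \<times> 'v) set \<Rightarrow> nat list \<Rightarrow> bool" where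
  "relation_code \<nu> R w \<longleftrightarrow>
     (\<exists>ps. distinct ps \<and> set ps = R \<and> w = pairs_code (map (map_prod \<nu> \<nu>) ps))"

type_synonym 'v mc_instance = "'v graph \<times> ('v \<times> 'v) set list \<times> fm"

fun mc_encodes :: "'v mc_instance \<Rightarrow> nat list \<Rightarrow> bool" where
  "mc_encodes (G, Ss, \<phi>) w \<longleftrightarrow>
     (\<exists>\<nu> e us. bij_betw \<nu> (verts G) {..<card (verts G)} \<and>
        relation_code \<nu> (edges G) e \<and> list_all2 (relation_code \<nu>) Ss us \<and>
        w = card (verts G) # e @ concat us @ fm_code \<phi>)"

fun mc_size :: "'v mc_instance \<Rightarrow> nat" where
  "mc_size (G, Ss, \<phi>) = card (verts G) + card (edges G) + (\<Sum>S\<leftarrow>Ss. card S)"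

definition MC_FO_succs :: "nat \<Rightarrow> 'v graph set \<Rightarrow> 'v mc_instance problem" where
  "MC_FO_succs s C =
     \<lparr>instances = {(G, Ss, \<phi>). G \<in> C \<and> length Ss = s \<and>
                     (\<forall>S\<in>set Ss. successor_relation (verts G) S) \<and> sentence s \<phi>},
      yes = (\<lambda>(G, Ss, \<phi>). models G Ss \<phi>),
      parameter = (\<lambda>(G, Ss, \<phi>). fm_length \<phi>),
      input_size = mc_size,
      encodes = mc_encodes\<rparr>"

definition MC_FO_plus1 :: "'v graph set \<Rightarrow> 'v mc_instance problem" where
  "MC_FO_plus1 C = MC_FO_succs 1 C"

end

theory Submission
  imports Defs
begin

text \<open>
  List the neighbours of each vertex in each relation. The structure is then given by boundedly many
  unary functions, and the type of radius \<open>r\<close> of a vertex is the equality pattern of the words of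
  length at most \<open>r\<close> in these functions; there are boundedly many types. As in Hanf's theorem, two tuples
  of one finite structure with the same type of radius \<open>3 r\<close> admit the same extensions up to types of
  radius \<open>r\<close>: an extension close to the first tuple is copied by its word, and for one that is far
  from it, both tuples leave equally many far elements of the required type. A quantifier may
  therefore be restricted to a set of bounded size, namely the words applied to the tuple so far and
  sufficiently many vertices of each type. The resulting evaluation algorithm is written in a small
  imperative language with arrays, whose cost measure counts loop iterations only, and compiled to a
  random access machine.
\<close>

section \<open>Local types\<close>

text \<open>A successor relation has in-degree and out-degree at most 1, so adding \<open>s\<close>
  of them keeps the degree bounded. Every relation is stored in both directions with
  \<open>D = max d 1\<close> slots each, hence \<open>k = 2 * (s + 1) * D\<close> functions. The
  second direction makes words reversible: if two words of length \<open>r\<close> meet, their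
  starting points are joined by a word of length \<open>2 r\<close>. This is the origin of the
  factor 3: an element counts as near within radius \<open>2 r\<close>, and \<open>r\<close> more
  letters are needed to see its type. A formula of length \<open>L\<close> nests at most
  \<open>L\<close> quantifiers, hence the total radius \<open>3 ^ L\<close>. Words are replaced by
  positions of a heap, because a loop using only additions enumerates them and because the ranges of
  all quantifiers become initial segments of one array. If \<open>N\<close> bounds the number of
  words at one vertex, then \<open>(L + 1) * N\<close> representatives per type always leave one
  outside the neighbourhood of a tuple of fewer than \<open>L\<close> elements.\<close>

definition words :: "nat \<Rightarrow> nat \<Rightarrow> nat list set" where
  "words k r = {w. set w \<subseteq> {..<k} \<and> length w \<le> r}"

lemma words_append: "u \<in> words k r \<Longrightarrow> v \<in> words k r' \<Longrightarrow> u @ v \<in> words k (r + r')"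
  by (auto simp: words_def)

lemma words_mono: "u \<in> words k r \<Longrightarrow> r \<le> r' \<Longrightarrow> u \<in> words k r'"
  by (auto simp: words_def)

lemma Nil_in_words [simp]: "[] \<in> words k r"
  by (simp add: words_def)

text \<open>A structure of bounded degree, presented by unary functions \<open>f 0, \<dots>, f (k - 1)\<close> such that
  reachability is symmetric.\<close>

locale functional_structure =
  fixes f :: "nat \<Rightarrow> nat \<Rightarrow> nat" and k n :: nat
  assumes f_less: "i < k \<Longrightarrow> v < n \<Longrightarrow> f i v < n"
    and f_back: "i < k \<Longrightarrow> v < n \<Longrightarrow> \<exists>j<k. f j (f i v) = v"
begin

abbreviation apply_word :: "nat list \<Rightarrow> nat \<Rightarrow> nat" where
  "apply_word w x \<equiv> fold f w x"

lemma apply_word_less: "w \<in> words k r \<Longrightarrow> x < n \<Longrightarrow> apply_word w x < n"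
proof (induction w arbitrary: x r)
  case (Cons i w)
  then have "w \<in> words k r" "i < k"
    by (auto simp: words_def)
  with Cons show ?case
    by (simp add: f_less)
qed simp

text \<open>Letters are undone in reverse order, each by a single letter from \<open>f_back\<close>,
  so the way back needs no larger radius than the way out.\<close>

lemma word_back:
  "w \<in> words k r \<Longrightarrow> x < n \<Longrightarrow> \<exists>w'\<in>words k r. apply_word w' (apply_word w x) = x"
proof (induction w arbitrary: x r)
  case Nil
  then show ?case by (intro bexI[of _ "[]"]) auto
next
  case (Cons i w)
  then obtain r' where r: "r = Suc r'"
    by (cases r) (auto simp: words_def)
  with Cons.prems have i: "i < k" and w: "w \<in> words k r'"
    by (auto simp: words_def)
  from Cons.IH[OF w f_less[OF i Cons.prems(2)]] obtain w' where
    w': "w' \<in> words k r'" "apply_word w' (apply_word w (f i x)) = f i x"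
    by auto
  from f_back[OF i Cons.prems(2)] obtain j where "j < k" "f j (f i x) = x"
    by auto
  with w' r show ?case
    by (intro bexI[of _ "w' @ [j]"]) (auto simp: words_def)
qed

definition same_type :: "nat \<Rightarrow> nat \<Rightarrow> nat \<Rightarrow> bool" where
  "same_type r a b \<longleftrightarrow> (\<forall>u\<in>words k r. \<forall>v\<in>words k r.
     apply_word u a = apply_word v a \<longleftrightarrow> apply_word u b = apply_word v b)"

text \<open>The joint type of a tuple indexed by \<open>X\<close>. Words starting at different
  coordinates are compared as well, which records which coordinates are close together and by which
  words they are linked.\<close>

definition sim :: "nat \<Rightarrow> nat set \<Rightarrow> (nat \<Rightarrow> nat) \<Rightarrow> (nat \<Rightarrow> nat) \<Rightarrow> bool" where
  "sim r X \<sigma> \<tau> \<longleftrightarrow> (\<forall>x\<in>X. \<forall>y\<in>X. \<forall>u\<in>words k r. \<forall>v\<in>words k r.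
     apply_word u (\<sigma> x) = apply_word v (\<sigma> y) \<longleftrightarrow> apply_word u (\<tau> x) = apply_word v (\<tau> y))"

definition near :: "nat \<Rightarrow> nat set \<Rightarrow> (nat \<Rightarrow> nat) \<Rightarrow> nat set" where
  "near r X \<sigma> = {apply_word w (\<sigma> x) | w x. w \<in> words k r \<and> x \<in> X}"

lemma sim_mono: "sim r X \<sigma> \<tau> \<Longrightarrow> r' \<le> r \<Longrightarrow> X' \<subseteq> X \<Longrightarrow> sim r' X' \<sigma> \<tau>"
  unfolding sim_def by (meson subsetD words_mono)

lemma sim_sym: "sim r X \<sigma> \<tau> \<Longrightarrow> sim r X \<tau> \<sigma>"
  unfolding sim_def by blast

lemma same_type_mono: "same_type r a b \<Longrightarrow> r' \<le> r \<Longrightarrow> same_type r' a b"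
  unfolding same_type_def by (meson words_mono)

text \<open>A word of length \<open>2 r\<close> leads to the point and \<open>r\<close> further
  letters probe its type; the radius \<open>3 r\<close> pays for both.\<close>

lemma sim_same_type:
  assumes "sim (3 * r) X \<sigma> \<tau>" and "w \<in> words k (2 * r)" and "x \<in> X"
  shows "same_type r (apply_word w (\<sigma> x)) (apply_word w (\<tau> x))"
proof -
  have "w @ u \<in> words k (3 * r)" if "u \<in> words k r" for u
    using words_append[OF assms(2) that] by (simp add: mult.commute)
  then show ?thesis
    using assms(1,3) unfolding same_type_def sim_def by (metis comp_apply fold_append)
qed

text \<open>Each near element is moved by choosing one word that reaches it from
  \<open>\<tau>\<close> and running the same word from \<open>\<sigma>\<close>. Transfer of
  equalities at radius \<open>2 r\<close> makes this map injective, and \<open>sim_same_type\<close>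
  keeps it inside \<open>T\<close>.\<close>

lemma card_near_of_type:
  assumes sim: "sim (3 * r) X \<sigma> \<tau>" and "finite T"
    and T: "T = {c. c < n \<and> same_type r a c}" and \<sigma>: "\<forall>x\<in>X. \<sigma> x < n"
  shows "card (T \<inter> near (2 * r) X \<tau>) \<le> card (T \<inter> near (2 * r) X \<sigma>)"
proof -
  have "\<forall>c\<in>near (2 * r) X \<tau>. \<exists>w x. w \<in> words k (2 * r) \<and> x \<in> X \<and> c = apply_word w (\<tau> x)"
    by (auto simp: near_def)
  then obtain w x where wx: "\<And>c. c \<in> near (2 * r) X \<tau> \<Longrightarrow>
      w c \<in> words k (2 * r) \<and> x c \<in> X \<and> c = apply_word (w c) (\<tau> (x c))"
    by metis
  define g where "g c = apply_word (w c) (\<sigma> (x c))" for c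
  have sim': "sim (2 * r) X \<sigma> \<tau>"
    using sim by (rule sim_mono) simp_all
  show ?thesis
  proof (rule card_inj_on_le[of g])
    show "inj_on g (T \<inter> near (2 * r) X \<tau>)"
    proof (rule inj_onI)
      fix c d
      assume "c \<in> T \<inter> near (2 * r) X \<tau>" "d \<in> T \<inter> near (2 * r) X \<tau>" "g c = g d"
      with wx[of c] wx[of d] sim' show "c = d"
        unfolding sim_def g_def by (metis IntE)
    qed
    show "g ` (T \<inter> near (2 * r) X \<tau>) \<subseteq> T \<inter> near (2 * r) X \<sigma>"
    proof clarify
      fix c
      assume c: "c \<in> T" "c \<in> near (2 * r) X \<tau>"
      from sim_same_type[OF sim] wx[OF c(2)] have "same_type r (g c) c"
        unfolding g_def by metis
      with c(1) T have "same_type r a (g c)"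
        unfolding same_type_def by auto
      moreover have "g c < n"
        using wx[OF c(2)] \<sigma> unfolding g_def by (blast intro: apply_word_less)
      ultimately show "g c \<in> T \<inter> near (2 * r) X \<sigma>"
        using T wx[OF c(2)] by (auto simp: near_def g_def)
    qed
  qed (use \<open>finite T\<close> in simp)
qed

text \<open>Following \<open>v\<close> from the tuple and then \<open>u\<close> backwards leads to
  \<open>a\<close>. The two legs give the radius \<open>2 r\<close>; its contrapositive says that a
  far element shares no endpoint of words with the tuple.\<close>

lemma apply_eq_near:
  assumes "u \<in> words k r" "v \<in> words k r" "a < n" "x \<in> X" "apply_word u a = apply_word v (\<sigma> x)"
  shows "a \<in> near (2 * r) X \<sigma>"
proof -
  from word_back[OF assms(1,3)] obtain u' where "u' \<in> words k r" "apply_word u' (apply_word u a) = a"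
    by auto
  with assms have "apply_word (v @ u') (\<sigma> x) = a" "v @ u' \<in> words k (2 * r)"
    using words_append[of v k r u' r] by (simp_all add: mult_2)
  with assms(4) show ?thesis
    by (force simp: near_def)
qed

text \<open>The back-and-forth step of Hanf's argument. An element far from \<open>\<sigma>\<close> is answered by an element of
  the same type far from \<open>\<tau>\<close>; it exists because both tuples live in the same structure and have
  equally many elements of that type in their neighbourhoods.\<close>

lemma sim_extend:
  assumes sim: "sim (3 * r) X \<sigma> \<tau>" and "finite X" and "x \<notin> X"
    and \<sigma>: "\<forall>y\<in>X. \<sigma> y < n" and \<tau>: "\<forall>y\<in>X. \<tau> y < n" and a: "a < n"
    and W: "W \<subseteq> {..<n}" "\<And>b. b < n \<Longrightarrow> b \<notin> W \<Longrightarrow> card (near (2 * r) X \<tau>) < card {c\<in>W. same_type r b c}"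
    and C: "W \<subseteq> C" "near (2 * r) X \<tau> \<subseteq> C"
  shows "\<exists>b\<in>C. b < n \<and> sim r (insert x X) (\<sigma>(x := a)) (\<tau>(x := b))"
proof -
  have sim_r: "sim r X \<sigma> \<tau>"
    using sim by (rule sim_mono) simp_all
  show ?thesis
  proof (cases "a \<in> near (2 * r) X \<sigma>")
    case True
    then obtain w y where w: "w \<in> words k (2 * r)" and y: "y \<in> X" and a_eq: "a = apply_word w (\<sigma> y)"
      by (auto simp: near_def)
    \<comment> \<open>The answer copies the word that leads to \<open>a\<close>. A word
      \<open>u\<close> at the new variable becomes \<open>w\<close> followed by \<open>u\<close> at
      \<open>y\<close>, still of length at most \<open>3 r\<close>.\<close>
    define b where "b = apply_word w (\<tau> y)"
    have wu: "w @ u \<in> words k (3 * r)" if "u \<in> words k r" for u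
      using words_append[OF w that] by (simp add: mult.commute)
    have u3: "u \<in> words k (3 * r)" if "u \<in> words k r" for u
      using that by (rule words_mono) simp
    have "sim r (insert x X) (\<sigma>(x := a)) (\<tau>(x := b))"
      unfolding sim_def
    proof (intro ballI)
      fix z1 z2 u v
      assume *: "z1 \<in> insert x X" "z2 \<in> insert x X" "u \<in> words k r" "v \<in> words k r"
      note s = sim[unfolded sim_def, rule_format]
      show "apply_word u ((\<sigma>(x := a)) z1) = apply_word v ((\<sigma>(x := a)) z2) \<longleftrightarrow>
        apply_word u ((\<tau>(x := b)) z1) = apply_word v ((\<tau>(x := b)) z2)"
        using * s[OF y y wu[OF *(3)] wu[OF *(4)]] s[of z1 y u "w @ v"] s[of y z2 "w @ u" v]
          s[of z1 z2 u v] wu[OF *(3)] wu[OF *(4)] u3[OF *(3)] u3[OF *(4)] y \<open>x \<notin> X\<close>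
        by (cases "z1 = x"; cases "z2 = x"; simp add: a_eq b_def)
    qed
    moreover have "b \<in> near (2 * r) X \<tau>"
      using w y by (auto simp: near_def b_def)
    moreover have "b < n"
      using apply_word_less[OF w] \<tau> y by (simp add: b_def)
    ultimately show ?thesis
      using C by blast
  next
    case False
    define T where "T = {c. c < n \<and> same_type r a c}"
    have fin: "finite T"
      by (simp add: T_def)
    have aT: "a \<in> T"
      using a by (simp add: T_def same_type_def)
    \<comment> \<open>Near \<open>\<sigma>\<close> there are at least as many elements of the type
      of \<open>a\<close> as near \<open>\<tau>\<close>, and \<open>a\<close> itself is a further
      one. So not all elements of this type can lie near \<open>\<tau>\<close>.\<close>
    have le: "card (T \<inter> near (2 * r) X \<tau>) \<le> card (T \<inter> near (2 * r) X \<sigma>)"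
      by (rule card_near_of_type[OF sim fin T_def \<sigma>])
    have "T \<inter> near (2 * r) X \<sigma> \<subset> T"
      using aT False by auto
    then have "card (T \<inter> near (2 * r) X \<sigma>) < card T"
      using fin by (rule psubset_card_mono[rotated])
    with le have lt: "card (T \<inter> near (2 * r) X \<tau>) < card T"
      by simp
    have near_fin: "finite (near (2 * r) X \<tau>)"
      by (rule finite_subset[of _ "{..<n}"]) (use \<tau> in \<open>auto simp: near_def intro: apply_word_less\<close>)
    have "\<exists>b\<in>T \<inter> W. b \<notin> near (2 * r) X \<tau>"
    \<comment> \<open>If \<open>W\<close> contains the whole type, the count above yields the
      element. Otherwise some element of the type was left out, and then \<open>W\<close> holds more
      elements of this type than fit near \<open>\<tau>\<close>.\<close>
    proof (cases "T \<subseteq> W")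
      case True
      have "\<not> T \<subseteq> T \<inter> near (2 * r) X \<tau>"
        using lt fin by (metis card_mono finite_Int leD)
      with True show ?thesis
        by auto
    next
      case False
      then obtain c where c: "c \<in> T" "c \<notin> W"
        by auto
      then have "card (near (2 * r) X \<tau>) < card {d\<in>W. same_type r c d}"
        using W(2)[of c] by (simp add: T_def)
      then have "\<not> {d\<in>W. same_type r c d} \<subseteq> near (2 * r) X \<tau>"
        using near_fin by (metis card_mono leD)
      then obtain d where d: "d \<in> W" "same_type r c d" "d \<notin> near (2 * r) X \<tau>"
        by auto
      with c have "same_type r a d"
        by (auto simp: T_def same_type_def)
      with d W(1) show ?thesis
        by (auto simp: T_def)
    qed
    then obtain b where b: "b \<in> T" "b \<in> W" "b \<notin> near (2 * r) X \<tau>"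
      by auto
    then have b_less: "b < n" and ab: "same_type r a b"
      by (auto simp: T_def)
    have "sim r (insert x X) (\<sigma>(x := a)) (\<tau>(x := b))"
      unfolding sim_def
    proof (intro ballI)
      fix z1 z2 u v
      assume *: "z1 \<in> insert x X" "z2 \<in> insert x X" "u \<in> words k r" "v \<in> words k r"
      \<comment> \<open>Both new elements are far from their tuples, so every mixed comparison is
        false on both sides; the rest follows from the type of the new element and from the old
        tuple separately.\<close>
      have fa: "apply_word u' a \<noteq> apply_word v' (\<sigma> z)"
        if "u' \<in> words k r" "v' \<in> words k r" "z \<in> X" for u' v' z
        using apply_eq_near[of u' r v' a z X \<sigma>] that a False by blast
      have fb: "apply_word u' b \<noteq> apply_word v' (\<tau> z)"
        if "u' \<in> words k r" "v' \<in> words k r" "z \<in> X" for u' v' z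
        using apply_eq_near[of u' r v' b z X \<tau>] that b_less b(3) by blast
      show "apply_word u ((\<sigma>(x := a)) z1) = apply_word v ((\<sigma>(x := a)) z2) \<longleftrightarrow>
        apply_word u ((\<tau>(x := b)) z1) = apply_word v ((\<tau>(x := b)) z2)"
        using * \<open>x \<notin> X\<close> fa[OF *(3,4), of z2] fa[OF *(4,3), of z1] fb[OF *(3,4), of z2]
          fb[OF *(4,3), of z1] ab[unfolded same_type_def] sim_r[unfolded sim_def]
        by (cases "z1 = x"; cases "z2 = x"; simp)
    qed
    with b b_less C show ?thesis
      by blast
  qed
qed

end

section \<open>Heap-ordered unravelling\<close>

text \<open>A \<open>k\<close>-ary heap with \<open>m\<close> roots: the \<open>i\<close>-th child of position \<open>p\<close> is position \<open>m + k p + i\<close>, and it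
  carries the image under \<open>f i\<close> of the entry at \<open>p\<close>.\<close>

function heap :: "(nat \<Rightarrow> nat \<Rightarrow> nat) \<Rightarrow> nat \<Rightarrow> nat \<Rightarrow> (nat \<Rightarrow> nat) \<Rightarrow> nat \<Rightarrow> nat" where
  "heap f k m ini p = (if p < m \<or> m = 0 then ini p
     else f ((p - m) mod k) (heap f k m ini ((p - m) div k)))"
  by auto
termination
  by (relation "measure (\<lambda>(f, k, m, ini, p). p)")
    (auto intro: le_less_trans[OF div_le_dividend])

declare heap.simps [simp del]

lemma heap_root: "p < m \<Longrightarrow> heap f k m ini p = ini p"
  by (simp add: heap.simps)

lemma heap_child:
  assumes "0 < m" and "i < k"
  shows "heap f k m ini (m + k * p + i) = f i (heap f k m ini p)"
  using assms by (subst heap.simps) simp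

text \<open>The \<open>m\<close> roots and the children of the first \<open>h\<close> positions fill
  exactly the positions below this number. Iterating it \<open>l\<close> times therefore covers all
  words of length \<open>l\<close> from these positions.\<close>

definition grow :: "nat \<Rightarrow> nat \<Rightarrow> nat \<Rightarrow> nat" where
  "grow k m h = m + k * h"

lemma grow_le: "0 < k \<Longrightarrow> h \<le> grow k m h"
  by (cases k) (auto simp: grow_def)

lemma grow_iter_le: "0 < k \<Longrightarrow> h \<le> (grow k m ^^ l) h"
proof (induction l)
  case (Suc l)
  then show ?case
    using grow_le[of k "(grow k m ^^ l) h" m] by simp
qed simp

lemma grow_iter_mono: "0 < k \<Longrightarrow> l \<le> l' \<Longrightarrow> (grow k m ^^ l) h \<le> (grow k m ^^ l') h"
  using grow_iter_le[where l = "l' - l" and h = "(grow k m ^^ l) h" and m = m and k = k] funpow_add[of "l' - l" l "grow k m"]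
  by simp

text \<open>Each letter moves to a child and costs one application of \<open>grow\<close>. The
  position \<open>q\<close> is chosen before \<open>ini\<close>, so one position stands for the same
  word at every starting vertex.\<close>

lemma heap_word:
  assumes "0 < m" and "0 < k" and "w \<in> words k l" and "p < h"
  shows "\<exists>q<(grow k m ^^ l) h. \<forall>ini. heap f k m ini q = fold f w (heap f k m ini p)"
  using assms(3,4)
proof (induction w arbitrary: l p h)
  case Nil
  then show ?case
    using grow_iter_le[OF assms(2), where h = h and m = m and l = l] by (intro exI[of _ p]) auto
next
  case (Cons i w)
  then obtain l' where l: "l = Suc l'"
    by (cases l) (auto simp: words_def)
  with Cons.prems have i: "i < k" and w: "w \<in> words k l'"
    by (auto simp: words_def)
  have "k * p + i < k * h"
    using i Cons.prems(2) nat_mult_le_cancel_disj[of k "Suc p" h] by (simp add: Suc_le_eq)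
  then have "m + k * p + i < grow k m h"
    by (simp add: grow_def)
  from Cons.IH[OF w this] obtain q where "q < (grow k m ^^ l') (grow k m h)"
    "\<forall>ini. heap f k m ini q = fold f w (heap f k m ini (m + k * p + i))"
    by auto
  then show ?case
    using l heap_child[OF assms(1) i] by (intro exI[of _ q]) (simp add: funpow_swap1)
qed

context functional_structure
begin

lemma heap_less:
  assumes "0 < k" and "\<And>p. p < m \<Longrightarrow> ini p < n" and "0 < m"
  shows "heap f k m ini p < n"
proof (induction p rule: less_induct)
  case (less p)
  show ?case
  proof (cases "p < m")
    case True
    then show ?thesis
      by (simp add: heap_root assms)
  next
    case False
    with assms have "(p - m) div k < p"
      by (auto intro: le_less_trans[OF div_le_dividend])
    from less[OF this] False assms show ?thesis
      by (subst heap.simps) (simp add: f_less)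
  qed
qed

text \<open>The computable counterpart of \<open>same_type\<close>: two unravellings with a single
  root are compared cell by cell.\<close>

definition same_pattern :: "nat \<Rightarrow> nat \<Rightarrow> nat \<Rightarrow> bool" where
  "same_pattern N a b \<longleftrightarrow> (\<forall>p<N. \<forall>q<N.
     heap f k 1 (\<lambda>_. a) p = heap f k 1 (\<lambda>_. a) q \<longleftrightarrow> heap f k 1 (\<lambda>_. b) p = heap f k 1 (\<lambda>_. b) q)"

lemma same_pattern_cong: "same_pattern N a b \<Longrightarrow> same_pattern N a = same_pattern N b"
  by (auto simp: same_pattern_def fun_eq_iff)

lemma word_position:
  assumes "0 < k" and "w \<in> words k r"
  shows "\<exists>q<(grow k 1 ^^ r) 1. \<forall>a. heap f k 1 (\<lambda>_. a) q = apply_word w a"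
proof -
  obtain q where q: "q < (grow k 1 ^^ r) 1"
    "\<forall>ini. heap f k 1 ini q = apply_word w (heap f k 1 ini 0)"
    using heap_word[OF _ assms(1,2), of 1 0 1 f] by auto
  have "\<forall>a. heap f k 1 (\<lambda>_. a) q = apply_word w a"
    using q(2) by (simp add: heap_root)
  with q(1) show ?thesis
    by blast
qed

text \<open>Every word of length at most \<open>r\<close> occurs at a position below
  \<open>(grow k 1 ^^ r) 1\<close>, at the same position for \<open>a\<close> and
  \<open>b\<close>.\<close>

lemma same_pattern_same_type:
  assumes "0 < k" and "same_pattern ((grow k 1 ^^ r) 1) a b"
  shows "same_type r a b"
  unfolding same_type_def
proof (intro ballI)
  fix u v
  assume u: "u \<in> words k r" and v: "v \<in> words k r"
  from word_position[OF assms(1) u] obtain p where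
    "p < (grow k 1 ^^ r) 1" "\<forall>a. heap f k 1 (\<lambda>_. a) p = apply_word u a"
    by blast
  moreover from word_position[OF assms(1) v] obtain q where
    "q < (grow k 1 ^^ r) 1" "\<forall>a. heap f k 1 (\<lambda>_. a) q = apply_word v a"
    by blast
  ultimately show "apply_word u a = apply_word v a \<longleftrightarrow> apply_word u b = apply_word v b"
    using assms(2) unfolding same_pattern_def by (metis (no_types))
qed

text \<open>Heap positions bound the number of words, so a neighbourhood is the image of pairs of a
  coordinate and a position.\<close>

lemma card_near_le:
  assumes "0 < k" and "finite X"
  shows "card (near r X \<tau>) \<le> card X * (grow k 1 ^^ r) 1"
proof -
  let ?N = "(grow k 1 ^^ r) 1"
  have "near r X \<tau> \<subseteq> (\<lambda>(x, q). heap f k 1 (\<lambda>_. \<tau> x) q) ` (X \<times> {..<?N})"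
  proof
    fix c
    assume "c \<in> near r X \<tau>"
    then obtain w x where "w \<in> words k r" "x \<in> X" "c = apply_word w (\<tau> x)"
      by (auto simp: near_def)
    moreover from word_position[OF assms(1) this(1)] obtain q where
      "q < ?N" "\<forall>a. heap f k 1 (\<lambda>_. a) q = apply_word w a"
      by blast
    ultimately show "c \<in> (\<lambda>(x, q). heap f k 1 (\<lambda>_. \<tau> x) q) ` (X \<times> {..<?N})"
      by (intro image_eqI[of _ _ "(x, q)"]) auto
  qed
  then have "card (near r X \<tau>) \<le> card (X \<times> {..<?N})"
    using assms(2) by (intro surj_card_le) auto
  then show ?thesis
    by (simp add: card_cartesian_product)
qed

section \<open>Representatives of the types\<close>

text \<open>Greedy selection: a vertex is kept as long as fewer than \<open>M\<close> vertices of
  its pattern have been kept before it.\<close>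

fun reps :: "nat \<Rightarrow> nat \<Rightarrow> nat \<Rightarrow> nat list" where
  "reps M N 0 = []"
| "reps M N (Suc b) = reps M N b @
     (if length (filter (same_pattern N b) (reps M N b)) < M then [b] else [])"

lemma set_reps: "set (reps M N b) \<subseteq> {..<b}"
  by (induction b) auto

lemma distinct_reps: "distinct (reps M N b)"
proof (induction b)
  case (Suc b)
  have "b \<notin> set (reps M N b)"
    using set_reps[of M N b] by auto
  with Suc show ?case
    by simp
qed simp

lemma reps_complete:
  "c < b \<Longrightarrow> c \<notin> set (reps M N b) \<Longrightarrow> M \<le> card {a\<in>set (reps M N b). same_pattern N c a}"
proof (induction b)
  case (Suc b)
  have *: "card {a\<in>set ws. same_pattern N c a} = length (filter (same_pattern N c) ws)"
    if "distinct ws" for ws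
    using that distinct_card[of "filter (same_pattern N c) ws"] by (simp add: Collect_conj_eq Int_commute)
  show ?case
  proof (cases "c = b")
    case True
    with Suc.prems have "M \<le> length (filter (same_pattern N c) (reps M N (Suc b)))"
      by (auto split: if_splits)
    then show ?thesis
      by (simp only: *[OF distinct_reps])
  next
    case False
    with Suc.prems have "c < b" "c \<notin> set (reps M N b)"
      by auto
    with Suc.IH have "M \<le> card {a\<in>set (reps M N b). same_pattern N c a}"
      by simp
    also have "\<dots> \<le> card {a\<in>set (reps M N (Suc b)). same_pattern N c a}"
      by (rule card_mono) auto
    finally show ?thesis .
  qed
qed simp

text \<open>A vertex \<open>b\<close> with the pattern of \<open>c\<close> defines the same filter
  as \<open>c\<close>, so the count bounded here is the one tested before \<open>b\<close> is
  added.\<close>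

lemma filter_reps_le: "length (filter (same_pattern N c) (reps M N b)) \<le> M"
proof (induction b)
  case (Suc b)
  show ?case
  proof (cases "same_pattern N c b")
    case True
    then have "same_pattern N c = same_pattern N b"
      by (rule same_pattern_cong)
    with Suc show ?thesis
      by simp
  next
    case False
    with Suc show ?thesis
      by simp
  qed
qed simp

text \<open>A pattern is a set of pairs of positions, so there are at most
  \<open>2 ^ (N * N)\<close> of them, each kept at most \<open>M\<close> times.\<close>

lemma length_reps_le: "length (reps M N b) \<le> M * 2 ^ (N * N)"
proof -
  define pat where "pat a = {(p, q). p < N \<and> q < N \<and> heap f k 1 (\<lambda>_. a) p = heap f k 1 (\<lambda>_. a) q}" for a
  let ?P = "Pow ({..<N} \<times> {..<N})"
  have pat: "pat a \<in> ?P" for a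
    by (auto simp: pat_def)
  have pat_eq: "same_pattern N a c" if "pat a = pat c" for a c
    using that unfolding same_pattern_def pat_def set_eq_iff by auto
  have "length (reps M N b) = card (set (reps M N b))"
    by (rule distinct_card[OF distinct_reps, symmetric])
  also have "set (reps M N b) = (\<Union>P\<in>?P. {a\<in>set (reps M N b). pat a = P})"
    using pat by blast
  also have "card \<dots> \<le> (\<Sum>P\<in>?P. card {a\<in>set (reps M N b). pat a = P})"
    by (rule card_UN_le) simp
  also have "\<dots> \<le> (\<Sum>P\<in>?P. M)"
  proof (rule sum_mono)
    fix P
    show "card {a\<in>set (reps M N b). pat a = P} \<le> M"
    proof (cases "{a\<in>set (reps M N b). pat a = P} = {}")
      case False
      then obtain c where c: "pat c = P"
        by auto
      have "card {a\<in>set (reps M N b). pat a = P} \<le> card (set (filter (same_pattern N c) (reps M N b)))"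
        by (rule card_mono) (use c pat_eq in auto)
      also have "\<dots> \<le> length (filter (same_pattern N c) (reps M N b))"
        by (rule card_length)
      also have "\<dots> \<le> M"
        by (rule filter_reps_le)
      finally show ?thesis .
    qed (metis card.empty le0)
  qed
  also have "\<dots> = M * 2 ^ (N * N)"
    by (simp add: card_Pow card_cartesian_product)
  finally show ?thesis .
qed

end

section \<open>Restricted quantifiers\<close>

text \<open>The position of a subformula in the prefix code of the whole formula determines the range of
  its quantifier.\<close>

fun rsat :: "(nat \<Rightarrow> nat set) \<Rightarrow> (nat \<Rightarrow> nat \<Rightarrow> nat \<Rightarrow> bool) \<Rightarrow> nat \<Rightarrow> (nat \<Rightarrow> nat) \<Rightarrow> fm \<Rightarrow> bool" where
  "rsat rg E p \<tau> (Equal x y) \<longleftrightarrow> \<tau> x = \<tau> y"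
| "rsat rg E p \<tau> (Edge x y) \<longleftrightarrow> E 0 (\<tau> x) (\<tau> y)"
| "rsat rg E p \<tau> (Succ i x y) \<longleftrightarrow> E (Suc i) (\<tau> x) (\<tau> y)"
| "rsat rg E p \<tau> (Neg \<phi>) \<longleftrightarrow> \<not> rsat rg E (p + 1) \<tau> \<phi>"
| "rsat rg E p \<tau> (Conj \<phi> \<psi>) \<longleftrightarrow>
     rsat rg E (p + 1) \<tau> \<phi> \<and> rsat rg E (p + 1 + fm_length \<phi>) \<tau> \<psi>"
| "rsat rg E p \<tau> (Disj \<phi> \<psi>) \<longleftrightarrow>
     rsat rg E (p + 1) \<tau> \<phi> \<or> rsat rg E (p + 1 + fm_length \<phi>) \<tau> \<psi>"
| "rsat rg E p \<tau> (Exists x \<phi>) \<longleftrightarrow> (\<exists>b\<in>rg p. rsat rg E (p + 2) (\<tau>(x := b)) \<phi>)"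
| "rsat rg E p \<tau> (Forall x \<phi>) \<longleftrightarrow> (\<forall>b\<in>rg p. rsat rg E (p + 2) (\<tau>(x := b)) \<phi>)"

fun qrank :: "fm \<Rightarrow> nat" where
  "qrank (Neg \<phi>) = qrank \<phi>"
| "qrank (Conj \<phi> \<psi>) = max (qrank \<phi>) (qrank \<psi>)"
| "qrank (Disj \<phi> \<psi>) = max (qrank \<phi>) (qrank \<psi>)"
| "qrank (Exists x \<phi>) = Suc (qrank \<phi>)"
| "qrank (Forall x \<phi>) = Suc (qrank \<phi>)"
| "qrank _ = 0"

lemma fm_length_simps [simp]:
  "fm_length (Equal x y) = 3" "fm_length (Edge x y) = 3" "fm_length (Succ i x y) = 4"
  "fm_length (Neg \<phi>) = Suc (fm_length \<phi>)"
  "fm_length (Conj \<phi> \<psi>) = Suc (fm_length \<phi> + fm_length \<psi>)"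
  "fm_length (Disj \<phi> \<psi>) = Suc (fm_length \<phi> + fm_length \<psi>)"
  "fm_length (Exists x \<phi>) = Suc (Suc (fm_length \<phi>))"
  "fm_length (Forall x \<phi>) = Suc (Suc (fm_length \<phi>))"
  by (simp_all add: fm_length_def)

lemma qrank_le: "qrank \<phi> \<le> fm_length \<phi>"
  by (induction \<phi>) auto

text \<open>The interface between Hanf's argument and the algorithm. Index 0 of \<open>E\<close> is
  the edge relation, index \<open>Suc i\<close> the successor relation \<open>i\<close>. The
  inequality in \<open>E_slots\<close> discards the loops that stand for empty slots.
  \<open>rg p\<close> is the range of a quantifier at code position \<open>p\<close>; since inner
  quantifiers have larger positions, \<open>rg_closed\<close> lets them see all words at earlier
  choices. \<open>W_rich\<close> exceeds the size of any neighbourhood of radius at most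
  \<open>R\<close> of at most \<open>L\<close> elements.\<close>

locale restricted_evaluation = functional_structure +
  fixes G :: "'v graph" and Ss :: "('v \<times> 'v) set list" and \<nu> :: "'v \<Rightarrow> nat"
    and E :: "nat \<Rightarrow> nat \<Rightarrow> nat \<Rightarrow> bool" and slots :: "nat \<Rightarrow> nat set"
    and rg :: "nat \<Rightarrow> nat set" and W :: "nat set" and R L :: nat
  assumes k_pos: "0 < k"
    and \<nu>: "bij_betw \<nu> (verts G) {..<n}"
    and E_iff: "j \<le> length Ss \<Longrightarrow> u \<in> verts G \<Longrightarrow> v \<in> verts G \<Longrightarrow>
      (u, v) \<in> (edges G # Ss) ! j \<longleftrightarrow> E j (\<nu> u) (\<nu> v)"
    and E_slots: "j \<le> length Ss \<Longrightarrow> x < n \<Longrightarrow> y < n \<Longrightarrow>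
      E j x y \<longleftrightarrow> x \<noteq> y \<and> (\<exists>i\<in>slots j. f i x = y)"
    and slots_less: "j \<le> length Ss \<Longrightarrow> slots j \<subseteq> {..<k}"
    and W_rg: "W \<subseteq> rg p" and rg_less: "rg p \<subseteq> {..<n}"
    and rg_closed: "p < q \<Longrightarrow> b \<in> rg p \<Longrightarrow> w \<in> words k R \<Longrightarrow> fold f w b \<in> rg q"
    and W_rich: "b < n \<Longrightarrow> b \<notin> W \<Longrightarrow> L * (grow k 1 ^^ R) 1 < card {c\<in>W. same_type R b c}"
begin

lemma \<nu>_less: "a \<in> verts G \<Longrightarrow> \<nu> a < n"
  using \<nu> by (auto simp: bij_betw_def)

text \<open>Atoms are Boolean combinations of equalities between words of length at most 1, so
  radius 1 decides them.\<close>

lemma atom_sim: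
  assumes "sim r X (\<nu> \<circ> \<sigma>) \<tau>" and "1 \<le> r" and "x \<in> X" "y \<in> X" and "j \<le> length Ss"
    and "\<sigma> x \<in> verts G" "\<sigma> y \<in> verts G" "\<tau> x < n" "\<tau> y < n"
  shows "(\<sigma> x, \<sigma> y) \<in> (edges G # Ss) ! j \<longleftrightarrow> E j (\<tau> x) (\<tau> y)"
proof -
  have w: "[i] \<in> words k r" if "i \<in> slots j" for i
    using that slots_less[OF assms(5)] assms(2) by (auto simp: words_def)
  have s: "fold f u (\<nu> (\<sigma> x)) = fold f v (\<nu> (\<sigma> y)) \<longleftrightarrow> fold f u (\<tau> x) = fold f v (\<tau> y)"
    if "u \<in> words k r" "v \<in> words k r" for u v
    using assms(1,3,4) that unfolding sim_def by simp
  have "\<nu> (\<sigma> x) = \<nu> (\<sigma> y) \<longleftrightarrow> \<tau> x = \<tau> y"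
    using s[of "[]" "[]"] by simp
  moreover have "f i (\<nu> (\<sigma> x)) = \<nu> (\<sigma> y) \<longleftrightarrow> f i (\<tau> x) = \<tau> y" if "i \<in> slots j" for i
    using s[OF w[OF that], of "[]"] by simp
  ultimately show ?thesis
    using E_iff[OF assms(5-7)] E_slots[OF assms(5)] assms(6-9) \<nu>_less by auto
qed

text \<open>The forth direction answers an arbitrary vertex inside the restricted range, with
  \<open>W\<close> as the reservoir of far elements. The back direction may answer with any vertex
  of the structure.\<close>

lemma quantifier_step:
  assumes sim: "sim (3 * r) X (\<nu> \<circ> \<sigma>) \<tau>" and fin: "finite X" and r: "3 * r \<le> R"
    and X: "card X < L" and \<sigma>: "\<forall>y\<in>X. \<sigma> y \<in> verts G" and \<tau>: "\<forall>y\<in>X. \<tau> y < n"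
    and closed: "\<forall>y\<in>X. \<forall>w\<in>words k R. apply_word w (\<tau> y) \<in> rg p"
    and X': "X' = insert x (X - {x})"
  shows "a \<in> verts G \<Longrightarrow> \<exists>b\<in>rg p. sim r X' (\<nu> \<circ> \<sigma>(x := a)) (\<tau>(x := b))"
    and "b \<in> rg p \<Longrightarrow> \<exists>a\<in>verts G. sim r X' (\<nu> \<circ> \<sigma>(x := a)) (\<tau>(x := b))"
proof -
  \<comment> \<open>A quantifier may rebind a variable of \<open>X\<close>; its old value is dropped
    before the tuple is extended.\<close>
  let ?Y = "X - {x}"
  have simY: "sim (3 * r) ?Y (\<nu> \<circ> \<sigma>) \<tau>"
    using sim by (rule sim_mono) auto
  have \<sigma>Y: "\<forall>y\<in>?Y. (\<nu> \<circ> \<sigma>) y < n"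
    using \<sigma> \<nu>_less by auto
  have \<tau>Y: "\<forall>y\<in>?Y. \<tau> y < n"
    using \<tau> by auto
  have upd: "\<nu> \<circ> \<sigma>(x := a) = (\<nu> \<circ> \<sigma>)(x := \<nu> a)" for a
    by auto
  have w2: "w \<in> words k R" if "w \<in> words k (2 * r)" for w
    using that by (rule words_mono) (use r in simp)
  show "\<exists>b\<in>rg p. sim r X' (\<nu> \<circ> \<sigma>(x := a)) (\<tau>(x := b))" if a: "a \<in> verts G"
  proof -
    have rich: "card (near (2 * r) ?Y \<tau>) < card {c\<in>W. same_type r b c}" if b: "b < n" "b \<notin> W" for b
    proof -
      have "card (near (2 * r) ?Y \<tau>) \<le> card ?Y * (grow k 1 ^^ (2 * r)) 1"
        by (rule card_near_le[OF k_pos]) (use fin in simp)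
      also have "\<dots> \<le> L * (grow k 1 ^^ R) 1"
        using X r card_mono[OF fin, of ?Y]
        by (intro mult_mono grow_iter_mono[OF k_pos]) auto
      also have "\<dots> < card {c\<in>W. same_type R b c}"
        using b by (rule W_rich)
      also have "\<dots> \<le> card {c\<in>W. same_type r b c}"
      proof (rule card_mono)
        show "finite {c\<in>W. same_type r b c}"
          by (rule finite_subset[of _ "{..<n}"]) (use W_rg[of 0] rg_less[of 0] in auto)
        show "{c\<in>W. same_type R b c} \<subseteq> {c\<in>W. same_type r b c}"
          using same_type_mono[of R b _ r] r by auto
      qed
      finally show ?thesis .
    qed
    have "\<exists>b\<in>rg p. b < n \<and> sim r (insert x ?Y) ((\<nu> \<circ> \<sigma>)(x := \<nu> a)) (\<tau>(x := b))"
    proof (rule sim_extend[OF simY _ _ \<sigma>Y \<tau>Y \<nu>_less[OF a] _ rich W_rg])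
      show "near (2 * r) ?Y \<tau> \<subseteq> rg p"
        using closed w2 by (auto simp: near_def)
    qed (use fin W_rg[of 0] rg_less[of 0] in auto)
    then show ?thesis
      unfolding upd X' by blast
  qed
  show "\<exists>a\<in>verts G. sim r X' (\<nu> \<circ> \<sigma>(x := a)) (\<tau>(x := b))" if b: "b \<in> rg p"
  proof -
    have b_less: "b < n"
      using b rg_less by auto
    have "\<exists>a\<in>{..<n}. a < n \<and> sim r (insert x ?Y) (\<tau>(x := b)) ((\<nu> \<circ> \<sigma>)(x := a))"
    \<comment> \<open>With all vertices as the reservoir, the richness premise holds
      vacuously.\<close>
    proof (rule sim_extend[OF sim_sym[OF simY] _ _ \<tau>Y \<sigma>Y b_less, where W = "{..<n}"])
      show "near (2 * r) ?Y (\<nu> \<circ> \<sigma>) \<subseteq> {..<n}"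
        using \<sigma>Y by (auto simp: near_def intro: apply_word_less)
    qed (use fin in auto)
    then obtain a where a: "a < n" "sim r (insert x ?Y) (\<tau>(x := b)) ((\<nu> \<circ> \<sigma>)(x := a))"
      by auto
    obtain a' where "a' \<in> verts G" "\<nu> a' = a"
      using \<nu> a(1) by (metis bij_betw_iff_bijections lessThan_iff)
    with sim_sym[OF a(2)] show ?thesis
      unfolding upd X' by auto
  qed
qed

text \<open>The induction invariant with \<open>q\<close> nested quantifiers still to come: radius
  \<open>3 ^ q\<close>, room for \<open>q\<close> more variables within \<open>L\<close>, and all
  words of length \<open>R\<close> at the chosen values available in the ranges from position
  \<open>p\<close> on.\<close>

definition matching :: "nat \<Rightarrow> nat set \<Rightarrow> nat \<Rightarrow> (nat \<Rightarrow> 'v) \<Rightarrow> (nat \<Rightarrow> nat) \<Rightarrow> bool" where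
  "matching q X p \<sigma> \<tau> \<longleftrightarrow> finite X \<and> card X + q \<le> L \<and> 3 ^ q \<le> R \<and> sim (3 ^ q) X (\<nu> \<circ> \<sigma>) \<tau> \<and>
     (\<forall>x\<in>X. \<sigma> x \<in> verts G \<and> \<tau> x < n \<and> (\<forall>p'\<ge>p. \<forall>w\<in>words k R. apply_word w (\<tau> x) \<in> rg p'))"

lemma matching_mono:
  assumes "matching q X p \<sigma> \<tau>" and "q' \<le> q" and "p \<le> p'"
  shows "matching q' X p' \<sigma> \<tau>"
proof -
  have le: "(3::nat) ^ q' \<le> 3 ^ q"
    using assms(2) by (rule power_increasing) simp
  have sim: "sim (3 ^ q) X (\<nu> \<circ> \<sigma>) \<tau>" and R: "3 ^ q \<le> R"
    using assms(1) unfolding matching_def by blast+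
  show ?thesis
    using assms sim_mono[OF sim le order_refl] order_trans[OF le R] unfolding matching_def by auto
qed

lemma matching_update:
  assumes "matching (Suc q) X p \<sigma> \<tau>" and "a \<in> verts G" and "b \<in> rg p"
    and "sim (3 ^ q) (insert x (X - {x})) (\<nu> \<circ> \<sigma>(x := a)) (\<tau>(x := b))"
  shows "matching q (insert x X) (p + 2) (\<sigma>(x := a)) (\<tau>(x := b))"
proof -
  have "card (insert x X) \<le> Suc (card X)"
    by (rule card_insert_le_m1) simp_all
  moreover have "apply_word w b \<in> rg p'" if "p + 2 \<le> p'" "w \<in> words k R" for p' w
    using rg_closed[of p p' b w] that assms(3) by simp
  moreover have "b < n"
    using rg_less assms(3) by blast
  moreover have "sim (3 ^ q) (insert x X) (\<nu> \<circ> \<sigma>(x := a)) (\<tau>(x := b))"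
    using assms(4) by (simp only: insert_Diff_single)
  ultimately show ?thesis
    using assms(1,2) unfolding matching_def by (auto simp del: comp_apply)
qed

lemma matching_extend:
  assumes "matching (Suc q) X p \<sigma> \<tau>"
  shows "a \<in> verts G \<Longrightarrow> \<exists>b\<in>rg p. matching q (insert x X) (p + 2) (\<sigma>(x := a)) (\<tau>(x := b))"
    and "b \<in> rg p \<Longrightarrow> \<exists>a\<in>verts G. matching q (insert x X) (p + 2) (\<sigma>(x := a)) (\<tau>(x := b))"
proof -
  have "sim (3 * 3 ^ q) X (\<nu> \<circ> \<sigma>) \<tau>" "finite X" "3 * 3 ^ q \<le> R" "card X < L"
    "\<forall>y\<in>X. \<sigma> y \<in> verts G" "\<forall>y\<in>X. \<tau> y < n" "\<forall>y\<in>X. \<forall>w\<in>words k R. apply_word w (\<tau> y) \<in> rg p"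
    using assms unfolding matching_def power_Suc by auto
  note step = quantifier_step[OF this refl]
  show "a \<in> verts G \<Longrightarrow> \<exists>b\<in>rg p. matching q (insert x X) (p + 2) (\<sigma>(x := a)) (\<tau>(x := b))"
    using step(1) matching_update[OF assms] by blast
  show "b \<in> rg p \<Longrightarrow> \<exists>a\<in>verts G. matching q (insert x X) (p + 2) (\<sigma>(x := a)) (\<tau>(x := b))"
    using step(2) matching_update[OF assms] by blast
qed

text \<open>Connectives weaken the invariant by \<open>matching_mono\<close>; a quantifier spends
  one factor 3 of the radius and one variable, and \<open>matching_extend\<close> supplies both
  directions of the exchange.\<close>

theorem rsat_iff_sat:
  assumes "free_vars \<phi> \<subseteq> X" and "succ_symbols \<phi> \<subseteq> {..<length Ss}" and "matching (qrank \<phi>) X p \<sigma> \<tau>"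
  shows "sat G Ss \<sigma> \<phi> \<longleftrightarrow> rsat rg E p \<tau> \<phi>"
  using assms
proof (induction \<phi> arbitrary: X \<sigma> \<tau> p)
  case (Equal x y)
  then have sim: "sim 1 X (\<nu> \<circ> \<sigma>) \<tau>" and xy: "x \<in> X" "y \<in> X" "\<sigma> x \<in> verts G" "\<sigma> y \<in> verts G"
    by (auto simp: matching_def)
  have "\<nu> (\<sigma> x) = \<nu> (\<sigma> y) \<longleftrightarrow> \<tau> x = \<tau> y"
    using sim[unfolded sim_def, rule_format, of x y "[]" "[]"] xy by simp
  moreover have "\<nu> (\<sigma> x) = \<nu> (\<sigma> y) \<longleftrightarrow> \<sigma> x = \<sigma> y"
    using xy \<nu> by (auto simp: bij_betw_def inj_on_def)
  ultimately show ?case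
    by simp
next
  case (Edge x y)
  then show ?case
    using atom_sim[of 1 X \<sigma> \<tau> x y 0] by (simp add: matching_def)
next
  case (Succ i x y)
  then show ?case
    using atom_sim[of 1 X \<sigma> \<tau> x y "Suc i"] by (simp add: matching_def Suc_le_eq)
next
  case (Neg \<phi>)
  then show ?case
    using Neg.IH[of X "p + 1" \<sigma> \<tau>] matching_mono[OF Neg.prems(3)] by simp
next
  case (Conj \<phi> \<psi>)
  then show ?case
    using Conj.IH(1)[of X "p + 1" \<sigma> \<tau>] Conj.IH(2)[of X "p + 1 + fm_length \<phi>" \<sigma> \<tau>]
      matching_mono[OF Conj.prems(3)] by simp
next
  case (Disj \<phi> \<psi>)
  then show ?case
    using Disj.IH(1)[of X "p + 1" \<sigma> \<tau>] Disj.IH(2)[of X "p + 1 + fm_length \<phi>" \<sigma> \<tau>]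
      matching_mono[OF Disj.prems(3)] by simp
next
  case (Exists x \<phi>)
  have "sat G Ss (\<sigma>(x := a)) \<phi> \<longleftrightarrow> rsat rg E (p + 2) (\<tau>(x := b)) \<phi>"
    if "matching (qrank \<phi>) (insert x X) (p + 2) (\<sigma>(x := a)) (\<tau>(x := b))" for a b
    by (rule Exists.IH[OF _ _ that]) (use Exists.prems in auto)
  then show ?case
    using matching_extend[OF Exists.prems(3)[unfolded qrank.simps], of _ x]
    unfolding sat.simps rsat.simps by meson
next
  case (Forall x \<phi>)
  have "sat G Ss (\<sigma>(x := a)) \<phi> \<longleftrightarrow> rsat rg E (p + 2) (\<tau>(x := b)) \<phi>"
    if "matching (qrank \<phi>) (insert x X) (p + 2) (\<sigma>(x := a)) (\<tau>(x := b))" for a b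
    by (rule Forall.IH[OF _ _ that]) (use Forall.prems in auto)
  then show ?case
    using matching_extend[OF Forall.prems(3)[unfolded qrank.simps], of _ x]
    unfolding sat.simps rsat.simps by meson
qed

corollary models_iff_rsat:
  assumes "sentence (length Ss) \<phi>" and "fm_length \<phi> \<le> L" and "3 ^ fm_length \<phi> \<le> R" and "0 < n"
  shows "models G Ss \<phi> \<longleftrightarrow> rsat rg E p \<tau> \<phi>"
proof -
  have "(3::nat) ^ qrank \<phi> \<le> 3 ^ fm_length \<phi>"
    by (rule power_increasing[OF qrank_le]) simp
  then have "3 ^ qrank \<phi> \<le> R"
    using assms(3) by (rule order_trans)
  then have *: "sat G Ss \<sigma> \<phi> \<longleftrightarrow> rsat rg E p \<tau> \<phi>" for \<sigma>
    using rsat_iff_sat[of \<phi> "{}" p \<sigma> \<tau>] assms(1,2) qrank_le[of \<phi>]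
    by (simp add: sentence_def sim_def matching_def)
  \<comment> \<open>Some assignment into the universe must exist, for otherwise the quantification
    over assignments in \<open>models\<close> would be vacuous.\<close>
  obtain a where "a \<in> verts G"
    using \<nu> assms(4) by (metis bij_betw_iff_bijections lessThan_iff)
  then have "range (\<lambda>_ :: nat. a) \<subseteq> verts G"
    by auto
  then show ?thesis
    unfolding models_def * by (cases "rsat rg E p \<tau> \<phi>") (simp_all only: simp_thms not_all, blast)
qed

end

section \<open>An imperative language with arrays\<close>

text \<open>\<open>A x e\<close> reads array \<open>x\<close> at index \<open>e\<close>; scalar
  variables are entries at index 0. Only the arithmetic of the machine is offered, so no expression
  hides a superconstant cost.\<close>

datatype aexp = N nat | A nat aexp | Plus aexp aexp | Minus aexp aexp

datatype com =
    Skip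
  | Asg nat aexp aexp
  | Inp nat aexp
  | Seq com com  (infixr ";;" 60)
  | If aexp com com
  | While aexp com

type_synonym store = "nat \<Rightarrow> nat \<Rightarrow> nat"
type_synonym state = "store \<times> nat list"

fun aval :: "aexp \<Rightarrow> store \<Rightarrow> nat" where
  "aval (N c) st = c"
| "aval (A x e) st = st x (aval e st)"
| "aval (Plus a b) st = aval a st + aval b st"
| "aval (Minus a b) st = aval a st - aval b st"

definition put :: "nat \<Rightarrow> nat \<Rightarrow> nat \<Rightarrow> store \<Rightarrow> store" where
  "put x i a st = st(x := (st x)(i := a))"

text \<open>Only loop iterations are charged: every other construct contributes a constant that depends
  on the program alone, which is accounted for in \<open>compile_correct\<close>.\<close>

inductive exec :: "com \<Rightarrow> state \<Rightarrow> nat \<Rightarrow> state \<Rightarrow> bool" where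
  exec_Skip: "exec Skip s 0 s"
| exec_Asg: "exec (Asg x e1 e2) (st, w) 0 (put x (aval e1 st) (aval e2 st) st, w)"
| exec_Inp: "exec (Inp x e) (st, w) 0
    (put x (aval e st) (case w of [] \<Rightarrow> 0 | a # _ \<Rightarrow> a) st, tl w)"
| exec_Seq: "exec c1 s n s' \<Longrightarrow> exec c2 s' m s'' \<Longrightarrow> exec (c1 ;; c2) s (n + m) s''"
| exec_IfT: "aval e (fst s) \<noteq> 0 \<Longrightarrow> exec c1 s n s' \<Longrightarrow> exec (If e c1 c2) s n s'"
| exec_IfF: "aval e (fst s) = 0 \<Longrightarrow> exec c2 s n s' \<Longrightarrow> exec (If e c1 c2) s n s'"
| exec_WhileF: "aval e (fst s) = 0 \<Longrightarrow> exec (While e c) s 0 s"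
| exec_WhileT: "aval e (fst s) \<noteq> 0 \<Longrightarrow> exec c s n s' \<Longrightarrow> exec (While e c) s' m s'' \<Longrightarrow>
    exec (While e c) s (Suc (n + m)) s''"

inductive_cases exec_SkipE: "exec Skip s n s'"
inductive_cases exec_AsgE: "exec (Asg x e1 e2) s n s'"
inductive_cases exec_InpE: "exec (Inp x e) s n s'"
inductive_cases exec_SeqE: "exec (c1 ;; c2) s n s'"
inductive_cases exec_IfE: "exec (If e c1 c2) s n s'"
inductive_cases exec_WhileE: "exec (While e c) s n s'"

section \<open>Compilation to random access machines\<close>

text \<open>Entry \<open>i\<close> of array \<open>x < 63\<close> lives in register \<open>64 i + x\<close>; the registers \<open>64 k + 63\<close> hold the
  intermediate results of expression evaluation.\<close>

definition tmp :: "nat \<Rightarrow> nat" where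
  "tmp k = 64 * k + 63"

lemma tmp_eq [simp]: "tmp j = tmp k \<longleftrightarrow> j = k"
  by (simp add: tmp_def)

text \<open>Six doublings multiply the index by 64, as the machine cannot multiply; adding the array
  name then gives the register number.\<close>

definition addr_code :: "nat \<Rightarrow> nat \<Rightarrow> instr list" where
  "addr_code x k = (let t = tmp k; i = Add t t t in
     [i, i, i, i, i, i, Const (tmp (Suc k)) x, Add t t (tmp (Suc k))])"

fun aexp_code :: "aexp \<Rightarrow> nat \<Rightarrow> instr list" where
  "aexp_code (N c) k = [Const (tmp k) c]"
| "aexp_code (A x e) k = aexp_code e k @ addr_code x k @ [Load (tmp k) (tmp k)]"
| "aexp_code (Plus a b) k =
     aexp_code a k @ aexp_code b (Suc k) @ [Add (tmp k) (tmp k) (tmp (Suc k))]"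
| "aexp_code (Minus a b) k =
     aexp_code a k @ aexp_code b (Suc k) @ [Sub (tmp k) (tmp k) (tmp (Suc k))]"

abbreviation jump :: "nat \<Rightarrow> instr list" where
  "jump m \<equiv> [Const (tmp 0) 1, JumpPos (tmp 0) m]"

text \<open>Given independently of the load address, so that \<open>compile\<close> can compute
  forward jump targets before the code exists.\<close>

fun code_size :: "com \<Rightarrow> nat" where
  "code_size Skip = 0"
| "code_size (Asg x e1 e2) = length (aexp_code e1 0) + 8 + length (aexp_code e2 1) + 1"
| "code_size (Inp x e) = length (aexp_code e 0) + 8 + 2"
| "code_size (c1 ;; c2) = code_size c1 + code_size c2"
| "code_size (If e c1 c2) = length (aexp_code e 0) + 1 + code_size c2 + 2 + code_size c1"
| "code_size (While e c) = length (aexp_code e 0) + 3 + code_size c + 2"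

text \<open>Jump targets are absolute, whence the load address \<open>m\<close>. The only jump is
  taken on a nonzero value, so the else branch comes first and unconditional jumps test a constant
  1.\<close>

fun compile :: "com \<Rightarrow> nat \<Rightarrow> instr list" where
  "compile Skip m = []"
| "compile (Asg x e1 e2) m =
     aexp_code e1 0 @ addr_code x 0 @ aexp_code e2 1 @ [Store (tmp 0) (tmp 1)]"
| "compile (Inp x e) m = aexp_code e 0 @ addr_code x 0 @ [Read (tmp 1), Store (tmp 0) (tmp 1)]"
| "compile (c1 ;; c2) m = compile c1 m @ compile c2 (m + code_size c1)"
| "compile (If e c1 c2) m =
     (let l = m + length (aexp_code e 0) + 1; l' = l + code_size c2 + 2 in
      aexp_code e 0 @ [JumpPos (tmp 0) l'] @ compile c2 l @ jump (l' + code_size c1) @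
      compile c1 l')"
| "compile (While e c) m =
     (let l = m + length (aexp_code e 0) + 3 in
      aexp_code e 0 @ [JumpPos (tmp 0) l] @ jump (l + code_size c + 2) @ compile c l @ jump m)"

lemma length_addr_code [simp]: "length (addr_code x k) = 8"
  by (simp add: addr_code_def Let_def)

lemma length_compile [simp]: "length (compile c m) = code_size c"
  by (induction c arbitrary: m) (auto simp: Let_def)

fun names_aexp :: "aexp \<Rightarrow> nat set" where
  "names_aexp (N c) = {}"
| "names_aexp (A x e) = insert x (names_aexp e)"
| "names_aexp (Plus a b) = names_aexp a \<union> names_aexp b"
| "names_aexp (Minus a b) = names_aexp a \<union> names_aexp b"

fun names :: "com \<Rightarrow> nat set" where
  "names Skip = {}"
| "names (Asg x e1 e2) = insert x (names_aexp e1 \<union> names_aexp e2)"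
| "names (Inp x e) = insert x (names_aexp e)"
| "names (c1 ;; c2) = names c1 \<union> names c2"
| "names (If e c1 c2) = names_aexp e \<union> names c1 \<union> names c2"
| "names (While e c) = names_aexp e \<union> names c"

section \<open>Simulation of the imperative language by code fragments of a larger program\<close>

definition code_at :: "program \<Rightarrow> nat \<Rightarrow> instr list \<Rightarrow> bool" where
  "code_at P m is \<longleftrightarrow> (\<exists>xs ys. P = xs @ is @ ys \<and> length xs = m)"

lemma code_at_append: "code_at P m (xs @ ys) \<longleftrightarrow> code_at P m xs \<and> code_at P (m + length xs) ys"
proof
  assume "code_at P m (xs @ ys)"
  then obtain us vs where "P = us @ (xs @ ys) @ vs" "length us = m"
    by (auto simp: code_at_def)
  then have "P = us @ xs @ (ys @ vs)" "P = (us @ xs) @ ys @ vs" "length (us @ xs) = m + length xs"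
    by simp_all
  then show "code_at P m xs \<and> code_at P (m + length xs) ys"
    unfolding code_at_def using \<open>length us = m\<close> by blast
next
  assume "code_at P m xs \<and> code_at P (m + length xs) ys"
  then obtain us vs us' vs' where 1: "P = us @ xs @ vs" "length us = m"
    and 2: "P = us' @ ys @ vs'" "length us' = m + length xs"
    unfolding code_at_def by blast
  then have "(us @ xs) @ vs = us' @ (ys @ vs')" "length (us @ xs) = length us'"
    by simp_all
  then have "vs = ys @ vs'"
    by (metis append_eq_append_conv)
  then show "code_at P m (xs @ ys)"
    unfolding code_at_def using 1 by auto
qed

lemma code_at_Cons: "code_at P m (i # is) \<longleftrightarrow> code_at P m [i] \<and> code_at P (Suc m) is"
  using code_at_append[of P m "[i]" "is"] by simp

definition represents :: "state \<Rightarrow> config \<Rightarrow> bool" where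
  "represents s c \<longleftrightarrow> (\<forall>x<63. \<forall>i. reg c (64 * i + x) = fst s x i) \<and> input c = snd s"

definition runs :: "program \<Rightarrow> config \<Rightarrow> nat \<Rightarrow> config \<Rightarrow> bool" where
  "runs P c t c' \<longleftrightarrow> (step P ^^ t) c = c'"

lemma runs_0: "runs P c 0 c"
  by (simp add: runs_def)

lemma runs_trans: "runs P c t c' \<Longrightarrow> runs P c' t' c'' \<Longrightarrow> runs P c (t + t') c''"
  by (auto simp: runs_def funpow_add[of t' t, unfolded add.commute[of t' t]])

lemma runs_instr: "code_at P (pc c) [i] \<Longrightarrow> runs P c (Suc 0) (exec_instr i c)"
  by (auto simp: runs_def code_at_def step_def halted_def nth_append)


fun is_jump :: "instr \<Rightarrow> bool" where
  "is_jump (JumpPos i m) = True"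
| "is_jump _ = False"

lemma pc_exec_instr: "\<not> is_jump i \<Longrightarrow> pc (exec_instr i c) = Suc (pc c)"
  by (cases i) (auto simp: set_reg_def split: list.split)

lemma runs_instrs:
  "code_at P (pc c) is \<Longrightarrow> \<forall>i\<in>set is. \<not> is_jump i \<Longrightarrow>
    runs P c (length is) (fold exec_instr is c) \<and> pc (fold exec_instr is c) = pc c + length is"
proof (induction "is" arbitrary: c)
  case Nil
  then show ?case by (simp add: runs_0)
next
  case (Cons i "is")
  from Cons.prems have "runs P c (Suc 0) (exec_instr i c)"
    by (subst (asm) code_at_Cons) (simp add: runs_instr)
  moreover from Cons.prems have "code_at P (pc (exec_instr i c)) is"
    by (subst (asm) code_at_Cons) (simp add: pc_exec_instr)
  ultimately show ?case
    using Cons runs_trans[of P c "Suc 0" "exec_instr i c"] by (simp add: pc_exec_instr)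
qed

lemma reg_set_reg: "reg (set_reg i a c) = (reg c)(i := a)"
  and pc_set_reg: "pc (set_reg i a c) = Suc (pc c)"
  and input_set_reg: "input (set_reg i a c) = input c"
  by (simp_all add: set_reg_def)

lemmas set_reg_simps = reg_set_reg pc_set_reg input_set_reg

lemma address_inj:
  assumes "x < 64" and "y < 64"
  shows "64 * i + x = 64 * j + (y :: nat) \<longleftrightarrow> i = j \<and> x = y"
proof
  assume eq: "64 * i + x = 64 * j + y"
  have "(64 * i + x) div 64 = i" "(64 * i + x) mod 64 = x"
    "(64 * j + y) div 64 = j" "(64 * j + y) mod 64 = y"
    using assms by simp_all
  with eq show "i = j \<and> x = y"
    by metis
qed simp

lemma address_neq_tmp: "x < 63 \<Longrightarrow> 64 * i + x \<noteq> tmp k"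
  using address_inj[of x 63 i k] by (simp add: tmp_def)

lemma represents_set_tmp: "represents s c \<Longrightarrow> represents s (set_reg (tmp k) a c)"
  using address_neq_tmp by (simp add: represents_def set_reg_simps)

lemma represents_put:
  assumes "represents (st, w) c" and "x < 63" and "reg c' = (reg c)(64 * i + x := a)"
    and "input c' = w'"
  shows "represents (put x i a st, w') c'"
  using assms by (auto simp: represents_def put_def address_inj)

lemma exec_double: "exec_instr (Add i i i) c = set_reg i (2 * reg c i) c"
  and exec_Const_Add: "exec_instr (Add i i j) (exec_instr (Const j a) c) =
    set_reg i ((if i = j then a else reg c i) + a) (set_reg j a c)"
  by (simp_all add: reg_set_reg mult_2)

lemma runs_addr_code:
  assumes "code_at P (pc c) (addr_code x k)" and "represents s c"
  shows "\<exists>c'. runs P c 8 c' \<and> pc c' = pc c + 8 \<and> represents s c' \<and>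
    reg c' (tmp k) = 64 * reg c (tmp k) + x \<and> (\<forall>j<k. reg c' (tmp j) = reg c (tmp j))"
proof -
  have "\<forall>i\<in>set (addr_code x k). \<not> is_jump i"
    by (auto simp: addr_code_def Let_def)
  from runs_instrs[OF assms(1) this]
  have "runs P c 8 (fold exec_instr (addr_code x k) c)"
    and "pc (fold exec_instr (addr_code x k) c) = pc c + 8"
    by simp_all
  moreover have "represents s (fold exec_instr (addr_code x k) c)"
    using assms(2)
    by (simp add: addr_code_def Let_def exec_double exec_Const_Add represents_set_tmp
        del: exec_instr.simps)
  moreover have "reg (fold exec_instr (addr_code x k) c) (tmp k) = 64 * reg c (tmp k) + x"
    "\<forall>j<k. reg (fold exec_instr (addr_code x k) c) (tmp j) = reg c (tmp j)"
    by (simp_all add: addr_code_def Let_def exec_double exec_Const_Add reg_set_reg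
        del: exec_instr.simps)
  ultimately show ?thesis
    by blast
qed

text \<open>Temporaries form a stack: the second operand is computed one level higher and must
  preserve all lower levels, among them the value of the first operand.\<close>

lemma runs_binary_code:
  assumes "code_at P (pc c) (xs @ ys @ [i])" and rep: "represents s c"
    and a: "\<And>c. code_at P (pc c) xs \<Longrightarrow> represents s c \<Longrightarrow> \<exists>c'. runs P c (length xs) c' \<and>
      pc c' = pc c + length xs \<and> represents s c' \<and> reg c' (tmp k) = a \<and>
      (\<forall>j<k. reg c' (tmp j) = reg c (tmp j))"
    and b: "\<And>c. code_at P (pc c) ys \<Longrightarrow> represents s c \<Longrightarrow> \<exists>c'. runs P c (length ys) c' \<and>
      pc c' = pc c + length ys \<and> represents s c' \<and> reg c' (tmp (Suc k)) = b \<and>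
      (\<forall>j<Suc k. reg c' (tmp j) = reg c (tmp j))"
    and i: "\<And>c. exec_instr i c = set_reg (tmp k) (g (reg c (tmp k)) (reg c (tmp (Suc k)))) c"
  shows "\<exists>c'. runs P c (length (xs @ ys @ [i])) c' \<and> pc c' = pc c + length (xs @ ys @ [i]) \<and>
    represents s c' \<and> reg c' (tmp k) = g a b \<and> (\<forall>j<k. reg c' (tmp j) = reg c (tmp j))"
proof -
  have code: "code_at P (pc c) xs" "code_at P (pc c + length xs) ys"
    "code_at P (pc c + length xs + length ys) [i]"
    using assms(1) by (simp_all add: code_at_append)
  obtain c1 where c1: "runs P c (length xs) c1" "pc c1 = pc c + length xs" "represents s c1"
    "reg c1 (tmp k) = a" "\<forall>j<k. reg c1 (tmp j) = reg c (tmp j)"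
    using a[OF code(1) rep] by blast
  obtain c2 where c2: "runs P c1 (length ys) c2" "pc c2 = pc c1 + length ys" "represents s c2"
    "reg c2 (tmp (Suc k)) = b" "\<forall>j<Suc k. reg c2 (tmp j) = reg c1 (tmp j)"
    using b[of c1] code(2) c1 by auto
  have "runs P c2 (Suc 0) (exec_instr i c2)"
    by (rule runs_instr) (use code(3) c1 c2 in simp)
  then show ?thesis
    using runs_trans[OF runs_trans[OF c1(1) c2(1)], of "Suc 0"] c1 c2
    by (intro exI[of _ "exec_instr i c2"]) (auto simp: i represents_set_tmp set_reg_simps add.assoc)
qed

lemma runs_aexp_code:
  assumes "code_at P (pc c) (aexp_code e k)" and "represents s c" and "names_aexp e \<subseteq> {..<63}"
  shows "\<exists>c'. runs P c (length (aexp_code e k)) c' \<and> pc c' = pc c + length (aexp_code e k) \<and>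
    represents s c' \<and> reg c' (tmp k) = aval e (fst s) \<and> (\<forall>j<k. reg c' (tmp j) = reg c (tmp j))"
  using assms
proof (induction e arbitrary: k c)
  case (N a)
  then show ?case
    by (intro exI[of _ "set_reg (tmp k) a c"])
      (use runs_instr[of P c "Const (tmp k) a"] in
        \<open>auto simp: represents_set_tmp set_reg_simps\<close>)
next
  case (A x e)
  then obtain c1 where c1: "runs P c (length (aexp_code e k)) c1"
    "pc c1 = pc c + length (aexp_code e k)" "represents s c1" "reg c1 (tmp k) = aval e (fst s)"
    "\<forall>j<k. reg c1 (tmp j) = reg c (tmp j)"
    by (auto simp: code_at_append) blast
  obtain c2 where c2: "runs P c1 8 c2" "pc c2 = pc c1 + 8" "represents s c2"
    "reg c2 (tmp k) = 64 * aval e (fst s) + x" "\<forall>j<k. reg c2 (tmp j) = reg c1 (tmp j)"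
    using runs_addr_code[of P c1 x k s] A.prems c1 by (auto simp: code_at_append)
  have "runs P c2 (Suc 0) (exec_instr (Load (tmp k) (tmp k)) c2)"
    by (rule runs_instr) (use A.prems c1 c2 in \<open>auto simp: code_at_append add.assoc\<close>)
  moreover have "reg c2 (reg c2 (tmp k)) = fst s x (aval e (fst s))"
    using c2(3,4) A.prems(3) by (simp add: represents_def)
  ultimately show ?case
    using runs_trans[OF runs_trans[OF c1(1) c2(1)], of "Suc 0"] c1 c2
    by (intro exI[of _ "exec_instr (Load (tmp k) (tmp k)) c2"])
      (simp add: represents_set_tmp set_reg_simps add.commute)
next
  case (Plus a b)
  then show ?case
    unfolding aexp_code.simps aval.simps by (intro runs_binary_code[where g = "(+)"]) auto
next
  case (Minus a b)
  then show ?case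
    unfolding aexp_code.simps aval.simps by (intro runs_binary_code[where g = "(-)"]) auto
qed

lemma runs_jump:
  assumes "code_at P (pc c) (jump m)" and "represents s c"
  shows "\<exists>c'. runs P c 2 c' \<and> pc c' = m \<and> represents s c'"
proof -
  let ?c = "set_reg (tmp 0) 1 c"
  have "runs P c (Suc 0) ?c" "runs P ?c (Suc 0) (?c\<lparr>pc := m\<rparr>)"
    using assms(1) runs_instr[of P c "Const (tmp 0) 1"] runs_instr[of P ?c "JumpPos (tmp 0) m"]
    by (simp_all add: code_at_Cons[of _ _ _ "[_]"] set_reg_simps)
  from runs_trans[OF this] represents_set_tmp[OF assms(2), of 0 1]
  have "runs P c 2 (?c\<lparr>pc := m\<rparr>)" "represents s (?c\<lparr>pc := m\<rparr>)"
    by (simp_all add: represents_def numeral_2_eq_2)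
  then show ?thesis
    by (intro exI[of _ "?c\<lparr>pc := m\<rparr>"]) simp
qed

lemma runs_JumpPos:
  assumes "code_at P (pc c) [JumpPos (tmp 0) m]" and "represents s c"
  shows "\<exists>c'. runs P c 1 c' \<and> pc c' = (if reg c (tmp 0) > 0 then m else Suc (pc c)) \<and>
    represents s c'"
  by (rule exI[of _ "exec_instr (JumpPos (tmp 0) m) c"])
    (use runs_instr[OF assms(1)] assms(2) in \<open>auto simp: represents_def\<close>)

lemma runs_branch:
  assumes "code_at P (pc c) (aexp_code e 0 @ [JumpPos (tmp 0) m])" and "represents s c"
    and "names_aexp e \<subseteq> {..<63}"
  shows "\<exists>c'. runs P c (length (aexp_code e 0) + 1) c' \<and> represents s c' \<and>
    pc c' = (if aval e (fst s) \<noteq> 0 then m else pc c + length (aexp_code e 0) + 1)"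
proof -
  from assms obtain c1 where c1: "runs P c (length (aexp_code e 0)) c1"
    "pc c1 = pc c + length (aexp_code e 0)" "represents s c1" "reg c1 (tmp 0) = aval e (fst s)"
    using runs_aexp_code[of P c e 0 s] by (auto simp: code_at_append)
  moreover from assms c1 obtain c2 where "runs P c1 1 c2" "represents s c2"
    "pc c2 = (if reg c1 (tmp 0) > 0 then m else Suc (pc c1))"
    using runs_JumpPos[of P c1 m s] by (auto simp: code_at_append)
  ultimately show ?thesis
    using runs_trans[OF c1(1), of 1 c2] by (intro exI[of _ c2]) auto
qed

lemma code_at_If:
  assumes "code_at P m (compile (If e c1 c2) m)"
  defines "l \<equiv> m + length (aexp_code e 0) + 1"
  defines "l' \<equiv> l + code_size c2 + 2"
  shows "code_at P m (aexp_code e 0 @ [JumpPos (tmp 0) l'])" "code_at P l (compile c2 l)"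
    "code_at P (l + code_size c2) (jump (l' + code_size c1))" "code_at P l' (compile c1 l')"
  using assms(1)
  unfolding compile.simps Let_def code_at_append length_append length_compile list.size l_def l'_def
  by (simp_all add: eval_nat_numeral add.assoc)

lemma code_at_While:
  assumes "code_at P m (compile (While e q) m)"
  defines "l \<equiv> m + length (aexp_code e 0) + 3"
  shows "code_at P m (aexp_code e 0 @ [JumpPos (tmp 0) l])"
    "code_at P (m + length (aexp_code e 0) + 1) (jump (m + code_size (While e q)))"
    "code_at P l (compile q l)" "code_at P (l + code_size q) (jump m)"
  using assms(1)
  unfolding compile.simps Let_def code_at_append length_append length_compile list.size l_def
  by (simp_all add: eval_nat_numeral add.assoc)

text \<open>Between two counted loop iterations every instruction of the program runs at most once,
  so \<open>n\<close> iterations cost at most \<open>n + 1\<close> times the size of the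
  code.\<close>

theorem compile_correct:
  assumes "exec p s n s'" and "code_at P m (compile p m)" and "represents s c" and "pc c = m"
    and "names p \<subseteq> {..<63}"
  shows "\<exists>t c'. t \<le> code_size p * (n + 1) \<and> runs P c t c' \<and> represents s' c' \<and>
    pc c' = m + code_size p"
  using assms
proof (induction arbitrary: m c rule: exec.induct)
  case (exec_Skip s)
  then show ?case
    by (intro exI[of _ 0] exI[of _ c]) (simp add: runs_0)
next
  case (exec_Asg x e1 e2 st w)
  note code = exec_Asg.prems(1)[simplified, simplified code_at_append, simplified]
  from exec_Asg.prems code obtain c1 where c1: "runs P c (length (aexp_code e1 0)) c1"
    "pc c1 = m + length (aexp_code e1 0)" "represents (st, w) c1" "reg c1 (tmp 0) = aval e1 st"
    using runs_aexp_code[of P c e1 0 "(st, w)"] by auto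
  obtain c2 where c2: "runs P c1 8 c2" "pc c2 = pc c1 + 8" "represents (st, w) c2"
    "reg c2 (tmp 0) = 64 * aval e1 st + x"
    using runs_addr_code[of P c1 x 0 "(st, w)"] code c1 by auto
  obtain c3 where c3: "runs P c2 (length (aexp_code e2 1)) c3"
    "pc c3 = pc c2 + length (aexp_code e2 1)" "represents (st, w) c3" "reg c3 (tmp 1) = aval e2 st"
    "reg c3 (tmp 0) = 64 * aval e1 st + x"
    using runs_aexp_code[of P c2 e2 1 "(st, w)"] code c1 c2 exec_Asg.prems by (auto simp: add.assoc)
  let ?i = "Store (tmp 0) (tmp 1)"
  have "runs P c3 (Suc 0) (exec_instr ?i c3)"
    by (rule runs_instr) (use code c1 c2 c3 in \<open>auto simp: add.assoc\<close>)
  from runs_trans[OF runs_trans[OF runs_trans[OF c1(1) c2(1)] c3(1)] this]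
  have "runs P c (code_size (Asg x e1 e2)) (exec_instr ?i c3)"
    by (simp add: add.commute add.left_commute)
  moreover have "represents (put x (aval e1 st) (aval e2 st) st, w) (exec_instr ?i c3)"
    by (rule represents_put[OF c3(3)])
      (use exec_Asg.prems c3 in \<open>auto simp: set_reg_simps represents_def\<close>)
  moreover have "pc (exec_instr ?i c3) = m + code_size (Asg x e1 e2)"
    using c1 c2 c3 by (simp add: set_reg_simps)
  ultimately show ?case
    by (metis add_0 mult.right_neutral order_refl)
next
  case (exec_Inp x e st w)
  note code = exec_Inp.prems(1)[simplified, simplified code_at_append, simplified,
      simplified code_at_Cons[of _ _ _ "[_]"]]
  from exec_Inp.prems code obtain c1 where c1: "runs P c (length (aexp_code e 0)) c1"
    "pc c1 = m + length (aexp_code e 0)" "represents (st, w) c1" "reg c1 (tmp 0) = aval e st"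
    using runs_aexp_code[of P c e 0 "(st, w)"] by auto
  obtain c2 where c2: "runs P c1 8 c2" "pc c2 = pc c1 + 8" "represents (st, w) c2"
    "reg c2 (tmp 0) = 64 * aval e st + x"
    using runs_addr_code[of P c1 x 0 "(st, w)"] code c1 by auto
  let ?i = "Read (tmp 1)" and ?j = "Store (tmp 0) (tmp 1)"
  let ?a = "case w of [] \<Rightarrow> 0 | a # _ \<Rightarrow> a"
  let ?c3 = "exec_instr ?i c2"
  have in2: "input c2 = w"
    using c2 by (simp add: represents_def)
  have c3: "pc ?c3 = Suc (pc c2)" "input ?c3 = tl w" "reg ?c3 = (reg c2)(tmp 1 := ?a)"
    using in2 by (auto simp: set_reg_simps split: list.split)
  have rep3: "represents (st, tl w) ?c3"
    using represents_set_tmp[OF c2(3), of 1 ?a] c3 by (simp add: represents_def set_reg_simps)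
  have "runs P c2 (Suc 0) ?c3"
    by (rule runs_instr) (use code c1 c2 in \<open>auto simp: add.assoc\<close>)
  moreover have "runs P ?c3 (Suc 0) (exec_instr ?j ?c3)"
    by (rule runs_instr) (use code c1 c2 c3(1) in \<open>simp add: add.assoc\<close>)
  ultimately have "runs P c (code_size (Inp x e)) (exec_instr ?j ?c3)"
    using runs_trans[OF runs_trans[OF runs_trans[OF c1(1) c2(1)], of "Suc 0" ?c3], of "Suc 0"]
    by (simp del: exec_instr.simps)
  moreover have "represents (put x (aval e st) ?a st, tl w) (exec_instr ?j ?c3)"
    by (rule represents_put[OF rep3])
      (use exec_Inp.prems c2 c3 in \<open>auto simp: set_reg_simps simp del: exec_instr.simps(7)\<close>)
  moreover have "pc (exec_instr ?j ?c3) = m + code_size (Inp x e)"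
    using c1 c2 c3 by (simp add: set_reg_simps del: exec_instr.simps(7))
  ultimately show ?case
    by (metis add_0 mult.right_neutral order_refl)
next
  case (exec_Seq c1 s n s' c2 k s'')
  from exec_Seq.IH(1)[of m c] exec_Seq.prems obtain t1 d1 where
    1: "t1 \<le> code_size c1 * (n + 1)" "runs P c t1 d1" "represents s' d1" "pc d1 = m + code_size c1"
    by (auto simp: code_at_append)
  from exec_Seq.IH(2)[of "m + code_size c1" d1] exec_Seq.prems 1 obtain t2 d2 where
    2: "t2 \<le> code_size c2 * (k + 1)" "runs P d1 t2 d2" "represents s'' d2"
    "pc d2 = m + code_size c1 + code_size c2"
    by (auto simp: code_at_append)
  have "t1 + t2 \<le> code_size (c1 ;; c2) * (n + k + 1)"
    using 1(1) 2(1) by (simp add: algebra_simps)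
  with 1 2 runs_trans[OF 1(2) 2(2)] show ?case
    by (intro exI[of _ "t1 + t2"] exI[of _ d2]) simp
next
  case (exec_IfT e s c1 n s' c2)
  define l where "l = m + length (aexp_code e 0) + 1 + code_size c2 + 2"
  note code = code_at_If[OF exec_IfT.prems(1)]
  obtain d where d: "runs P c (length (aexp_code e 0) + 1) d" "represents s d" "pc d = l"
    using runs_branch[OF code(1)[folded exec_IfT.prems(3)] exec_IfT.prems(2)] exec_IfT.hyps(1)
      exec_IfT.prems(3,4)
    by (auto simp: l_def)
  from exec_IfT.IH[of l d] d code exec_IfT.prems obtain t d' where
    d': "t \<le> code_size c1 * (n + 1)" "runs P d t d'" "represents s' d'" "pc d' = l + code_size c1"
    by (auto simp: l_def)
  have "length (aexp_code e 0) + 1 + t \<le> code_size (If e c1 c2) * (n + 1)"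
    using d'(1) by (simp add: algebra_simps)
  with d d' runs_trans[OF d(1) d'(2)] show ?case
    by (intro exI[of _ "length (aexp_code e 0) + 1 + t"] exI[of _ d']) (simp add: l_def)
next
  case (exec_IfF e s c2 n s' c1)
  define l where "l = m + length (aexp_code e 0) + 1"
  note code = code_at_If[OF exec_IfF.prems(1)]
  obtain d where d: "runs P c (length (aexp_code e 0) + 1) d" "represents s d" "pc d = l"
    using runs_branch[OF code(1)[folded exec_IfF.prems(3)] exec_IfF.prems(2)] exec_IfF.hyps(1)
      exec_IfF.prems(3,4)
    by (auto simp: l_def)
  from exec_IfF.IH[of l d] d code exec_IfF.prems obtain t d' where
    d': "t \<le> code_size c2 * (n + 1)" "runs P d t d'" "represents s' d'" "pc d' = l + code_size c2"
    by (auto simp: l_def)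
  obtain d'' where d'': "runs P d' 2 d''" "represents s' d''"
    "pc d'' = m + code_size (If e c1 c2)"
    using runs_jump[OF _ d'(3)] d'(4) code(3) by (force simp: l_def)
  have "length (aexp_code e 0) + 1 + t + 2 \<le> code_size (If e c1 c2) * (n + 1)"
    using d'(1) by (simp add: algebra_simps)
  with d d' d'' runs_trans[OF runs_trans[OF d(1) d'(2)] d''(1)] show ?case
    by (intro exI[of _ "length (aexp_code e 0) + 1 + t + 2"] exI[of _ d'']) simp
next
  case (exec_WhileF e s q)
  define l where "l = m + length (aexp_code e 0) + 1"
  note code = code_at_While[OF exec_WhileF.prems(1)]
  obtain d where d: "runs P c (length (aexp_code e 0) + 1) d" "represents s d" "pc d = l"
    using runs_branch[OF code(1)[folded exec_WhileF.prems(3)] exec_WhileF.prems(2)] exec_WhileF.hyps(1)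
      exec_WhileF.prems(3,4)
    by (auto simp: l_def)
  obtain d' where d': "runs P d 2 d'" "represents s d'" "pc d' = m + code_size (While e q)"
    using runs_jump[OF _ d(2)] d(3) code(2) by (metis l_def)
  with d runs_trans[OF d(1) d'(1)] show ?case
    by (intro exI[of _ "length (aexp_code e 0) + 1 + 2"] exI[of _ d']) simp
next
  case (exec_WhileT e s q n s' k s'')
  define l where "l = m + length (aexp_code e 0) + 3"
  note code = code_at_While[OF exec_WhileT.prems(1)]
  obtain d where d: "runs P c (length (aexp_code e 0) + 1) d" "represents s d" "pc d = l"
    using runs_branch[OF code(1)[folded exec_WhileT.prems(3)] exec_WhileT.prems(2)] exec_WhileT.hyps(1)
      exec_WhileT.prems(3,4)
    by (auto simp: l_def)
  from exec_WhileT.IH(1)[of l d] d code exec_WhileT.prems obtain t d' where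
    d': "t \<le> code_size q * (n + 1)" "runs P d t d'" "represents s' d'" "pc d' = l + code_size q"
    by (auto simp: l_def)
  obtain d'' where d'': "runs P d' 2 d''" "represents s' d''" "pc d'' = m"
    using runs_jump[OF _ d'(3), of P m] d'(4) code(4) by (auto simp: l_def)
  from exec_WhileT.IH(2)[of m d''] d'' exec_WhileT.prems obtain t' c' where
    c': "t' \<le> code_size (While e q) * (k + 1)" "runs P d'' t' c'" "represents s'' c'"
    "pc c' = m + code_size (While e q)"
    by auto
  have "length (aexp_code e 0) + 1 + t + 2 \<le> code_size (While e q) * (n + 1)"
    using d'(1) by (simp add: algebra_simps)
  \<comment> \<open>An iteration whose body takes \<open>n\<close> ticks is charged
    \<open>n + 1\<close> copies of the loop; the remaining \<open>k + 1\<close> copies pay for the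
    rest of the run.\<close>
  then have "length (aexp_code e 0) + 1 + t + 2 + t' \<le> code_size (While e q) * (n + 1 + (k + 1))"
    using c'(1) by (simp only: add_mult_distrib2)
  with c' runs_trans[OF runs_trans[OF runs_trans[OF d(1) d'(2)] d''(1)] c'(2)] show ?case
    by (intro exI[of _ "length (aexp_code e 0) + 1 + t + 2 + t'"] exI[of _ c'])
      (simp add: add.commute add.left_commute)
qed

corollary exec_answers_within:
  assumes "exec p (\<lambda>_ _. 0, w) n (st, w')" and "names p \<subseteq> {..<63}"
    and "code_size p * (n + 1) \<le> T" and "st 0 0 \<noteq> 0 \<longleftrightarrow> b"
  shows "answers_within (compile p 0) w T b"
proof -
  have "code_at (compile p 0) 0 (compile p 0)"
    by (auto simp: code_at_def)
  moreover have "represents (\<lambda>_ _. 0, w) (init_config w)"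
    by (simp add: represents_def init_config_def)
  ultimately obtain t c where "t \<le> code_size p * (n + 1)" "runs (compile p 0) (init_config w) t c"
    "represents (st, w') c" "pc c = code_size p"
    using compile_correct[OF assms(1), of "compile p 0" 0 "init_config w"] assms(2)
    by (auto simp: init_config_def)
  moreover from this have "reg c 0 = st 0 0"
    unfolding represents_def by (metis add_0 fst_conv mult_0_right zero_less_numeral)
  ultimately show ?thesis
    using assms(3,4) unfolding answers_within_def
    by (intro exI[of _ t]) (auto simp: runs_def halted_def Let_def)
qed

section \<open>Reasoning about programs\<close>

text \<open>Total correctness: \<open>exec\<close> is a big-step relation, so termination is part of
  the claim, and the postcondition also sees the number of loop iterations.\<close>

definition wp :: "com \<Rightarrow> (nat \<Rightarrow> state \<Rightarrow> bool) \<Rightarrow> state \<Rightarrow> bool" where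
  "wp c Q s \<longleftrightarrow> (\<exists>n s'. exec c s n s' \<and> Q n s')"

lemma wp_Skip [simp]: "wp Skip Q s \<longleftrightarrow> Q 0 s"
  unfolding wp_def by (blast intro: exec_Skip elim: exec_SkipE)

lemma wp_Asg [simp]: "wp (Asg x e1 e2) Q (st, w) \<longleftrightarrow> Q 0 (put x (aval e1 st) (aval e2 st) st, w)"
  by (auto simp: wp_def intro: exec_Asg elim: exec_AsgE)

lemma wp_Inp [simp]: "wp (Inp x e) Q (st, w) \<longleftrightarrow>
    Q 0 (put x (aval e st) (case w of [] \<Rightarrow> 0 | a # _ \<Rightarrow> a) st, tl w)"
  by (auto simp: wp_def intro: exec_Inp elim: exec_InpE)

lemma wp_Asg_fun: "wp (Asg x e1 e2) Q =
    (\<lambda>s. Q 0 (put x (aval e1 (fst s)) (aval e2 (fst s)) (fst s), snd s))"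
  by auto

lemma wp_Seq [simp]: "wp (c1 ;; c2) Q = wp c1 (\<lambda>n. wp c2 (\<lambda>m. Q (n + m)))"
  by (auto simp: fun_eq_iff wp_def intro: exec_Seq elim!: exec_SeqE) (blast intro: exec_Seq)

lemma wp_If [simp]: "wp (If e c1 c2) Q s \<longleftrightarrow> (if aval e (fst s) \<noteq> 0 then wp c1 Q s else wp c2 Q s)"
  by (auto simp: wp_def intro: exec_IfT exec_IfF elim!: exec_IfE)

lemma wp_While: "wp (While e c) Q s \<longleftrightarrow>
  (if aval e (fst s) \<noteq> 0 then wp c (\<lambda>n. wp (While e c) (\<lambda>m. Q (Suc (n + m)))) s else Q 0 s)"
proof (cases "aval e (fst s) = 0")
  case True
  then have "exec (While e c) s n s' \<longleftrightarrow> n = 0 \<and> s' = s" for n s'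
    by (auto intro: exec_WhileF elim: exec_WhileE)
  with True show ?thesis
    unfolding wp_def by simp
next
  case False
  then have "exec (While e c) s l s'' \<longleftrightarrow>
      (\<exists>n s' m. l = Suc (n + m) \<and> exec c s n s' \<and> exec (While e c) s' m s'')" for l s''
    using exec_WhileE[of e c s l s''] exec_WhileT[of e s c _ _ _ s''] by (metis neq0_conv)
  with False show ?thesis
    unfolding wp_def by (simp only: if_True not_False_eq_True) blast
qed

lemma wp_mono: "wp c Q s \<Longrightarrow> (\<And>n s'. Q n s' \<Longrightarrow> Q' n s') \<Longrightarrow> wp c Q' s"
  unfolding wp_def by blast

fun mods :: "com \<Rightarrow> nat set" where
  "mods Skip = {}"
| "mods (Asg x e1 e2) = {x}"
| "mods (Inp x e) = {x}"
| "mods (c1 ;; c2) = mods c1 \<union> mods c2"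
| "mods (If e c1 c2) = mods c1 \<union> mods c2"
| "mods (While e c) = mods c"

fun input_free :: "com \<Rightarrow> bool" where
  "input_free (Inp x e) = False"
| "input_free (c1 ;; c2) = (input_free c1 \<and> input_free c2)"
| "input_free (If e c1 c2) = (input_free c1 \<and> input_free c2)"
| "input_free (While e c) = input_free c"
| "input_free _ = True"

lemma put_same [simp]: "put x i a st x = (st x)(i := a)"
  and put_other [simp]: "y \<noteq> x \<Longrightarrow> put x i a st y = st y"
  by (simp_all add: put_def)

lemma exec_frame: "exec c s n s' \<Longrightarrow> x \<notin> mods c \<Longrightarrow> fst s' x = fst s x"
  by (induction rule: exec.induct) auto

lemma exec_input_free: "exec c s n s' \<Longrightarrow> input_free c \<Longrightarrow> snd s' = snd s"
  by (induction rule: exec.induct) auto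

definition agree_off :: "nat set \<Rightarrow> store \<Rightarrow> store \<Rightarrow> bool" where
  "agree_off X st st' \<longleftrightarrow> (\<forall>x. x \<notin> X \<longrightarrow> st' x = st x)"

text \<open>Lets specifications mention only what a program produces; that the other arrays are
  unchanged follows from its syntax.\<close>

lemma wp_frame:
  assumes "wp c Q (st, w)"
    and "\<And>n st' w'. Q n (st', w') \<Longrightarrow> agree_off (mods c) st st' \<Longrightarrow> (input_free c \<longrightarrow> w' = w) \<Longrightarrow>
      Q' n (st', w')"
  shows "wp c Q' (st, w)"
proof -
  from assms(1) obtain n st' w' where e: "exec c (st, w) n (st', w')" and Q: "Q n (st', w')"
    by (auto simp: wp_def)
  have "Q' n (st', w')"
    using exec_frame[OF e] exec_input_free[OF e] by (intro assms(2)[OF Q]) (auto simp: agree_off_def)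
  with e show ?thesis
    by (auto simp: wp_def)
qed

abbreviation V :: "nat \<Rightarrow> aexp" where
  "V x \<equiv> A x (N 0)"

abbreviation Set :: "nat \<Rightarrow> aexp \<Rightarrow> com"  (infix "::=" 61) where
  "x ::= e \<equiv> Asg x (N 0) e"

definition For :: "nat \<Rightarrow> aexp \<Rightarrow> com \<Rightarrow> com" where
  "For v e c = (v ::= N 0 ;; While (Minus e (V v)) (c ;; v ::= Plus (V v) (N 1)))"

lemma mods_For [simp]: "mods (For v e c) = insert v (mods c)"
  and names_For [simp]: "names (For v e c) = insert v (names_aexp e \<union> names c)"
  and input_free_For [simp]: "input_free (For v e c) = input_free c"
  by (auto simp: For_def)

text \<open>The bound \<open>e\<close> is re-evaluated in every round, so it must keep the value
  \<open>b\<close>. The invariant is restored after the increment of \<open>v\<close>, and each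
  round costs the body plus one tick.\<close>

lemma wp_For:
  assumes init: "I 0 (put v 0 0 st) w"
    and v: "v \<notin> mods c"
    and bound: "\<And>i st' w'. I i st' w' \<Longrightarrow> agree_off (insert v (mods c)) st st' \<Longrightarrow> aval e st' = b"
    and step: "\<And>i st' w'. i < b \<Longrightarrow> I i st' w' \<Longrightarrow> st' v 0 = i \<Longrightarrow>
      agree_off (insert v (mods c)) st st' \<Longrightarrow>
      wp c (\<lambda>n (st'', w''). n \<le> t \<and> I (Suc i) (put v 0 (Suc i) st'') w'') (st', w')"
    and post: "\<And>n st' w'. I b st' w' \<Longrightarrow> st' v 0 = b \<Longrightarrow> agree_off (insert v (mods c)) st st' \<Longrightarrow>
      n \<le> b * (t + 1) \<Longrightarrow> Q n (st', w')"
  shows "wp (For v e c) Q (st, w)"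
proof -
  let ?W = "While (Minus e (V v)) (c ;; v ::= Plus (V v) (N 1))"
  have "wp ?W (\<lambda>n (st'', w''). n \<le> k * (t + 1) \<and> I b st'' w'' \<and> st'' v 0 = b \<and>
      agree_off (insert v (mods c)) st st'') (st', w')"
    if "k + i = b" "I i st' w'" "st' v 0 = i" "agree_off (insert v (mods c)) st st'" for k i st' w'
    using that
  proof (induction k arbitrary: i st' w')
    case 0
    then show ?case
      using bound[of i st' w'] by (subst wp_While) simp
  next
    case (Suc k)
    then have lt: "i < b"
      by simp
    from bound[OF Suc.prems(2,4)] lt Suc.prems(3) have ne: "aval (Minus e (V v)) st' \<noteq> 0"
      by simp
    have "wp c (\<lambda>n. wp (v ::= Plus (V v) (N 1)) (\<lambda>m. wp ?W (\<lambda>l (st'', w'').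
        Suc (n + m + l) \<le> Suc k * (t + 1) \<and> I b st'' w'' \<and> st'' v 0 = b \<and>
        agree_off (insert v (mods c)) st st''))) (st', w')"
    proof (rule wp_frame[OF step[OF lt Suc.prems(2-4)]], clarify)
      fix n st1 w1
      assume n: "n \<le> t" and I: "I (Suc i) (put v 0 (Suc i) st1) w1"
        and fr: "agree_off (mods c) st' st1"
      have v1: "st1 v 0 = i"
        using fr v Suc.prems(3) by (simp add: agree_off_def)
      have "agree_off (insert v (mods c)) st (put v 0 (Suc i) st1)"
        using fr Suc.prems(4) by (simp add: agree_off_def)
      from Suc.IH[OF _ I _ this] Suc.prems(1)
      show "wp (v ::= Plus (V v) (N 1)) (\<lambda>m. wp ?W (\<lambda>l (st'', w'').
        Suc (n + m + l) \<le> Suc k * (t + 1) \<and> I b st'' w'' \<and> st'' v 0 = b \<and>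
        agree_off (insert v (mods c)) st st'')) (st1, w1)"
        using n by (simp add: v1) (erule wp_mono, auto)
    qed
    then show ?case
      using ne by (subst wp_While) simp
  qed
  note W = this[of b 0 "put v 0 0 st" w]
  have "wp ?W (\<lambda>n s. Q n s) (put v 0 0 st, w)"
    by (rule wp_mono[OF W]) (use init post in \<open>auto simp: agree_off_def\<close>)
  then show ?thesis
    by (simp add: For_def)
qed

text \<open>Multiplication by a number fixed in the program text, unrolled into additions. It
  suffices because the numbers \<open>D\<close> and \<open>k\<close> depend on the class and on
  \<open>s\<close> only.\<close>

primrec cmul :: "nat \<Rightarrow> aexp \<Rightarrow> aexp" where
  "cmul 0 e = N 0"
| "cmul (Suc k) e = Plus e (cmul k e)"

lemma aval_cmul [simp]: "aval (cmul k e) st = k * aval e st"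
  by (induction k) simp_all

lemma names_cmul [simp]: "names_aexp (cmul k e) = (if k = 0 then {} else names_aexp e)"
  by (induction k) auto

text \<open>With truncated subtraction the inner sum is the distance of the two values.\<close>

definition Eq :: "aexp \<Rightarrow> aexp \<Rightarrow> aexp" where
  "Eq a b = Minus (N 1) (Plus (Minus a b) (Minus b a))"

lemma aval_Eq [simp]: "aval (Eq a b) st = of_bool (aval a st = aval b st)"
  by (auto simp: Eq_def)

lemma names_Eq [simp]: "names_aexp (Eq a b) = names_aexp a \<union> names_aexp b"
  by (auto simp: Eq_def)

text \<open>\<open>exec\<close> describes only completed loops. The evaluator simulates recursion by
  one loop, so its correctness proof must speak of stretches of iterations that stop while the guard
  still holds.\<close>

inductive iters :: "aexp \<Rightarrow> com \<Rightarrow> state \<Rightarrow> nat \<Rightarrow> state \<Rightarrow> bool" for e c where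
  iters_refl: "iters e c s 0 s"
| iters_step: "aval e (fst s) \<noteq> 0 \<Longrightarrow> exec c s n s' \<Longrightarrow> iters e c s' m s'' \<Longrightarrow>
    iters e c s (Suc (n + m)) s''"

lemma iters_trans: "iters e c s n s' \<Longrightarrow> iters e c s' m s'' \<Longrightarrow> iters e c s (n + m) s''"
proof (induction rule: iters.induct)
  case (iters_step s n s' k s1)
  then show ?case
    using iters.iters_step[of e s c n s' "k + m" s''] by (simp add: add.assoc)
qed simp

lemma exec_While_iters: "iters e c s n s' \<Longrightarrow> aval e (fst s') = 0 \<Longrightarrow> exec (While e c) s n s'"
  by (induction rule: iters.induct) (auto intro: exec_WhileF exec_WhileT)

section \<open>The model checking program\<close>

abbreviation (input) "vRes \<equiv> 0 :: nat"
abbreviation (input) "vPos \<equiv> 1 :: nat"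
abbreviation (input) "vMode \<equiv> 2 :: nat"
abbreviation (input) "vSp \<equiv> 3 :: nat"
abbreviation (input) "aFrame \<equiv> 4 :: nat"
abbreviation (input) "aCount \<equiv> 5 :: nat"
abbreviation (input) "aSaved \<equiv> 6 :: nat"
abbreviation (input) "aEnv \<equiv> 7 :: nat"
abbreviation (input) "aFm \<equiv> 8 :: nat"
abbreviation (input) "vLen \<equiv> 9 :: nat"
abbreviation (input) "aF \<equiv> 10 :: nat"
abbreviation (input) "aCnt \<equiv> 11 :: nat"
abbreviation (input) "vn \<equiv> 12 :: nat"
abbreviation (input) "vRel \<equiv> 13 :: nat"
abbreviation (input) "vPairs \<equiv> 14 :: nat"
abbreviation (input) "vE \<equiv> 15 :: nat"
abbreviation (input) "vA \<equiv> 16 :: nat"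
abbreviation (input) "vB \<equiv> 17 :: nat"
abbreviation (input) "vIdx \<equiv> 18 :: nat"
abbreviation (input) "vNeed \<equiv> 19 :: nat"
abbreviation (input) "vR \<equiv> 20 :: nat"
abbreviation (input) "vN \<equiv> 21 :: nat"
abbreviation (input) "vM \<equiv> 22 :: nat"
abbreviation (input) "vI \<equiv> 23 :: nat"
abbreviation (input) "aU \<equiv> 24 :: nat"
abbreviation (input) "vK \<equiv> 25 :: nat"
abbreviation (input) "aQA \<equiv> 26 :: nat"
abbreviation (input) "aQB \<equiv> 27 :: nat"
abbreviation (input) "vV \<equiv> 28 :: nat"
abbreviation (input) "vJ \<equiv> 29 :: nat"
abbreviation (input) "vP \<equiv> 30 :: nat"
abbreviation (input) "vQ \<equiv> 31 :: nat"
abbreviation (input) "vSame \<equiv> 32 :: nat"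
abbreviation (input) "vC \<equiv> 33 :: nat"
abbreviation (input) "aH \<equiv> 34 :: nat"
abbreviation (input) "vH \<equiv> 35 :: nat"
abbreviation (input) "vT \<equiv> 36 :: nat"

text \<open>The table \<open>F\<close> stores the \<open>i\<close>-th neighbour \<open>u\<close> of \<open>v\<close> as \<open>u + 1\<close>; an empty slot acts as a loop.\<close>

definition slot_fun :: "nat \<Rightarrow> (nat \<Rightarrow> nat) \<Rightarrow> nat \<Rightarrow> nat \<Rightarrow> nat" where
  "slot_fun k F i v = (if F (k * v + i) = 0 then v else F (k * v + i) - 1)"

text \<open>The array is its own work queue: parents are visited in order and their children are
  appended behind the entries already filled.\<close>

definition heap_code :: "nat \<Rightarrow> nat \<Rightarrow> aexp \<Rightarrow> aexp \<Rightarrow> com" where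
  "heap_code k q m e =
     For vP e (For vI (N k)
       (If (A aF (Plus (cmul k (A q (V vP))) (V vI)))
          (Asg q (Plus m (Plus (cmul k (V vP)) (V vI)))
            (Minus (A aF (Plus (cmul k (A q (V vP))) (V vI))) (N 1)))
          (Asg q (Plus m (Plus (cmul k (V vP)) (V vI))) (A q (V vP)))))"

lemma mods_heap_code [simp]: "mods (heap_code k q m e) = {vP, vI, q}"
  by (auto simp: heap_code_def)

lemma wp_heap_code:
  assumes q: "q \<notin> {vP, vI, aF}" and "0 < k" and "0 < r"
    and m: "\<And>st'. agree_off {vP, vI, q} st st' \<Longrightarrow> aval m st' = r"
    and e: "\<And>st'. agree_off {vP, vI, q} st st' \<Longrightarrow> aval e st' = b"
  shows "wp (heap_code k q m e) (\<lambda>n (st', w'). n \<le> b * (k + 1) \<and>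
     (\<forall>p<grow k r b. st' q p = heap (slot_fun k (st aF)) k r (st q) p)) (st, w)"
  unfolding heap_code_def
proof (rule wp_For[where b = b and t = k and
      I = "\<lambda>p st' w'. \<forall>x<grow k r p. st' q x = heap (slot_fun k (st aF)) k r (st q) x"])
  let ?hp = "heap (slot_fun k (st aF)) k r (st q)"
  let ?v = "A aF (Plus (cmul k (A q (V vP))) (V vI))"
  let ?ix = "Plus m (Plus (cmul k (V vP)) (V vI))"
  show "\<forall>x<grow k r 0. put vP 0 0 st q x = ?hp x"
    using q by (simp add: grow_def heap_root)
  fix p st1 w1
  assume I1: "\<forall>x<grow k r p. st1 q x = ?hp x" and p1: "st1 vP 0 = p"
    and fr1: "agree_off (insert vP (mods (For vI (N k)
      (If ?v (Asg q ?ix (Minus ?v (N 1))) (Asg q ?ix (A q (V vP))))))) st st1"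
  have fr1': "agree_off {vP, vI, q} st st1"
    using fr1 by (simp add: agree_off_def)
  show "wp (For vI (N k) (If ?v (Asg q ?ix (Minus ?v (N 1))) (Asg q ?ix (A q (V vP)))))
    (\<lambda>n (st'', w''). n \<le> k \<and> (\<forall>x<grow k r (Suc p). put vP 0 (Suc p) st'' q x = ?hp x)) (st1, w1)"
  proof (rule wp_For[where b = k and t = 0 and I = "\<lambda>i st' w'. \<forall>x<grow k r p + i. st' q x = ?hp x"])
    show "\<forall>x<grow k r p + 0. put vI 0 0 st1 q x = ?hp x"
      using I1 q by simp
    fix i st2 w2
    assume i: "i < k" and I2: "\<forall>x<grow k r p + i. st2 q x = ?hp x" and i2: "st2 vI 0 = i"
      and fr2: "agree_off (insert vI (mods (If ?v (Asg q ?ix (Minus ?v (N 1))) (Asg q ?ix (A q (V vP)))))) st1 st2"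
    have fr2': "agree_off {vP, vI, q} st st2"
      using fr1' fr2 by (simp add: agree_off_def)
    have F2: "st2 aF = st aF" and p2: "st2 vP 0 = p"
      using fr2' fr2 q p1 by (auto simp: agree_off_def)
    \<comment> \<open>A parent is always filled before it is visited; this needs at least one root
      and at least one child per position.\<close>
    have "p < grow k r p"
      using \<open>0 < k\<close> \<open>0 < r\<close> by (cases k) (auto simp: grow_def)
    then have qp: "st2 q p = ?hp p"
      using I2 by simp
    have "?hp (grow k r p + i) = slot_fun k (st aF) i (?hp p)"
      unfolding grow_def using \<open>0 < r\<close> i by (rule heap_child)
    then show "wp (If ?v (Asg q ?ix (Minus ?v (N 1))) (Asg q ?ix (A q (V vP))))
      (\<lambda>n (st'', w''). n \<le> 0 \<and> (\<forall>x<grow k r p + Suc i. put vI 0 (Suc i) st'' q x = ?hp x)) (st2, w2)"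
      using I2 q by (auto simp: F2 p2 i2 qp m[OF fr2'] slot_fun_def grow_def less_Suc_eq)
  qed (use q in \<open>auto simp: grow_def\<close>)
qed (use q e in \<open>auto simp: insert_commute\<close>)

section \<open>Comparing patterns and selecting representatives\<close>

definition pattern_code :: com where
  "pattern_code = (vSame ::= N 1 ;;
     For vP (V vN) (For vQ (V vN)
       (If (Eq (Eq (A aQA (V vP)) (A aQA (V vQ))) (Eq (A aQB (V vP)) (A aQB (V vQ))))
          Skip (vSame ::= N 0))))"

lemma mods_pattern_code [simp]: "mods pattern_code = {vSame, vP, vQ}"
  by (auto simp: pattern_code_def)

lemma wp_pattern_code:
  assumes N: "st vN 0 = l"
  shows "wp pattern_code (\<lambda>n (st', w'). n \<le> l * (l + 1) \<and> st' vSame 0 =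
     of_bool (\<forall>p<l. \<forall>q<l. st aQA p = st aQA q \<longleftrightarrow> st aQB p = st aQB q)) (st, w)"
proof -
  let ?ok = "\<lambda>p q. st aQA p = st aQA q \<longleftrightarrow> st aQB p = st aQB q"
  let ?b = "If (Eq (Eq (A aQA (V vP)) (A aQA (V vQ))) (Eq (A aQB (V vP)) (A aQB (V vQ))))
          Skip (vSame ::= N 0)"
  have "wp (For vP (V vN) (For vQ (V vN) ?b)) (\<lambda>n (st', w'). n \<le> l * (l + 1) \<and>
      st' vSame 0 = of_bool (\<forall>p<l. \<forall>q<l. ?ok p q)) (put vSame 0 1 st, w)"
  proof (rule wp_For[where b = l and t = l and
        I = "\<lambda>p st' w'. st' vSame 0 = of_bool (\<forall>p'<p. \<forall>q<l. ?ok p' q)"])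
    fix p st1 w1
    assume I1: "st1 vSame 0 = of_bool (\<forall>p'<p. \<forall>q<l. ?ok p' q)" and p1: "st1 vP 0 = p"
      and "agree_off (insert vP (mods (For vQ (V vN) ?b))) (put vSame 0 1 st) st1"
    then have fr1: "st1 aQA = st aQA" "st1 aQB = st aQB" "st1 vN = st vN"
      by (auto simp: agree_off_def)
    show "wp (For vQ (V vN) ?b) (\<lambda>n (st'', w''). n \<le> l \<and>
      put vP 0 (Suc p) st'' vSame 0 = of_bool (\<forall>p'<Suc p. \<forall>q<l. ?ok p' q)) (st1, w1)"
    proof (rule wp_For[where b = l and t = 0 and
          I = "\<lambda>q st' w'. st' vSame 0 = of_bool ((\<forall>p'<p. \<forall>q<l. ?ok p' q) \<and> (\<forall>q'<q. ?ok p q'))"])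
      fix q st2 w2
      assume I2: "st2 vSame 0 = of_bool ((\<forall>p'<p. \<forall>q<l. ?ok p' q) \<and> (\<forall>q'<q. ?ok p q'))"
        and q2: "st2 vQ 0 = q" and "agree_off (insert vQ (mods ?b)) st1 st2"
      then have fr2: "st2 aQA = st aQA" "st2 aQB = st aQB" "st2 vP 0 = p"
        using fr1 p1 by (auto simp: agree_off_def)
      show "wp ?b (\<lambda>n (st'', w''). n \<le> 0 \<and> put vQ 0 (Suc q) st'' vSame 0 =
        of_bool ((\<forall>p'<p. \<forall>q<l. ?ok p' q) \<and> (\<forall>q'<Suc q. ?ok p q'))) (st2, w2)"
        using I2 by (auto simp: fr2 q2 less_Suc_eq)
    qed (use I1 fr1 N in \<open>auto simp: agree_off_def less_Suc_eq\<close>)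
  qed (use N in \<open>auto simp: agree_off_def\<close>)
  then show ?thesis
    by (simp add: pattern_code_def)
qed

definition reps_code :: "nat \<Rightarrow> com" where
  "reps_code k = (vK ::= N 0 ;;
     For vV (V vn) (
       Asg aQA (N 0) (V vV) ;; heap_code k aQA (N 1) (V vN) ;; vC ::= N 0 ;;
       For vJ (V vK) (
         Asg aQB (N 0) (A aU (V vJ)) ;; heap_code k aQB (N 1) (V vN) ;; pattern_code ;;
         vC ::= Plus (V vC) (V vSame)) ;;
       If (Minus (V vM) (V vC)) (Asg aU (V vK) (V vV) ;; vK ::= Plus (V vK) (N 1)) Skip))"

lemma mods_reps_code [simp]:
    "mods (reps_code k) = {vK, vV, aQA, vP, vI, vC, vJ, aQB, vSame, vQ, aU}"
  by (auto simp: reps_code_def)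

context functional_structure
begin

abbreviation heap1 :: "nat \<Rightarrow> nat \<Rightarrow> nat" where
  "heap1 a \<equiv> heap f k 1 (\<lambda>_. a)"

lemma wp_heap1:
  assumes k: "0 < k" and F: "st aF = slots" "slot_fun k slots = f" and q: "q \<notin> {vP, vI, aF, vN}"
    and "st vN 0 = l" and "st q 0 = a"
  shows "wp (heap_code k q (N 1) (V vN)) (\<lambda>n (st', w'). n \<le> l * (k + 1) \<and> (\<forall>p<l. st' q p = heap1 a p)) (st, w)"
proof -
  \<comment> \<open>With one root the recursion ends at position 0 only, so an array still filled by
    an earlier vertex can be reused.\<close>
  have "heap f k 1 (st q) p = heap1 a p" for p
  proof (induction p rule: less_induct)
    case (less p)
    show ?case
    proof (cases "p = 0")
      case False
      then have "(p - 1) div k < p"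
        by (auto intro: le_less_trans[OF div_le_dividend])
      from less[OF this] False show ?thesis
        by (subst (1 2) heap.simps) simp
    qed (simp add: heap_root assms)
  qed
  moreover have "l \<le> grow k 1 l"
    using grow_le[OF k] .
  moreover have "wp (heap_code k q (N 1) (V vN)) (\<lambda>n (st', w'). n \<le> l * (k + 1) \<and>
    (\<forall>p<grow k 1 l. st' q p = heap (slot_fun k (st aF)) k 1 (st q) p)) (st, w)"
    by (rule wp_heap_code) (use assms in \<open>auto simp: agree_off_def\<close>)
  ultimately show ?thesis
    using F by (elim wp_mono) (auto simp: less_le_trans)
qed

lemma wp_count:
  assumes k: "0 < k" and F: "st aF = slots" "slot_fun k slots = f" and l: "st vN 0 = l"
    and QA: "\<forall>p<l. st aQA p = heap1 a p" and K: "st vK 0 = length ws"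
    and U: "\<forall>j<length ws. st aU j = ws ! j" and C: "st vC 0 = 0"
  shows "wp (For vJ (V vK) (
         Asg aQB (N 0) (A aU (V vJ)) ;; heap_code k aQB (N 1) (V vN) ;; pattern_code ;;
         vC ::= Plus (V vC) (V vSame)))
    (\<lambda>n (st', w'). n \<le> length ws * (l * (k + 1) + l * (l + 1) + 1) \<and>
       st' vC 0 = length (filter (same_pattern l a) ws)) (st, w)"
proof (rule wp_For[where b = "length ws" and t = "l * (k + 1) + l * (l + 1)" and
      I = "\<lambda>j st' w'. st' vC 0 = length (filter (same_pattern l a) (take j ws))"])
  fix j st1 w1
  assume j: "j < length ws" and I1: "st1 vC 0 = length (filter (same_pattern l a) (take j ws))"
    and j1: "st1 vJ 0 = j"
    and "agree_off (insert vJ (mods (Asg aQB (N 0) (A aU (V vJ)) ;; heap_code k aQB (N 1) (V vN) ;;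
      pattern_code ;; vC ::= Plus (V vC) (V vSame)))) st st1"
  then have fr1: "st1 aQA = st aQA" "st1 vN = st vN" "st1 aF = st aF" "st1 aU = st aU"
    by (auto simp: agree_off_def)
  let ?st2 = "put aQB 0 (ws ! j) st1"
  have "wp (heap_code k aQB (N 1) (V vN)) (\<lambda>n. wp pattern_code (\<lambda>m (st'', w'').
      n + m \<le> l * (k + 1) + l * (l + 1) \<and>
      st'' vC 0 + st'' vSame 0 = length (filter (same_pattern l a) (take (Suc j) ws)))) (?st2, w1)"
  proof (rule wp_frame[OF wp_heap1[OF k _ F(2), where q = aQB and l = l and a = "ws ! j"]], goal_cases)
    case (5 n st3 w3)
    then have QB: "\<forall>p<l. st3 aQB p = heap1 (ws ! j) p" and n: "n \<le> l * (k + 1)"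
      and fr3: "st3 aQA = st aQA" "st3 vN = st vN" "st3 vC = st1 vC"
      using fr1 by (auto simp: agree_off_def)
    have eq: "(\<forall>p<l. \<forall>q<l. st3 aQA p = st3 aQA q \<longleftrightarrow> st3 aQB p = st3 aQB q) \<longleftrightarrow> same_pattern l a (ws ! j)"
      using QA QB fr3 by (simp add: same_pattern_def)
    show ?case
    proof (rule wp_frame[OF wp_pattern_code[where l = l]], goal_cases)
      case (2 m st4 w4)
      then have "st4 vC = st1 vC"
        using fr3 by (auto simp: agree_off_def)
      moreover have "m \<le> l * (l + 1)" "st4 vSame 0 = of_bool (same_pattern l a (ws ! j))"
        using 2(1)[unfolded prod.case eq] by blast+
      ultimately show ?case
        using n I1 j by (simp add: take_Suc_conv_app_nth)
    qed (use fr3 l in simp)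
  qed (use fr1 F l in auto)
  then show "wp (Asg aQB (N 0) (A aU (V vJ)) ;; heap_code k aQB (N 1) (V vN) ;; pattern_code ;;
      vC ::= Plus (V vC) (V vSame))
    (\<lambda>n (st'', w''). n \<le> l * (k + 1) + l * (l + 1) \<and>
       put vJ 0 (Suc j) st'' vC 0 = length (filter (same_pattern l a) (take (Suc j) ws))) (st1, w1)"
    using U j fr1 j1 by (simp add: case_prod_unfold wp_Asg_fun)
qed (use K C in \<open>auto simp: agree_off_def\<close>)

text \<open>Apart from reading the input, this pass is the only work that grows with the number of
  vertices. The list of representatives is only ever extended, so \<open>B\<close> also bounds the
  cost of counting in every round.\<close>

lemma wp_reps_code:
  assumes k: "0 < k" and F: "st aF = slots" "slot_fun k slots = f" and l: "st vN 0 = l"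
    and n: "st vn 0 = n" and M: "st vM 0 = M" and B: "length (reps M l n) \<le> B"
  shows "wp (reps_code k) (\<lambda>t (st', w').
      t \<le> n * (l * (k + 1) + B * (l * (k + 1) + l * (l + 1) + 1) + 1) \<and>
      st' vK 0 = length (reps M l n) \<and> (\<forall>j<length (reps M l n). st' aU j = reps M l n ! j)) (st, w)"
proof -
  let ?cnt = "For vJ (V vK) (
         Asg aQB (N 0) (A aU (V vJ)) ;; heap_code k aQB (N 1) (V vN) ;; pattern_code ;;
         vC ::= Plus (V vC) (V vSame))"
  let ?add = "If (Minus (V vM) (V vC)) (Asg aU (V vK) (V vV) ;; vK ::= Plus (V vK) (N 1)) Skip"
  let ?body = "Asg aQA (N 0) (V vV) ;; heap_code k aQA (N 1) (V vN) ;; vC ::= N 0 ;; ?cnt ;; ?add"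
  let ?T = "l * (k + 1) + B * (l * (k + 1) + l * (l + 1) + 1)"
  have mono: "length (reps M l b) \<le> length (reps M l n)" if "b \<le> n" for b
    using that by (induction rule: inc_induct) auto
  have "wp (For vV (V vn) ?body) (\<lambda>t (st', w'). t \<le> n * (?T + 1) \<and>
      st' vK 0 = length (reps M l n) \<and> (\<forall>j<length (reps M l n). st' aU j = reps M l n ! j))
      (put vK 0 0 st, w)"
  proof (rule wp_For[where b = n and t = ?T and I = "\<lambda>b st' w'. st' vK 0 = length (reps M l b) \<and>
        (\<forall>j<length (reps M l b). st' aU j = reps M l b ! j)"])
    fix b st1 w1
    assume b: "b < n" and I1: "st1 vK 0 = length (reps M l b) \<and>
        (\<forall>j<length (reps M l b). st1 aU j = reps M l b ! j)" and b1: "st1 vV 0 = b"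
      and "agree_off (insert vV (mods ?body)) (put vK 0 0 st) st1"
    then have fr1: "st1 vN 0 = l" "st1 aF = slots" "st1 vM 0 = M"
      using l F M by (auto simp: agree_off_def)
    have le: "length (reps M l b) \<le> B"
      using mono[of b] b B by simp
    let ?st2 = "put aQA 0 b st1"
    have "wp (heap_code k aQA (N 1) (V vN)) (\<lambda>t1. wp (vC ::= N 0) (\<lambda>t2. wp ?cnt (\<lambda>t3. wp ?add
      (\<lambda>t4 (st'', w''). t1 + t2 + t3 + t4 \<le> ?T \<and> (st'' vK 0 = length (reps M l (Suc b)) \<and>
        (\<forall>j<length (reps M l (Suc b)). st'' aU j = reps M l (Suc b) ! j)))))) (?st2, w1)"
    proof (rule wp_frame[OF wp_heap1[OF k _ F(2), where q = aQA and l = l and a = b]], goal_cases)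
      case (5 t1 st3 w3)
      then have QA: "\<forall>p<l. st3 aQA p = heap1 b p" and t1: "t1 \<le> l * (k + 1)"
        and fr3: "st3 aF = slots" "st3 vN 0 = l" "st3 vM 0 = M" "st3 vK = st1 vK" "st3 aU = st1 aU"
          "st3 vV 0 = b"
        using fr1 b1 by (auto simp: agree_off_def)
      have "wp ?cnt (\<lambda>t3. wp ?add
        (\<lambda>t4 (st'', w''). t1 + t3 + t4 \<le> ?T \<and> (st'' vK 0 = length (reps M l (Suc b)) \<and>
        (\<forall>j<length (reps M l (Suc b)). st'' aU j = reps M l (Suc b) ! j)))) (put vC 0 0 st3, w3)"
      proof (rule wp_frame[OF wp_count[OF k _ F(2), where l = l and a = b and ws = "reps M l b"]], goal_cases)
        case (7 t3 st4 w4)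
        then have C: "st4 vC 0 = length (filter (same_pattern l b) (reps M l b))"
          and t3: "t3 \<le> length (reps M l b) * (l * (k + 1) + l * (l + 1) + 1)"
          and fr4: "st4 vM 0 = M" "st4 vK = st1 vK" "st4 aU = st1 aU" "st4 vV 0 = b"
          using fr3 by (auto simp: agree_off_def)
        from t3 le have "t3 \<le> B * (l * (k + 1) + l * (l + 1) + 1)"
          by (meson le_trans mult_le_mono1)
        with t1 have "t1 + t3 \<le> ?T"
          by simp
        with I1 C fr4 show ?case
          by (auto simp: nth_append less_Suc_eq)
      qed (use fr3 QA I1 in auto)
      then show ?case
        by simp
    qed (use fr1 in auto)
    then show "wp ?body (\<lambda>t (st'', w''). t \<le> ?T \<and>
      (put vV 0 (Suc b) st'' vK 0 = length (reps M l (Suc b)) \<and>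
        (\<forall>j<length (reps M l (Suc b)). put vV 0 (Suc b) st'' aU j = reps M l (Suc b) ! j))) (st1, w1)"
      using b1 by (simp add: case_prod_unfold wp_Asg_fun add.assoc del: reps.simps)
  qed (use n in \<open>auto simp: agree_off_def\<close>)
  then show ?thesis
    by (simp add: reps_code_def case_prod_unfold)
qed

end

text \<open>With \<open>L\<close> the formula length, this yields the radius \<open>3 ^ L\<close>,
  the number of heap positions for words of that radius, and the multiplicity per type, which is
  \<open>L + 1\<close> times this number.\<close>

definition param_code :: "nat \<Rightarrow> com" where
  "param_code k = (vR ::= N 1 ;; For vI (V vLen) (vR ::= cmul 3 (V vR)) ;;
     vN ::= N 1 ;; For vI (V vR) (vN ::= Plus (N 1) (cmul k (V vN))) ;;
     vM ::= V vN ;; For vI (V vLen) (vM ::= Plus (V vM) (V vN)))"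

lemma mods_param_code [simp]: "mods (param_code k) = {vR, vI, vN, vM}"
  by (auto simp: param_code_def)

lemma wp_param_code:
  assumes L: "st vLen 0 = L"
  shows "wp (param_code k) (\<lambda>t (st', w'). t \<le> L + 3 ^ L + L \<and> st' vR 0 = 3 ^ L \<and>
     st' vN 0 = (grow k 1 ^^ 3 ^ L) 1 \<and> st' vM 0 = Suc L * (grow k 1 ^^ 3 ^ L) 1) (st, w)"
proof -
  have 1: "wp (For vI (V vLen) (vR ::= cmul 3 (V vR))) (\<lambda>t (st', w'). t \<le> L \<and> st' vR 0 = 3 ^ L) (st1, w1)"
    if "st1 vR 0 = 1" "st1 vLen 0 = L" for st1 w1
    by (rule wp_For[where b = L and t = 0 and I = "\<lambda>i st' w'. st' vR 0 = 3 ^ i"])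
      (use that in \<open>auto simp: agree_off_def\<close>)
  have 2: "wp (For vI (V vR) (vN ::= Plus (N 1) (cmul k (V vN))))
      (\<lambda>t (st', w'). t \<le> r \<and> st' vN 0 = (grow k 1 ^^ r) 1) (st1, w1)"
    if "st1 vN 0 = 1" "st1 vR 0 = r" for st1 w1 r
    by (rule wp_For[where b = r and t = 0 and I = "\<lambda>i st' w'. st' vN 0 = (grow k 1 ^^ i) 1"])
      (use that in \<open>auto simp: agree_off_def grow_def\<close>)
  have 3: "wp (For vI (V vLen) (vM ::= Plus (V vM) (V vN)))
      (\<lambda>t (st', w'). t \<le> L \<and> st' vM 0 = Suc L * l) (st1, w1)"
    if "st1 vM 0 = l" "st1 vLen 0 = L" "st1 vN 0 = l" for st1 w1 l
    by (rule wp_For[where b = L and t = 0 and I = "\<lambda>i st' w'. st' vM 0 = Suc i * l"])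
      (use that in \<open>auto simp: agree_off_def\<close>)
  show ?thesis
    unfolding param_code_def
    apply simp
    apply (rule wp_frame[OF 1])
      apply (use L in \<open>simp_all add: agree_off_def\<close>)
    apply (rule wp_frame[OF 2[OF _ refl, simplified]])
     apply (simp_all add: agree_off_def)
    apply (rule wp_frame[OF 3])
       apply (use L in \<open>simp_all add: agree_off_def\<close>)
    by linarith
qed

text \<open>One unravelling serves all quantifiers. Starting from the representatives, the length of
  the range grows by \<open>R\<close> levels per code position and is recorded in \<open>aH\<close>;
  the array is then filled up to the largest length in a single run.\<close>

definition range_code :: "nat \<Rightarrow> com" where
  "range_code k = (vH ::= V vK ;;
     For vP (V vLen) (Asg aH (V vP) (V vH) ;;
       For vI (V vR) (vH ::= Plus (V vK) (cmul k (V vH)))) ;;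
     heap_code k aU (V vK) (V vH))"

lemma mods_range_code [simp]: "mods (range_code k) = {vH, vP, aH, vI, aU}"
  by (auto simp: range_code_def)

lemma wp_range_code:
  assumes "st vLen 0 = L" "st vR 0 = R" "st vK 0 = K" and "0 < k" "0 < K"
  defines "h \<equiv> \<lambda>p. (grow k K ^^ (p * R)) K"
  shows "wp (range_code k) (\<lambda>t (st', w'). t \<le> L * (R + 1) + h L * (k + 1) \<and>
     (\<forall>p<L. st' aH p = h p) \<and>
     (\<forall>q<grow k K (h L). st' aU q = heap (slot_fun k (st aF)) k K (st aU) q)) (st, w)"
proof -
  let ?in = "For vI (V vR) (vH ::= Plus (V vK) (cmul k (V vH)))"
  have 1: "wp ?in (\<lambda>t (st', w'). t \<le> R \<and> st' vH 0 = (grow k K ^^ R) x) (st1, w1)"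
    if "st1 vH 0 = x" "st1 vR 0 = R" "st1 vK 0 = K" for st1 w1 x
    by (rule wp_For[where b = R and t = 0 and I = "\<lambda>i st' w'. st' vH 0 = (grow k K ^^ i) x"])
      (use that in \<open>auto simp: agree_off_def grow_def\<close>)
  have 2: "wp (For vP (V vLen) (Asg aH (V vP) (V vH) ;; ?in))
      (\<lambda>t (st', w'). t \<le> L * (R + 1) \<and> st' vH 0 = h L \<and> (\<forall>p<L. st' aH p = h p)) (put vH 0 K st, w)"
  proof (rule wp_For[where b = L and t = R and I = "\<lambda>i st' w'. st' vH 0 = h i \<and> (\<forall>p<i. st' aH p = h p)"])
    fix i st1 w1
    assume I1: "st1 vH 0 = h i \<and> (\<forall>p<i. st1 aH p = h p)" and "st1 vP 0 = i"
      and "agree_off (insert vP (mods (Asg aH (V vP) (V vH) ;; ?in))) (put vH 0 K st) st1"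
    then have fr: "st1 vR 0 = R" "st1 vK 0 = K" "st1 vP 0 = i"
      using assms by (auto simp: agree_off_def)
    have Suc: "h (Suc i) = (grow k K ^^ R) (h i)"
      by (simp add: h_def funpow_add)
    have "wp ?in (\<lambda>n (st'', w''). n \<le> R \<and> st'' vH 0 = h (Suc i) \<and> (\<forall>p<Suc i. st'' aH p = h p))
      (put aH i (h i) st1, w1)"
      by (rule wp_frame[OF 1[where x = "h i"]])
        (use I1 fr in \<open>auto simp: agree_off_def less_Suc_eq Suc\<close>)
    then show "wp (Asg aH (V vP) (V vH) ;; ?in) (\<lambda>n (st'', w''). n \<le> R \<and>
      put vP 0 (Suc i) st'' vH 0 = h (Suc i) \<and> (\<forall>p<Suc i. put vP 0 (Suc i) st'' aH p = h p)) (st1, w1)"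
      using I1 fr by (simp add: case_prod_unfold)
  qed (use assms in \<open>auto simp: agree_off_def h_def\<close>)
  have "wp (For vP (V vLen) (Asg aH (V vP) (V vH) ;; ?in)) (\<lambda>n. wp (heap_code k aU (V vK) (V vH))
    (\<lambda>m (st', w'). n + m \<le> L * (R + 1) + h L * (k + 1) \<and> (\<forall>p<L. st' aH p = h p) \<and>
     (\<forall>q<grow k K (h L). st' aU q = heap (slot_fun k (st aF)) k K (st aU) q))) (put vH 0 K st, w)"
  proof (rule wp_frame[OF 2], clarify)
    fix n st1 w1
    assume n: "n \<le> L * (R + 1)" and H: "st1 vH 0 = h L" "\<forall>p<L. st1 aH p = h p"
      and "agree_off (mods (For vP (V vLen) (Asg aH (V vP) (V vH) ;; ?in))) (put vH 0 K st) st1"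
    then have fr: "st1 aF = st aF" "st1 aU = st aU" "st1 vK 0 = K"
      using assms by (auto simp: agree_off_def)
    show "wp (heap_code k aU (V vK) (V vH))
      (\<lambda>m (st', w'). n + m \<le> L * (R + 1) + h L * (k + 1) \<and> (\<forall>p<L. st' aH p = h p) \<and>
       (\<forall>q<grow k K (h L). st' aU q = heap (slot_fun k (st aF)) k K (st aU) q)) (st1, w1)"
      by (rule wp_frame[OF wp_heap_code[where r = K and b = "h L"]])
        (use n H fr assms in \<open>auto simp: agree_off_def\<close>)
  qed
  then show ?thesis
    using assms by (simp add: range_code_def)
qed

section \<open>Reading the relations into the neighbour table\<close>

definition vals :: "(nat \<times> nat) list \<Rightarrow> nat \<Rightarrow> nat list" where
  "vals es x = map snd (filter (\<lambda>e. fst e = x) es)"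

lemma vals_simps [simp]: "vals [] x = []"
  "vals (e # es) x = (if fst e = x then snd e # vals es x else vals es x)"
  "vals (es @ es') x = vals es x @ vals es' x"
  by (simp_all add: vals_def)

text \<open>The table is specified by the history \<open>es\<close> of its insertions: bucket
  \<open>x\<close> lists the values inserted under key \<open>x\<close>, in order, and a zeroed
  store is the table of the empty history.\<close>

definition table :: "nat \<Rightarrow> (nat \<times> nat) list \<Rightarrow> store \<Rightarrow> bool" where
  "table D es st \<longleftrightarrow> (\<forall>x. st aCnt x = length (vals es x) \<and>
     (\<forall>i<D. st aF (D * x + i) = (if i < length (vals es x) then Suc (vals es x ! i) else 0)))"

definition push_code :: "nat \<Rightarrow> aexp \<Rightarrow> aexp \<Rightarrow> com" where
  "push_code D x e = (vIdx ::= x ;;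
     Asg aF (Plus (cmul D (V vIdx)) (A aCnt (V vIdx))) (Plus e (N 1)) ;;
     Asg aCnt (V vIdx) (Plus (A aCnt (V vIdx)) (N 1)))"

lemma mult_add_eq_iff:
  fixes D :: nat
  assumes "i < D" "j < D"
  shows "D * x + i = D * y + j \<longleftrightarrow> x = y \<and> i = j"
proof
  assume "D * x + i = D * y + j"
  moreover have "(D * x + i) div D = x" "(D * y + j) div D = y"
    using assms by auto
  ultimately show "x = y \<and> i = j"
    by (metis add_left_cancel)
qed simp

text \<open>The bucket must have a free cell, since otherwise the write would land in the next
  bucket.\<close>

lemma wp_push_code:
  assumes "table D es st" and "length (vals es x) < D" and "aval a st = x"
    and "aval e (put vIdx 0 x st) = v"
    and "\<And>st'. table D (es @ [(x, v)]) st' \<Longrightarrow> agree_off {vIdx, aF, aCnt} st st' \<Longrightarrow> Q 0 (st', w)"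
  shows "wp (push_code D a e) Q (st, w)"
proof -
  let ?st' = "put aCnt x (Suc (length (vals es x)))
    (put aF (D * x + length (vals es x)) (Suc v) (put vIdx 0 x st))"
  have "table D (es @ [(x, v)]) ?st'"
    using assms(1,2) unfolding table_def by (auto simp: mult_add_eq_iff nth_append)
  moreover have "agree_off {vIdx, aF, aCnt} st ?st'"
    by (simp add: agree_off_def)
  ultimately have "Q 0 (?st', w)"
    by (rule assms(5))
  then show ?thesis
    using assms(1,3,4) by (simp add: push_code_def table_def)
qed

text \<open>Every vertex owns \<open>2 * (s + 1)\<close> buckets, an even one for the out-neighbours
  and an odd one for the in-neighbours in each relation. Entering each pair twice is what makes the
  resulting functions reversible.\<close>

definition read_code :: "nat \<Rightarrow> nat \<Rightarrow> com" where
  "read_code s D = (Inp vn (N 0) ;;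
     For vRel (N (s + 1)) (Inp vPairs (N 0) ;;
       For vE (V vPairs) (Inp vA (N 0) ;; Inp vB (N 0) ;;
         push_code D (Plus (cmul (2 * (s + 1)) (V vA)) (cmul 2 (V vRel))) (V vB) ;;
         push_code D (Plus (cmul (2 * (s + 1)) (V vB)) (Plus (cmul 2 (V vRel)) (N 1))) (V vA))))"

definition events :: "nat \<Rightarrow> nat \<Rightarrow> (nat \<times> nat) list \<Rightarrow> (nat \<times> nat) list" where
  "events s j ps = concat (map (\<lambda>(a, b).
     [(2 * (s + 1) * a + 2 * j, b), (2 * (s + 1) * b + (2 * j + 1), a)]) ps)"

definition all_events :: "nat \<Rightarrow> (nat \<times> nat) list list \<Rightarrow> nat \<Rightarrow> (nat \<times> nat) list" where
  "all_events s pss m = concat (map (\<lambda>j. events s j (pss ! j)) [0..<m])"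

lemma all_events_Suc: "all_events s pss (Suc j) = all_events s pss j @ events s j (pss ! j)"
  by (simp add: all_events_def)

lemma all_events_le: "j \<le> m \<Longrightarrow> \<exists>es. all_events s pss m = all_events s pss j @ es"
  by (induction m rule: dec_induct) (auto simp: all_events_Suc)

text \<open>The outer invariant says that the history so far is \<open>all_events\<close> for the
  relations read, the inner one adds the pairs read from the current relation.\<close>

lemma wp_read_code:
  assumes pss: "length pss = s + 1"
    and D: "\<And>x. length (vals (all_events s pss (s + 1)) x) \<le> D"
    and T: "\<And>ps. ps \<in> set pss \<Longrightarrow> length ps \<le> T"
    and st: "st = (\<lambda>_ _. 0)" and w: "w = n # concat (map pairs_code pss) @ rest"
  shows "wp (read_code s D) (\<lambda>t (st', w'). t \<le> (s + 1) * (T + 1) \<and> st' vn 0 = n \<and> w' = rest \<and>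
     table D (all_events s pss (s + 1)) st') (st, w)"
proof -
  let ?pa = "push_code D (Plus (cmul (2 * (s + 1)) (V vA)) (cmul 2 (V vRel))) (V vB)"
  let ?pb = "push_code D (Plus (cmul (2 * (s + 1)) (V vB)) (Plus (cmul 2 (V vRel)) (N 1))) (V vA)"
  let ?in = "Inp vA (N 0) ;; Inp vB (N 0) ;; ?pa ;; ?pb"
  let ?flat = "\<lambda>ps. concat (map (\<lambda>(a, b). [a, b]) ps)"
  have "wp (For vRel (N (s + 1)) (Inp vPairs (N 0) ;; For vE (V vPairs) ?in))
     (\<lambda>t (st', w'). t \<le> (s + 1) * (T + 1) \<and> st' vn 0 = n \<and> w' = rest \<and>
     table D (all_events s pss (s + 1)) st') (put vn 0 n st, tl w)"
  proof (rule wp_For[where b = "s + 1" and t = T and I = "\<lambda>j st' w'.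
        table D (all_events s pss j) st' \<and> w' = concat (map pairs_code (drop j pss)) @ rest"])
    fix j st1 w1
    assume j: "j < s + 1"
      and I1: "table D (all_events s pss j) st1 \<and> w1 = concat (map pairs_code (drop j pss)) @ rest"
      and j1: "st1 vRel 0 = j"
    let ?ps = "pss ! j"
    let ?w2 = "concat (map pairs_code (drop (Suc j) pss)) @ rest"
    have w1: "w1 = length ?ps # ?flat ?ps @ ?w2"
      using I1 j pss by (simp add: pairs_code_def flip: Cons_nth_drop_Suc)
    \<comment> \<open>The degree bound concerns the complete history. It is strict for a proper
      prefix whose next insertion goes to the same bucket.\<close>
    have bound: "length (vals es x) < D"
      if pre: "es @ [(x, v)] @ es' = all_events s pss (Suc j)" for es x v es'
    proof -
      obtain es'' where "all_events s pss (s + 1) = all_events s pss (Suc j) @ es''"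
        using all_events_le[of "Suc j" "s + 1"] j by auto
      with pre have "all_events s pss (s + 1) = es @ [(x, v)] @ es' @ es''"
        by (metis append.assoc)
      with D[of x] show ?thesis
        by simp
    qed
    have "wp (For vE (V vPairs) ?in) (\<lambda>t (st', w'). t \<le> T \<and>
        table D (all_events s pss (Suc j)) st' \<and> w' = ?w2) (put vPairs 0 (length ?ps) st1, ?flat ?ps @ ?w2)"
    proof (rule wp_For[where b = "length ?ps" and t = 0 and I = "\<lambda>e st' w'.
        table D (all_events s pss j @ events s j (take e ?ps)) st' \<and> w' = ?flat (drop e ?ps) @ ?w2"])
      fix e st2 w2
      assume e: "e < length ?ps"
        and I2: "table D (all_events s pss j @ events s j (take e ?ps)) st2 \<and>
          w2 = ?flat (drop e ?ps) @ ?w2"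
        and "agree_off (insert vE (mods ?in)) (put vPairs 0 (length ?ps) st1) st2"
      then have j2: "st2 vRel 0 = j"
        using j1 by (simp add: agree_off_def push_code_def)
      obtain a b where ab: "?ps ! e = (a, b)"
        by force
      have w2: "w2 = a # b # ?flat (drop (Suc e) ?ps) @ ?w2"
        using I2 e ab by (simp flip: Cons_nth_drop_Suc)
      define es where "es = all_events s pss j @ events s j (take e ?ps)"
      define xa where "xa = 2 * (s + 1) * a + 2 * j"
      define xb where "xb = 2 * (s + 1) * b + (2 * j + 1)"
      have es': "all_events s pss j @ events s j (take (Suc e) ?ps) = es @ [(xa, b)] @ [(xb, a)]"
        using e ab by (simp add: es_def events_def take_Suc_conv_app_nth xa_def xb_def)
      have "all_events s pss (Suc j) = (all_events s pss j @ events s j (take (Suc e) ?ps)) @ events s j (drop (Suc e) ?ps)"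
        by (simp add: all_events_Suc events_def flip: concat_append map_append)
      then have full: "es @ [(xa, b)] @ [(xb, a)] @ events s j (drop (Suc e) ?ps) = all_events s pss (Suc j)"
        by (simp add: es')
      let ?st3 = "put vB 0 b (put vA 0 a st2)" and ?w3 = "?flat (drop (Suc e) ?ps) @ ?w2"
      have t3: "table D es ?st3"
        using I2 by (simp add: es_def table_def)
      have "wp ?pa (\<lambda>n. wp ?pb (\<lambda>m (st'', w''). n + m \<le> 0 \<and>
        (table D (all_events s pss j @ events s j (take (Suc e) ?ps)) (put vE 0 (Suc e) st'') \<and>
           w'' = ?flat (drop (Suc e) ?ps) @ ?w2))) (?st3, ?w3)"
      proof (rule wp_push_code[OF t3, where x = xa and v = b])
        show "length (vals es xa) < D"
          using full by (intro bound[of es xa b]) simp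
        fix st4
        assume t4: "table D (es @ [(xa, b)]) st4" and fr4: "agree_off {vIdx, aF, aCnt} ?st3 st4"
        show "wp ?pb (\<lambda>m (st'', w''). 0 + m \<le> 0 \<and>
          (table D (all_events s pss j @ events s j (take (Suc e) ?ps)) (put vE 0 (Suc e) st'') \<and>
           w'' = ?flat (drop (Suc e) ?ps) @ ?w2)) (st4, ?w3)"
        proof (rule wp_push_code[OF t4, where x = xb and v = a])
          show "length (vals (es @ [(xa, b)]) xb) < D"
            using full by (intro bound[of "es @ [(xa, b)]" xb a]) simp
          fix st5
          assume t5: "table D ((es @ [(xa, b)]) @ [(xb, a)]) st5"
          then show "case (st5, ?w3) of (st'', w'') \<Rightarrow> 0 + 0 \<le> (0::nat) \<and>
            (table D (all_events s pss j @ events s j (take (Suc e) ?ps)) (put vE 0 (Suc e) st'') \<and>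
             w'' = ?flat (drop (Suc e) ?ps) @ ?w2)"
            unfolding es' by (simp add: table_def)
        qed (use fr4 j2 in \<open>simp_all add: agree_off_def xb_def\<close>)
      qed (use j2 in \<open>simp_all add: xa_def\<close>)
      then show "wp ?in (\<lambda>n (st'', w''). n \<le> 0 \<and>
        (table D (all_events s pss j @ events s j (take (Suc e) ?ps)) (put vE 0 (Suc e) st'') \<and>
           w'' = ?flat (drop (Suc e) ?ps) @ ?w2)) (st2, w2)"
        unfolding w2 by simp
    next
      fix t' st' w'
      assume "table D (all_events s pss j @ events s j (take (length ?ps) ?ps)) st' \<and>
          w' = ?flat (drop (length ?ps) ?ps) @ ?w2" and "t' \<le> length ?ps * (0 + 1)"
      then show "case (st', w') of (st', w') \<Rightarrow> t' \<le> T \<and> table D (all_events s pss (Suc j)) st' \<and> w' = ?w2"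
        using T[of ?ps] j pss by (simp add: all_events_Suc)
    qed (use I1 in \<open>auto simp: agree_off_def table_def events_def push_code_def\<close>)
    then show "wp (Inp vPairs (N 0) ;; For vE (V vPairs) ?in) (\<lambda>n (st'', w''). n \<le> T \<and>
      (table D (all_events s pss (Suc j)) (put vRel 0 (Suc j) st'') \<and> w'' = ?w2)) (st1, w1)"
      unfolding w1 by (simp add: table_def case_prod_unfold)
  qed (use pss w st in \<open>auto simp: agree_off_def table_def all_events_def push_code_def\<close>)
  then show ?thesis
    using w by (simp add: read_code_def)
qed

section \<open>Parsing\<close>

definition holds :: "(nat \<Rightarrow> nat) \<Rightarrow> nat \<Rightarrow> nat list \<Rightarrow> bool" where
  "holds g l xs \<longleftrightarrow> (\<forall>i<length xs. g (l + i) = xs ! i)"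

lemma holds_Nil [simp]: "holds g l []"
  by (simp add: holds_def)

lemma holds_Cons [simp]: "holds g l (x # xs) \<longleftrightarrow> g l = x \<and> holds g (Suc l) xs"
  by (auto simp: holds_def less_Suc_eq_0_disj)

lemma holds_append [simp]: "holds g l (xs @ ys) \<longleftrightarrow> holds g l xs \<and> holds g (l + length xs) ys"
  by (induction xs arbitrary: l) simp_all

lemma holds_cong: "holds g l xs \<Longrightarrow> \<forall>i<l + length xs. g' i = g i \<Longrightarrow> holds g' l xs"
  by (simp add: holds_def)

definition token_code :: com where
  "token_code = (Inp aFm (V vLen) ;; vLen ::= Plus (V vLen) (N 1))"

text \<open>Prefix code delimits itself: \<open>vNeed\<close> counts the formulas still expected. An
  atom fulfils one expectation, a binary connective replaces one by two, and negation and
  quantifiers replace one by one.\<close>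

definition parse_step :: com where
  "parse_step = (token_code ;; vT ::= A aFm (Minus (V vLen) (N 1)) ;;
     If (Minus (N 3) (V vT))
       (token_code ;; token_code ;; If (Eq (V vT) (N 2)) token_code Skip ;;
        vNeed ::= Minus (V vNeed) (N 1))
       (If (Minus (V vT) (N 5)) token_code
         (If (Minus (V vT) (N 3)) (vNeed ::= Plus (V vNeed) (N 1)) Skip)))"

definition parse_code :: com where
  "parse_code = (vNeed ::= N 1 ;; vLen ::= N 0 ;; While (V vNeed) parse_step)"

lemma mods_parse_code [simp]: "mods parse_code = {vNeed, vLen, aFm, vT}"
  by (auto simp: parse_code_def parse_step_def token_code_def)

text \<open>Generalised from one formula to the list of pending formulas, since this is what remains
  after an operator symbol; the induction is on the length of the pending code.\<close>

lemma wp_parse_loop: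
  assumes "st vNeed 0 = length \<phi>s" and "st vLen 0 = l" and "w = concat (map fm_code \<phi>s) @ rest"
  shows "wp (While (V vNeed) parse_step) (\<lambda>n (st', w'). n \<le> length (concat (map fm_code \<phi>s)) \<and>
    st' vLen 0 = l + length (concat (map fm_code \<phi>s)) \<and>
    holds (st' aFm) l (concat (map fm_code \<phi>s)) \<and> (\<forall>i<l. st' aFm i = st aFm i) \<and> w' = rest) (st, w)"
  using assms
proof (induction "length (concat (map fm_code \<phi>s))" arbitrary: \<phi>s st w l rule: less_induct)
  case less
  show ?case
  proof (cases \<phi>s)
    case Nil
    with less.prems show ?thesis
      by (subst wp_While) simp
  next
    case (Cons \<phi> \<psi>s)
    let ?C = "\<lambda>\<phi>s. concat (map fm_code \<phi>s)"
    have step: "wp (While (V vNeed) parse_step) (\<lambda>n (st', w'). Suc n \<le> length (?C \<phi>s) \<and>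
        st' vLen 0 = l + length (?C \<phi>s) \<and> holds (st' aFm) l (?C \<phi>s) \<and>
        (\<forall>i<l. st' aFm i = st aFm i) \<and> w' = rest) (st1, ?C \<chi>s @ rest)"
      if "?C \<phi>s = ts @ ?C \<chi>s" "0 < length ts" "st1 vNeed 0 = length \<chi>s" "st1 vLen 0 = l + length ts"
        "holds (st1 aFm) l ts" "\<forall>i<l. st1 aFm i = st aFm i" for ts \<chi>s st1
    proof (rule wp_mono[OF less.hyps[of \<chi>s st1 "l + length ts" "?C \<chi>s @ rest"]], goal_cases)
      case (5 n s')
      then show ?case
        using that holds_cong[OF that(5), of "fst s' aFm"]
        by (cases s') (auto simp: Suc_le_eq simp del: length_greater_0_conv)
    qed (use that in auto)
    have ne: "st vNeed 0 \<noteq> 0"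
      using less.prems Cons by simp
    note simps = parse_step_def token_code_def less.prems Cons
    show ?thesis
    proof (cases \<phi>)
      case (Equal x y)
      then show ?thesis
        using ne Cons less.prems step[of "[0, x, y]" \<psi>s] by (subst wp_While) (simp add: simps)
    next
      case (Edge x y)
      then show ?thesis
        using ne Cons less.prems step[of "[1, x, y]" \<psi>s] by (subst wp_While) (simp add: simps)
    next
      case (Succ i x y)
      then show ?thesis
        using ne Cons less.prems step[of "[2, i, x, y]" \<psi>s] by (subst wp_While) (simp add: simps)
    next
      case (Neg \<chi>)
      then show ?thesis
        using ne Cons less.prems step[of "[3]" "\<chi> # \<psi>s"] by (subst wp_While) (simp add: simps)
    next
      case (Conj \<chi> \<chi>')
      then show ?thesis
        using ne Cons less.prems step[of "[4]" "\<chi> # \<chi>' # \<psi>s"] by (subst wp_While) (simp add: simps)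
    next
      case (Disj \<chi> \<chi>')
      then show ?thesis
        using ne Cons less.prems step[of "[5]" "\<chi> # \<chi>' # \<psi>s"] by (subst wp_While) (simp add: simps)
    next
      case (Exists x \<chi>)
      then show ?thesis
        using ne Cons less.prems step[of "[6, x]" "\<chi> # \<psi>s"] by (subst wp_While) (simp add: simps)
    next
      case (Forall x \<chi>)
      then show ?thesis
        using ne Cons less.prems step[of "[7, x]" "\<chi> # \<psi>s"] by (subst wp_While) (simp add: simps)
    qed
  qed
qed

lemma wp_parse_code:
  "wp parse_code (\<lambda>n (st', w'). n \<le> fm_length \<phi> \<and> st' vLen 0 = fm_length \<phi> \<and>
    holds (st' aFm) 0 (fm_code \<phi>)) (st, fm_code \<phi>)"
proof -
  have "wp (While (V vNeed) parse_step) (\<lambda>n (st', w'). n \<le> length (concat (map fm_code [\<phi>])) \<and>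
    st' vLen 0 = 0 + length (concat (map fm_code [\<phi>])) \<and>
    holds (st' aFm) 0 (concat (map fm_code [\<phi>])) \<and>
    (\<forall>i<0. st' aFm i = put vLen 0 0 (put vNeed 0 1 st) aFm i) \<and> w' = [])
    (put vLen 0 0 (put vNeed 0 1 st), fm_code \<phi>)"
    by (rule wp_parse_loop) simp_all
  then show ?thesis
    by (simp add: parse_code_def fm_length_def) (erule wp_mono, auto)
qed

section \<open>Evaluation\<close>

text \<open>Each relation owns \<open>2 * D\<close> consecutive slots per vertex, of which the first
  \<open>D\<close> hold the out-neighbours.\<close>

definition erel :: "nat \<Rightarrow> nat \<Rightarrow> (nat \<Rightarrow> nat) \<Rightarrow> nat \<Rightarrow> nat \<Rightarrow> nat \<Rightarrow> bool" where
  "erel D k F j x y \<longleftrightarrow> (\<exists>i<D. F (k * x + (2 * D * j + i)) = Suc y)"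

definition rel_code :: "nat \<Rightarrow> nat \<Rightarrow> aexp \<Rightarrow> aexp \<Rightarrow> aexp \<Rightarrow> com" where
  "rel_code D k j x y = (vRes ::= N 0 ;;
     For vI (N D) (If (Eq (A aF (Plus (cmul k x) (Plus (cmul (2 * D) j) (V vI)))) (Plus y (N 1)))
       (vRes ::= N 1) Skip))"

lemma mods_rel_code [simp]: "mods (rel_code D k j x y) = {vRes, vI}"
  and input_free_rel_code [simp]: "input_free (rel_code D k j x y)"
  by (auto simp: rel_code_def)

lemma wp_rel_code:
  assumes "\<And>st'. agree_off {vRes, vI} st st' \<Longrightarrow> aval j st' = j' \<and> aval x st' = a \<and> aval y st' = b"
  shows "wp (rel_code D k j x y) (\<lambda>n (st', w'). n \<le> D \<and> st' vRes 0 = of_bool (erel D k (st aF) j' a b)) (st, w)"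
proof -
  let ?P = "\<lambda>i. st aF (k * a + (2 * D * j' + i)) = Suc b"
  have "wp (For vI (N D) (If (Eq (A aF (Plus (cmul k x) (Plus (cmul (2 * D) j) (V vI)))) (Plus y (N 1)))
       (vRes ::= N 1) Skip)) (\<lambda>n (st', w'). n \<le> D \<and> st' vRes 0 = of_bool (\<exists>i<D. ?P i)) (put vRes 0 0 st, w)"
    (is "wp (For vI (N D) ?b) _ _")
  proof (rule wp_For[where b = D and t = 0 and I = "\<lambda>i st' w'. st' vRes 0 = of_bool (\<exists>i'<i. ?P i')"])
    fix i st1 w1
    assume I1: "st1 vRes 0 = of_bool (\<exists>i'<i. ?P i')" and i1: "st1 vI 0 = i"
      and "agree_off (insert vI (mods ?b)) (put vRes 0 0 st) st1"
    then have fr: "agree_off {vRes, vI} st st1" and F: "st1 aF = st aF"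
      by (auto simp: agree_off_def)
    show "wp ?b (\<lambda>n (st'', w''). n \<le> 0 \<and> put vI 0 (Suc i) st'' vRes 0 = of_bool (\<exists>i'<Suc i. ?P i')) (st1, w1)"
      using assms[OF fr] I1 by (auto simp: i1 F less_Suc_eq)
  qed auto
  then show ?thesis
    by (simp add: rel_code_def erel_def)
qed

abbreviation pos :: "nat \<Rightarrow> aexp" where
  "pos i \<equiv> Plus (V vPos) (N i)"

abbreviation env_at :: "nat \<Rightarrow> aexp" where
  "env_at i \<equiv> A aEnv (A aFm (pos i))"

text \<open>Mode 1 evaluates the subformula at \<open>vPos\<close>. Atoms answer at once; other
  symbols push a frame with their position and a counter, and a quantifier also saves the value of
  its variable before assigning the first candidate.\<close>

definition call_code :: "nat \<Rightarrow> nat \<Rightarrow> com" where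
  "call_code D k = (vT ::= A aFm (V vPos) ;;
     If (Minus (N 3) (V vT))
       (vMode ::= N 0 ;;
        If (V vT)
          (If (Minus (V vT) (N 1))
             (rel_code D k (Plus (A aFm (pos 1)) (N 1)) (env_at 2) (env_at 3) ;; vPos ::= pos 4)
             (rel_code D k (N 0) (env_at 1) (env_at 2) ;; vPos ::= pos 3))
          (vRes ::= Eq (env_at 1) (env_at 2) ;; vPos ::= pos 3))
       (Asg aFrame (V vSp) (V vPos) ;; Asg aCount (V vSp) (N 0) ;;
        If (Minus (V vT) (N 5))
          (Asg aSaved (V vSp) (env_at 1) ;; Asg aEnv (A aFm (pos 1)) (A aU (N 0)) ;; vPos ::= pos 2)
          (vPos ::= pos 1) ;;
        vSp ::= Plus (V vSp) (N 1)))"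

text \<open>Mode 0 hands \<open>vRes\<close> to the top frame. \<open>vT - 6\<close> is 0 for an
  existential and 1 for a universal quantifier, which is exactly the result on which the search goes
  on; the outer subtraction is a conjunction with the test for a further candidate. For connectives
  the counter tells whether the left operand is already known.\<close>

definition return_code :: com where
  "return_code = (vSp ::= Minus (V vSp) (N 1) ;;
     vP ::= A aFrame (V vSp) ;; vT ::= A aFm (V vP) ;;
     If (Minus (V vT) (N 5))
       (vC ::= Plus (A aCount (V vSp)) (N 1) ;;
        If (Minus (Eq (V vRes) (Minus (V vT) (N 6))) (Minus (N 1) (Minus (A aH (V vP)) (V vC))))
          (Asg aCount (V vSp) (V vC) ;; Asg aEnv (A aFm (Plus (V vP) (N 1))) (A aU (V vC)) ;;
           vPos ::= Plus (V vP) (N 2) ;; vMode ::= N 1 ;; vSp ::= Plus (V vSp) (N 1))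
          (Asg aEnv (A aFm (Plus (V vP) (N 1))) (A aSaved (V vSp))))
       (If (Minus (V vT) (N 3))
          (If (A aCount (V vSp))
             (If (Minus (V vT) (N 4))
                (vRes ::= Minus (N 1) (Minus (N 1) (Plus (V vRes) (A aSaved (V vSp)))))
                (vRes ::= Minus (Plus (V vRes) (A aSaved (V vSp))) (N 1)))
             (Asg aCount (V vSp) (N 1) ;; Asg aSaved (V vSp) (V vRes) ;;
              vMode ::= N 1 ;; vSp ::= Plus (V vSp) (N 1)))
          (vRes ::= Minus (N 1) (V vRes))))"

definition eval_step :: "nat \<Rightarrow> nat \<Rightarrow> com" where
  "eval_step D k = If (V vMode) (call_code D k) return_code"

text \<open>The loop ends when a result is returned to the empty stack.\<close>

abbreviation eval_guard :: aexp where
  "eval_guard \<equiv> Plus (V vMode) (V vSp)"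

definition eval_code :: "nat \<Rightarrow> nat \<Rightarrow> com" where
  "eval_code D k = (vPos ::= N 0 ;; vSp ::= N 0 ;; vMode ::= N 1 ;; While eval_guard (eval_step D k))"

section \<open>Correctness of the evaluator, one machine step at a time\<close>

definition same_data :: "store \<Rightarrow> store \<Rightarrow> bool" where
  "same_data st st' \<longleftrightarrow> st' aFm = st aFm \<and> st' aH = st aH \<and> st' aU = st aU \<and> st' aF = st aF"

definition same_frames :: "nat \<Rightarrow> store \<Rightarrow> store \<Rightarrow> bool" where
  "same_frames m st st' \<longleftrightarrow>
     (\<forall>i<m. st' aFrame i = st aFrame i \<and> st' aCount i = st aCount i \<and> st' aSaved i = st aSaved i)"

definition called :: "store \<Rightarrow> nat \<Rightarrow> bool" where
  "called st p \<longleftrightarrow> st vMode 0 = 1 \<and> st vPos 0 = p"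

text \<open>The contract of a recursive call: the result is in \<open>vRes\<close>,
  \<open>vPos\<close> stands just behind the subformula, and the environment and the frames below
  the entry level are as before.\<close>

definition evaluated :: "store \<Rightarrow> store \<Rightarrow> nat \<Rightarrow> bool \<Rightarrow> bool" where
  "evaluated st st' p b \<longleftrightarrow> same_data st st' \<and> st' vMode 0 = 0 \<and> st' vPos 0 = p \<and>
     st' vRes 0 = of_bool b \<and> st' vSp 0 = st vSp 0 \<and> st' aEnv = st aEnv \<and>
     same_frames (st vSp 0) st st'"

lemmas eval_defs = same_data_def same_frames_def called_def evaluated_def

definition reaches :: "nat \<Rightarrow> nat \<Rightarrow> nat list \<Rightarrow> store \<Rightarrow> nat \<Rightarrow> store \<Rightarrow> bool" where
  "reaches D k w st t st' \<longleftrightarrow> (\<exists>n\<le>t. iters eval_guard (eval_step D k) (st, w) n (st', w))"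

lemma reaches_trans:
  "reaches D k w st t st' \<Longrightarrow> reaches D k w st' t' st'' \<Longrightarrow> reaches D k w st (t + t') st''"
  unfolding reaches_def by (meson add_mono iters_trans)

lemma reaches_mono: "reaches D k w st t st' \<Longrightarrow> t \<le> t' \<Longrightarrow> reaches D k w st t' st'"
  unfolding reaches_def by (meson le_trans)

lemma reaches_step:
  assumes "wp (eval_step D k) (\<lambda>n (st1, w1). n \<le> D \<and> w1 = w \<and> R st1) (st, w)"
    and "st vMode 0 + st vSp 0 \<noteq> 0"
  shows "\<exists>st1. reaches D k w st (D + 1) st1 \<and> R st1"
proof -
  from assms(1) obtain n st1 where "exec (eval_step D k) (st, w) n (st1, w)" "n \<le> D" "R st1"
    by (auto simp: wp_def)
  moreover from this(1) have "iters eval_guard (eval_step D k) (st, w) (Suc (n + 0)) (st1, w)"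
    by (rule iters_step[rotated]) (use assms(2) in \<open>auto intro: iters_refl\<close>)
  ultimately show ?thesis
    by (auto simp: reaches_def)
qed

lemma call_atom:
  assumes "called st p" and "holds (st aFm) p (fm_code \<phi>)"
    and \<phi>: "(\<exists>x y. \<phi> = Equal x y) \<or> (\<exists>x y. \<phi> = Edge x y) \<or> (\<exists>i x y. \<phi> = Succ i x y)"
  shows "\<exists>st1. reaches D k w st (D + 1) st1 \<and>
    evaluated st st1 (p + fm_length \<phi>) (rsat rg (erel D k (st aF)) p (st aEnv) \<phi>)"
proof (rule reaches_step)
  show "st vMode 0 + st vSp 0 \<noteq> 0"
    using assms by (simp add: called_def)
  show "wp (eval_step D k) (\<lambda>n (st1, w1). n \<le> D \<and> w1 = w \<and>
    evaluated st st1 (p + fm_length \<phi>) (rsat rg (erel D k (st aF)) p (st aEnv) \<phi>)) (st, w)"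
    using \<phi>
  proof (elim disjE exE)
    fix x y assume "\<phi> = Equal x y"
    then show ?thesis
      using assms(1,2) by (simp add: eval_step_def call_code_def eval_defs eval_nat_numeral)
  next
    fix x y assume \<phi>: "\<phi> = Edge x y"
    let ?st = "put vMode 0 0 (put vT 0 1 st)"
    have "wp (rel_code D k (N 0) (env_at 1) (env_at 2)) (\<lambda>n (st1, w1). n \<le> D \<and> w1 = w \<and>
      evaluated st (put vPos 0 (p + 3) st1) (p + 3) (rsat rg (erel D k (st aF)) p (st aEnv) \<phi>) \<and> st1 vPos 0 = p)
      (?st, w)"
      by (rule wp_frame[OF wp_rel_code[where j' = 0 and a = "st aEnv x" and b = "st aEnv y"]])
        (use assms(1,2) \<phi> in \<open>auto simp: agree_off_def eval_defs eval_nat_numeral\<close>)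
    then show ?thesis
      using assms(1,2) \<phi>
      by (simp add: eval_step_def call_code_def called_def wp_Asg_fun) (erule wp_mono, auto)
  next
    fix i x y assume \<phi>: "\<phi> = Succ i x y"
    let ?st = "put vMode 0 0 (put vT 0 2 st)"
    have "wp (rel_code D k (Plus (A aFm (pos 1)) (N 1)) (env_at 2) (env_at 3)) (\<lambda>n (st1, w1). n \<le> D \<and> w1 = w \<and>
      evaluated st (put vPos 0 (p + 4) st1) (p + 4) (rsat rg (erel D k (st aF)) p (st aEnv) \<phi>) \<and> st1 vPos 0 = p)
      (?st, w)"
      by (rule wp_frame[OF wp_rel_code[where j' = "Suc i" and a = "st aEnv x" and b = "st aEnv y"]])
        (use assms(1,2) \<phi> in \<open>auto simp: agree_off_def eval_defs eval_nat_numeral\<close>)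
    then show ?thesis
      using assms(1,2) \<phi>
      by (simp add: eval_step_def call_code_def called_def wp_Asg_fun) (erule wp_mono, auto)
  qed
qed

lemma call_push:
  assumes "called st p" and "st aFm p \<in> {3, 4, 5}"
  shows "\<exists>st1. reaches D k w st (D + 1) st1 \<and> called st1 (p + 1) \<and> same_data st st1 \<and>
    st1 aEnv = st aEnv \<and> st1 vSp 0 = Suc (st vSp 0) \<and> st1 aFrame (st vSp 0) = p \<and>
    st1 aCount (st vSp 0) = 0 \<and> same_frames (st vSp 0) st st1"
  by (rule reaches_step)
    (use assms in \<open>auto simp: eval_step_def call_code_def eval_defs\<close>)

lemma call_quantifier:
  assumes "called st p" and "st aFm p \<in> {6, 7}" and "st aFm (p + 1) = x"
  shows "\<exists>st1. reaches D k w st (D + 1) st1 \<and> called st1 (p + 2) \<and> same_data st st1 \<and>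
    st1 aEnv = (st aEnv)(x := st aU 0) \<and> st1 vSp 0 = Suc (st vSp 0) \<and> st1 aFrame (st vSp 0) = p \<and>
    st1 aCount (st vSp 0) = 0 \<and> st1 aSaved (st vSp 0) = st aEnv x \<and> same_frames (st vSp 0) st st1"
  by (rule reaches_step)
    (use assms in \<open>auto simp: eval_step_def call_code_def eval_defs\<close>)

lemma return_neg:
  assumes "st vMode 0 = 0" and "st vSp 0 = Suc m" and "st aFm (st aFrame m) = 3"
    and "st vRes 0 = of_bool b"
  shows "\<exists>st1. reaches D k w st (D + 1) st1 \<and> same_data st st1 \<and> st1 vMode 0 = 0 \<and>
    st1 vPos 0 = st vPos 0 \<and> st1 vRes 0 = of_bool (\<not> b) \<and> st1 vSp 0 = m \<and> st1 aEnv = st aEnv \<and>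
    same_frames m st st1"
  by (rule reaches_step)
    (use assms in \<open>auto simp: eval_step_def return_code_def eval_defs\<close>)

text \<open>After the left operand, \<open>vPos\<close> already points at the right one, so the next
  call starts there without storing its position.\<close>

lemma return_left:
  assumes "st vMode 0 = 0" and "st vSp 0 = Suc m" and "st aFm (st aFrame m) \<in> {4, 5}"
    and "st aCount m = 0"
  shows "\<exists>st1. reaches D k w st (D + 1) st1 \<and> same_data st st1 \<and> called st1 (st vPos 0) \<and>
    st1 vSp 0 = Suc m \<and> st1 aEnv = st aEnv \<and> st1 aFrame m = st aFrame m \<and>
    st1 aCount m = 1 \<and> st1 aSaved m = st vRes 0 \<and> same_frames m st st1"
  by (rule reaches_step)
    (use assms in \<open>auto simp: eval_step_def return_code_def eval_defs\<close>)

lemma return_right: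
  assumes "st vMode 0 = 0" and "st vSp 0 = Suc m" and "st aFm (st aFrame m) = (if cj then 4 else 5)"
    and "st aCount m = 1" and "st vRes 0 = of_bool b" and "st aSaved m = of_bool a"
  shows "\<exists>st1. reaches D k w st (D + 1) st1 \<and> same_data st st1 \<and> st1 vMode 0 = 0 \<and>
    st1 vPos 0 = st vPos 0 \<and> st1 vRes 0 = of_bool (if cj then a \<and> b else a \<or> b) \<and>
    st1 vSp 0 = m \<and> st1 aEnv = st aEnv \<and> same_frames m st st1"
  by (rule reaches_step)
    (use assms in \<open>auto simp: eval_step_def return_code_def eval_defs\<close>)

lemma return_continue:
  assumes "st vMode 0 = 0" and "st vSp 0 = Suc m" and "st aFrame m = p"
    and "st aFm p = (if al then 7 else 6)" and "st aFm (p + 1) = x" and "st aCount m = c"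
    and "st vRes 0 = of_bool al" and "Suc c < st aH p"
  shows "\<exists>st1. reaches D k w st (D + 1) st1 \<and> same_data st st1 \<and> called st1 (p + 2) \<and>
    st1 vSp 0 = Suc m \<and> st1 aEnv = (st aEnv)(x := st aU (Suc c)) \<and> st1 aFrame m = p \<and>
    st1 aCount m = Suc c \<and> st1 aSaved m = st aSaved m \<and> same_frames m st st1"
  by (rule reaches_step)
    (use assms in \<open>auto simp: eval_step_def return_code_def eval_defs\<close>)

lemma return_finish:
  assumes "st vMode 0 = 0" and "st vSp 0 = Suc m" and "st aFrame m = p"
    and "st aFm p = (if al then 7 else 6)" and "st aFm (p + 1) = x" and "st aCount m = c"
    and "st vRes 0 = of_bool b" and "b \<noteq> al \<or> st aH p \<le> Suc c"
  shows "\<exists>st1. reaches D k w st (D + 1) st1 \<and> same_data st st1 \<and> st1 vMode 0 = 0 \<and>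
    st1 vPos 0 = st vPos 0 \<and> st1 vRes 0 = of_bool b \<and> st1 vSp 0 = m \<and>
    st1 aEnv = (st aEnv)(x := st aSaved m) \<and> same_frames m st st1"
  by (rule reaches_step)
    (use assms in \<open>auto simp: eval_step_def return_code_def eval_defs\<close>)

lemma same_data_trans: "same_data st st1 \<Longrightarrow> same_data st1 st2 \<Longrightarrow> same_data st st2"
  by (simp add: same_data_def)

lemma same_frames_trans:
  "same_frames m st st1 \<Longrightarrow> same_frames m' st1 st2 \<Longrightarrow> m \<le> m' \<Longrightarrow> same_frames m st st2"
  by (simp add: same_frames_def)

text \<open>Induction on the number of remaining candidates, entered at a moment when candidate
  \<open>c\<close> has just been assigned. Each candidate costs one call of the body and one return
  step.\<close>

lemma quantifier_loop:
  assumes body: "\<And>st2 c. c < st aH p \<Longrightarrow> called st2 (p + 2) \<Longrightarrow> same_data st st2 \<Longrightarrow>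
      st2 aEnv = (st aEnv)(x := st aU c) \<Longrightarrow>
      \<exists>st3. reaches D k w st2 t st3 \<and> evaluated st2 st3 p' (P c)"
    and p: "st aFm p = (if al then 7 else 6)" "st aFm (p + 1) = x"
    and m: "st vSp 0 = m"
    and st1: "called st1 (p + 2)" "same_data st st1" "st1 aEnv = (st aEnv)(x := st aU c)"
      "st1 vSp 0 = Suc m" "st1 aFrame m = p" "st1 aCount m = c" "st1 aSaved m = st aEnv x"
      "same_frames m st st1"
    and c: "c < st aH p"
  shows "\<exists>st'. reaches D k w st1 ((st aH p - c) * (t + (D + 1))) st' \<and>
    evaluated st st' p' (if al then \<forall>i\<in>{c..<st aH p}. P i else \<exists>i\<in>{c..<st aH p}. P i)"
  using st1 c
proof (induction "st aH p - c" arbitrary: c st1)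
  case 0
  then show ?case
    by simp
next
  case (Suc d)
  note st1 = Suc.prems(1-8) and c = Suc.prems(9)
  from body[OF c st1(1-3)] obtain st2 where
    r2: "reaches D k w st1 t st2" and ev2: "evaluated st1 st2 p' (P c)"
    by auto
  have st2: "same_data st st2" "st2 vMode 0 = 0" "st2 vPos 0 = p'" "st2 vRes 0 = of_bool (P c)"
    "st2 vSp 0 = Suc m" "st2 aEnv = (st aEnv)(x := st aU c)" "st2 aFrame m = p" "st2 aCount m = c"
    "st2 aSaved m = st aEnv x" "same_frames m st st2"
    using ev2 st1 by (auto simp: evaluated_def same_data_def same_frames_def)
  have data2: "st2 aFm p = (if al then 7 else 6)" "st2 aFm (p + 1) = x" "st2 aH = st aH" "st2 aU = st aU"
    using st2(1) p by (auto simp: same_data_def)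
  show ?case
  proof (cases "P c = al \<and> Suc c < st aH p")
    case True
    then obtain st3 where r3: "reaches D k w st2 (D + 1) st3" and st3: "same_data st2 st3"
      "called st3 (p + 2)" "st3 vSp 0 = Suc m" "st3 aEnv = (st2 aEnv)(x := st2 aU (Suc c))"
      "st3 aFrame m = p" "st3 aCount m = Suc c" "st3 aSaved m = st2 aSaved m" "same_frames m st2 st3"
      using return_continue[of st2 m p al x c D k w] st2 data2 by auto
    have "\<exists>st'. reaches D k w st3 ((st aH p - Suc c) * (t + (D + 1))) st' \<and> evaluated st st' p'
       (if al then \<forall>i\<in>{Suc c..<st aH p}. P i else \<exists>i\<in>{Suc c..<st aH p}. P i)"
    proof (rule Suc.hyps(1)[OF _ st3(2) same_data_trans[OF st2(1) st3(1)] _ st3(3,5,6)])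
      show "d = st aH p - Suc c"
        using Suc.hyps(2) by simp
      show "same_frames m st st3"
        using same_frames_trans[OF st2(10) st3(8)] by simp
      show "st3 aSaved m = st aEnv x" "st3 aEnv = (st aEnv)(x := st aU (Suc c))"
        using st3 st2 data2 by simp_all
      show "Suc c < st aH p"
        using True by simp
    qed
    then obtain st' where r': "reaches D k w st3 ((st aH p - Suc c) * (t + (D + 1))) st'"
      and ev': "evaluated st st' p'
       (if al then \<forall>i\<in>{Suc c..<st aH p}. P i else \<exists>i\<in>{Suc c..<st aH p}. P i)"
      by auto
    have "{c..<st aH p} = insert c {Suc c..<st aH p}"
      using c by auto
    then have "(if al then \<forall>i\<in>{c..<st aH p}. P i else \<exists>i\<in>{c..<st aH p}. P i) \<longleftrightarrow>
      (if al then \<forall>i\<in>{Suc c..<st aH p}. P i else \<exists>i\<in>{Suc c..<st aH p}. P i)"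
      using True by auto
    moreover have "t + (D + 1) + (st aH p - Suc c) * (t + (D + 1)) = (st aH p - c) * (t + (D + 1))"
      using c by (metis Suc_diff_Suc mult_Suc)
    ultimately show ?thesis
      using reaches_trans[OF reaches_trans[OF r2 r3] r'] ev' by auto
  next
    case False
    then obtain st3 where r3: "reaches D k w st2 (D + 1) st3" and st3: "same_data st2 st3"
      "st3 vMode 0 = 0" "st3 vPos 0 = st2 vPos 0" "st3 vRes 0 = of_bool (P c)" "st3 vSp 0 = m"
      "st3 aEnv = (st2 aEnv)(x := st2 aSaved m)" "same_frames m st2 st3"
      using return_finish[of st2 m p al x c "P c" D k w] st2 data2 by auto
    \<comment> \<open>The search stops because the last result is decisive or because
      \<open>c\<close> is the last candidate; in both cases this result is the value of the
      quantifier.\<close>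
    have "(if al then \<forall>i\<in>{c..<st aH p}. P i else \<exists>i\<in>{c..<st aH p}. P i) \<longleftrightarrow> P c"
    proof (cases "P c = al")
      case True
      with False c have "{c..<st aH p} = {c}"
        by auto
      with True show ?thesis
        by simp
    next
      case neq: False
      with c show ?thesis
        by auto
    qed
    moreover have "evaluated st st3 p' (P c)"
      using st2 st3 same_frames_trans[OF st2(10) st3(7)] m
      by (auto simp: evaluated_def same_data_def)
    moreover have "reaches D k w st1 ((st aH p - c) * (t + (D + 1))) st3"
      using reaches_trans[OF r2 r3]
      by (rule reaches_mono) (use c mult_le_mono1[of 1 "st aH p - c" "t + (D + 1)"] in simp)
    ultimately show ?thesis
      by auto
  qed
qed

section \<open>Evaluation cost and correctness by induction on the formula\<close>

definition ranges :: "store \<Rightarrow> nat \<Rightarrow> nat set" where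
  "ranges st q = st aU ` {..<st aH q}"

lemma ranges_cong:
  assumes "same_data st st'"
  shows "ranges st' = ranges st" "st' aF = st aF"
  using assms by (auto simp: same_data_def ranges_def fun_eq_iff)

lemma atom_cost: "d \<le> d * (h + 5) ^ l" for d h l :: nat
  using mult_le_mono2[of 1 "(h + 5) ^ l" d] by simp

text \<open>The 3 stands for the push and the returns after the left and the right operand; with
  \<open>y = 1\<close> the bound also covers negation.\<close>

lemma binary_cost:
  fixes x y h :: nat
  assumes "1 \<le> x" "1 \<le> y"
  shows "3 + x + y \<le> (h + 5) * (x * y)"
proof -
  have "1 \<le> x * y" "x \<le> x * y" "y \<le> x * y"
    using assms by auto
  then have "3 + x + y \<le> 5 * (x * y)"
    by linarith
  also have "\<dots> \<le> (h + 5) * (x * y)"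
    by simp
  finally show ?thesis .
qed

text \<open>One step enters, and each of at most \<open>h\<close> candidates costs the body and a
  return. The two factors match the two symbols that a quantifier occupies in the code.\<close>

lemma quantifier_cost:
  fixes x h :: nat
  assumes "1 \<le> x"
  shows "1 + h * (x + 1) \<le> (h + 5) * ((h + 5) * x)"
proof -
  have "h * (x + 1) \<le> h * (2 * x)"
    using assms by (intro mult_le_mono2) simp
  then have "1 + h * (x + 1) \<le> x + h * (2 * x)"
    using assms by linarith
  also have "\<dots> \<le> (h + 5) * ((h + 5) * x)"
    by (simp add: algebra_simps)
  finally show ?thesis .
qed

text \<open>The ranges must be non-empty because a quantifier tries its first candidate without a
  test. The base \<open>h + 5\<close> leaves room for the constant overheads, and
  \<open>D + 1\<close> is the cost of a single step including its search through \<open>D\<close>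
  slots.\<close>

definition evaluates :: "nat \<Rightarrow> nat \<Rightarrow> nat list \<Rightarrow> nat \<Rightarrow> fm \<Rightarrow> bool" where
  "evaluates D k w h \<phi> \<longleftrightarrow> (\<forall>st p. called st p \<longrightarrow> holds (st aFm) p (fm_code \<phi>) \<longrightarrow>
     (\<forall>q. p \<le> q \<and> q < p + fm_length \<phi> \<longrightarrow> 1 \<le> st aH q \<and> st aH q \<le> h) \<longrightarrow>
     (\<exists>st'. reaches D k w st ((D + 1) * (h + 5) ^ fm_length \<phi>) st' \<and>
       evaluated st st' (p + fm_length \<phi>) (rsat (ranges st) (erel D k (st aF)) p (st aEnv) \<phi>)))"

text \<open>Restates the claim for a later store \<open>st1\<close> with the ranges and relations of
  the original store \<open>st\<close>, which the recursive calls share.\<close>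

lemma evaluatesD:
  assumes "evaluates D k w h \<phi>" and "called st1 p" and "same_data st st1" and "st1 aEnv = \<tau>"
    and "holds (st aFm) p (fm_code \<phi>)"
    and "\<forall>q. p \<le> q \<and> q < p + fm_length \<phi> \<longrightarrow> 1 \<le> st aH q \<and> st aH q \<le> h"
  shows "\<exists>st'. reaches D k w st1 ((D + 1) * (h + 5) ^ fm_length \<phi>) st' \<and>
    evaluated st1 st' (p + fm_length \<phi>) (rsat (ranges st) (erel D k (st aF)) p \<tau> \<phi>)"
proof -
  have "st1 aFm = st aFm" "st1 aH = st aH"
    using assms(3) by (simp_all add: same_data_def)
  then show ?thesis
    using assms(1)[unfolded evaluates_def, rule_format, of st1 p] assms(2,4-6)
      ranges_cong[OF assms(3)] by metis
qed

lemma evaluates_atom: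
  assumes "(\<exists>x y. \<phi> = Equal x y) \<or> (\<exists>x y. \<phi> = Edge x y) \<or> (\<exists>i x y. \<phi> = Succ i x y)"
  shows "evaluates D k w h \<phi>"
  unfolding evaluates_def
proof (intro allI impI)
  fix st p
  assume "called st p" "holds (st aFm) p (fm_code \<phi>)"
  from call_atom[OF this assms] show "\<exists>st'. reaches D k w st ((D + 1) * (h + 5) ^ fm_length \<phi>) st' \<and>
    evaluated st st' (p + fm_length \<phi>) (rsat (ranges st) (erel D k (st aF)) p (st aEnv) \<phi>)"
    using atom_cost by (blast intro: reaches_mono)
qed

lemma evaluates_Neg:
  assumes "evaluates D k w h \<phi>"
  shows "evaluates D k w h (Neg \<phi>)"
  unfolding evaluates_def
proof (intro allI impI)
  fix st p
  assume prems: "called st p" "holds (st aFm) p (fm_code (Neg \<phi>))"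
    "\<forall>q. p \<le> q \<and> q < p + fm_length (Neg \<phi>) \<longrightarrow> 1 \<le> st aH q \<and> st aH q \<le> h"
  define m where "m = st vSp 0"
  let ?b = "rsat (ranges st) (erel D k (st aF)) (p + 1) (st aEnv) \<phi>"
  let ?t = "(D + 1) * (h + 5) ^ fm_length \<phi>"
  obtain st1 where r1: "reaches D k w st (D + 1) st1" and st1: "called st1 (p + 1)" "same_data st st1"
    "st1 aEnv = st aEnv" "st1 vSp 0 = Suc m" "st1 aFrame m = p" "same_frames m st st1"
    using call_push[OF prems(1), of D k w] prems(2) unfolding m_def by auto
  obtain st2 where r2: "reaches D k w st1 ?t st2" and ev2: "evaluated st1 st2 (p + 1 + fm_length \<phi>) ?b"
    using evaluatesD[OF assms st1(1-3)] prems by auto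
  have st2: "same_data st st2" "st2 vMode 0 = 0" "st2 vPos 0 = p + 1 + fm_length \<phi>"
    "st2 vRes 0 = of_bool ?b" "st2 vSp 0 = Suc m" "st2 aEnv = st aEnv" "st2 aFrame m = p"
    "same_frames m st st2"
    using ev2 st1 by (auto simp: evaluated_def same_data_def same_frames_def)
  have "st2 aFm (st2 aFrame m) = 3"
    using st2 prems(2) by (simp add: same_data_def)
  then obtain st3 where r3: "reaches D k w st2 (D + 1) st3" and st3: "same_data st2 st3"
    "st3 vMode 0 = 0" "st3 vPos 0 = p + 1 + fm_length \<phi>" "st3 vRes 0 = of_bool (\<not> ?b)"
    "st3 vSp 0 = m" "st3 aEnv = st aEnv" "same_frames m st2 st3"
    using return_neg[of st2 m ?b D k w] st2 by auto
  have "evaluated st st3 (p + fm_length (Neg \<phi>)) (rsat (ranges st) (erel D k (st aF)) p (st aEnv) (Neg \<phi>))"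
    using st3 same_data_trans[OF st2(1) st3(1)] same_frames_trans[OF st2(8) st3(7)]
    by (simp add: evaluated_def m_def)
  moreover have "2 + (h + 5) ^ fm_length \<phi> \<le> (h + 5) ^ fm_length (Neg \<phi>)"
    using binary_cost[of "(h + 5) ^ fm_length \<phi>" 1 h] by simp
  then have "(D + 1) * (2 + (h + 5) ^ fm_length \<phi>) \<le> (D + 1) * (h + 5) ^ fm_length (Neg \<phi>)"
    by (rule mult_le_mono2)
  with reaches_trans[OF reaches_trans[OF r1 r2] r3]
  have "reaches D k w st ((D + 1) * (h + 5) ^ fm_length (Neg \<phi>)) st3"
    by (elim reaches_mono) (simp only: add_mult_distrib2 mult_2_right ac_simps)
  ultimately show "\<exists>st'. reaches D k w st ((D + 1) * (h + 5) ^ fm_length (Neg \<phi>)) st' \<and>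
      evaluated st st' (p + fm_length (Neg \<phi>))
        (rsat (ranges st) (erel D k (st aF)) p (st aEnv) (Neg \<phi>))"
    by blast
qed

lemma evaluates_binary:
  assumes "evaluates D k w h \<chi>" and "evaluates D k w h \<psi>"
    and \<phi>: "\<phi> = (if cj then Conj \<chi> \<psi> else Disj \<chi> \<psi>)"
  shows "evaluates D k w h \<phi>"
  unfolding evaluates_def
proof (intro allI impI)
  fix st p
  assume prems: "called st p" "holds (st aFm) p (fm_code \<phi>)"
    "\<forall>q. p \<le> q \<and> q < p + fm_length \<phi> \<longrightarrow> 1 \<le> st aH q \<and> st aH q \<le> h"
  let ?B = "\<lambda>\<phi>. (h + 5) ^ fm_length \<phi>"
  let ?a = "rsat (ranges st) (erel D k (st aF)) (p + 1) (st aEnv) \<chi>"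
  let ?b = "rsat (ranges st) (erel D k (st aF)) (p + 1 + fm_length \<chi>) (st aEnv) \<psi>"
  have code: "holds (st aFm) (p + 1) (fm_code \<chi>)" "holds (st aFm) (p + 1 + fm_length \<chi>) (fm_code \<psi>)"
    using prems(2) by (auto simp: \<phi> fm_length_def split: if_splits)
  have len: "fm_length \<phi> = 1 + fm_length \<chi> + fm_length \<psi>"
    by (simp add: \<phi>)
  define m where "m = st vSp 0"
  have op: "st aFm p = (if cj then 4 else 5)"
    using prems(2) \<phi> by (auto split: if_splits)
  then have op': "st aFm p \<in> {3, 4, 5}"
    by simp
  obtain st1 where r1: "reaches D k w st (D + 1) st1" and st1: "called st1 (p + 1)" "same_data st st1"
    "st1 aEnv = st aEnv" "st1 vSp 0 = Suc m" "st1 aFrame m = p" "st1 aCount m = 0" "same_frames m st st1"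
    using call_push[OF prems(1) op', of D k w] unfolding m_def by blast
  obtain st2 where r2: "reaches D k w st1 ((D + 1) * ?B \<chi>) st2" and ev2: "evaluated st1 st2 (p + 1 + fm_length \<chi>) ?a"
    using evaluatesD[OF assms(1) st1(1-3) code(1)] prems(3) len by auto
  have st2: "same_data st st2" "st2 vMode 0 = 0" "st2 vPos 0 = p + 1 + fm_length \<chi>"
    "st2 vRes 0 = of_bool ?a" "st2 vSp 0 = Suc m" "st2 aEnv = st aEnv" "st2 aFrame m = p"
    "st2 aCount m = 0" "same_frames m st st2"
    using ev2 st1 by (auto simp: evaluated_def same_data_def same_frames_def)
  have "st2 aFm (st2 aFrame m) \<in> {4, 5}"
    using st2 op by (auto simp: same_data_def)
  then obtain st3 where r3: "reaches D k w st2 (D + 1) st3" and st3: "same_data st2 st3"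
    "called st3 (p + 1 + fm_length \<chi>)" "st3 vSp 0 = Suc m" "st3 aEnv = st aEnv" "st3 aFrame m = p"
    "st3 aCount m = 1" "st3 aSaved m = of_bool ?a" "same_frames m st2 st3"
    using return_left[of st2 m D k w] st2 by auto
  obtain st4 where r4: "reaches D k w st3 ((D + 1) * ?B \<psi>) st4"
    and ev4: "evaluated st3 st4 (p + 1 + fm_length \<chi> + fm_length \<psi>) ?b"
    using evaluatesD[OF assms(2) st3(2) same_data_trans[OF st2(1) st3(1)] st3(4) code(2)] prems(3) len
    by auto
  have fr3: "same_frames m st st3"
    using same_frames_trans[OF st2(9) st3(8)] by simp
  have st4: "same_data st st4" "st4 vMode 0 = 0" "st4 vPos 0 = p + 1 + fm_length \<chi> + fm_length \<psi>"
    "st4 vRes 0 = of_bool ?b" "st4 vSp 0 = Suc m" "st4 aEnv = st aEnv" "st4 aFrame m = p"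
    "st4 aCount m = 1" "st4 aSaved m = of_bool ?a" "same_frames m st st4"
    using ev4 st3 fr3 st2(1) by (auto simp: evaluated_def same_data_def same_frames_def)
  have "st4 aFm (st4 aFrame m) = (if cj then 4 else 5)"
    using st4 op by (simp add: same_data_def)
  then obtain st5 where r5: "reaches D k w st4 (D + 1) st5" and st5: "same_data st4 st5"
    "st5 vMode 0 = 0" "st5 vPos 0 = p + 1 + fm_length \<chi> + fm_length \<psi>"
    "st5 vRes 0 = of_bool (if cj then ?a \<and> ?b else ?a \<or> ?b)" "st5 vSp 0 = m" "st5 aEnv = st aEnv"
    "same_frames m st4 st5"
    using return_right[of st4 m cj ?b ?a D k w] st4 by auto
  have "evaluated st st5 (p + fm_length \<phi>) (if cj then ?a \<and> ?b else ?a \<or> ?b)"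
    using st5 same_data_trans[OF st4(1) st5(1)] same_frames_trans[OF st4(10) st5(7)] \<phi>
    by (simp add: evaluated_def m_def)
  moreover have "D + 1 + (D + 1) * ?B \<chi> + (D + 1) + (D + 1) * ?B \<psi> + (D + 1) \<le> (D + 1) * ?B \<phi>"
    using mult_le_mono2[OF binary_cost[of "?B \<chi>" "?B \<psi>" h], of "D + 1"]
    by (simp add: \<phi> add_mult_distrib2 power_add)
  then have "reaches D k w st ((D + 1) * ?B \<phi>) st5"
    using reaches_trans[OF reaches_trans[OF reaches_trans[OF reaches_trans[OF r1 r2] r3] r4] r5]
    by (rule reaches_mono[rotated])
  ultimately show "\<exists>st'. reaches D k w st ((D + 1) * ?B \<phi>) st' \<and>
      evaluated st st' (p + fm_length \<phi>) (rsat (ranges st) (erel D k (st aF)) p (st aEnv) \<phi>)"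
    by (auto simp: \<phi> split: if_splits)
qed

lemma evaluates_quantifier:
  assumes "evaluates D k w h \<psi>" and \<phi>: "\<phi> = (if al then Forall x \<psi> else Exists x \<psi>)"
  shows "evaluates D k w h \<phi>"
  unfolding evaluates_def
proof (intro allI impI)
  fix st p
  assume prems: "called st p" "holds (st aFm) p (fm_code \<phi>)"
    "\<forall>q. p \<le> q \<and> q < p + fm_length \<phi> \<longrightarrow> 1 \<le> st aH q \<and> st aH q \<le> h"
  let ?t = "(D + 1) * (h + 5) ^ fm_length \<psi>"
  let ?P = "\<lambda>b. rsat (ranges st) (erel D k (st aF)) (p + 2) ((st aEnv)(x := b)) \<psi>"
  have code: "holds (st aFm) (p + 2) (fm_code \<psi>)"
    using prems(2) by (auto simp: \<phi> split: if_splits)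
  have len: "fm_length \<phi> = 2 + fm_length \<psi>"
    by (simp add: \<phi>)
  have H: "1 \<le> st aH p" "st aH p \<le> h"
    using prems(3) len by auto
  have body: "\<exists>st2. reaches D k w st1 ?t st2 \<and> evaluated st1 st2 (p + fm_length \<phi>) (?P (st aU c))"
    if "called st1 (p + 2)" "same_data st st1" "st1 aEnv = (st aEnv)(x := st aU c)" for st1 c
    using evaluatesD[OF assms(1) that code] prems(3) len by (simp add: fun_upd_def)
  define m where "m = st vSp 0"
  have op: "st aFm p = (if al then 7 else 6)" "st aFm (p + 1) = x"
    using prems(2) \<phi> by (auto split: if_splits)
  then have op': "st aFm p \<in> {6, 7}"
    by simp
  obtain st1 where r1: "reaches D k w st (D + 1) st1" and st1: "called st1 (p + 2)" "same_data st st1"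
    "st1 aEnv = (st aEnv)(x := st aU 0)" "st1 vSp 0 = Suc m" "st1 aFrame m = p" "st1 aCount m = 0"
    "st1 aSaved m = st aEnv x" "same_frames m st st1"
    using call_quantifier[OF prems(1) op' op(2), of D k w] unfolding m_def by blast
  have "\<exists>st'. reaches D k w st1 ((st aH p - 0) * (?t + (D + 1))) st' \<and>
    evaluated st st' (p + fm_length \<phi>) (if al then \<forall>i\<in>{0..<st aH p}. ?P (st aU i)
      else \<exists>i\<in>{0..<st aH p}. ?P (st aU i))"
    by (rule quantifier_loop[OF body op m_def[symmetric] st1]) (use H in auto)
  then obtain st2 where r2: "reaches D k w st1 (st aH p * (?t + (D + 1))) st2"
    and ev: "evaluated st st2 (p + fm_length \<phi>) (if al then \<forall>i\<in>{0..<st aH p}. ?P (st aU i)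
      else \<exists>i\<in>{0..<st aH p}. ?P (st aU i))"
    by auto
  have "D + 1 + st aH p * (?t + (D + 1)) \<le> D + 1 + h * (?t + (D + 1))"
    by (intro add_left_mono mult_le_mono1 H(2))
  also have "\<dots> \<le> (D + 1) * (h + 5) ^ fm_length \<phi>"
    using mult_le_mono2[OF quantifier_cost[of "(h + 5) ^ fm_length \<psi>" h], of "D + 1"]
    by (simp add: \<phi> algebra_simps)
  finally have "reaches D k w st ((D + 1) * (h + 5) ^ fm_length \<phi>) st2"
    by (rule reaches_mono[OF reaches_trans[OF r1 r2]])
  moreover have "(if al then \<forall>i\<in>{0..<st aH p}. ?P (st aU i) else \<exists>i\<in>{0..<st aH p}. ?P (st aU i)) =
    rsat (ranges st) (erel D k (st aF)) p (st aEnv) \<phi>"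
    by (auto simp: \<phi> ranges_def)
  ultimately show "\<exists>st'. reaches D k w st ((D + 1) * (h + 5) ^ fm_length \<phi>) st' \<and>
      evaluated st st' (p + fm_length \<phi>) (rsat (ranges st) (erel D k (st aF)) p (st aEnv) \<phi>)"
    using ev by auto
qed

theorem evaluates: "evaluates D k w h \<phi>"
proof (induction \<phi>)
  case (Conj \<chi> \<psi>)
  then show ?case
    by (rule evaluates_binary[where cj = True]) simp
next
  case (Disj \<chi> \<psi>)
  then show ?case
    by (rule evaluates_binary[where cj = False]) simp
next
  case (Exists x \<psi>)
  then show ?case
    by (rule evaluates_quantifier[where al = False]) simp
next
  case (Forall x \<psi>)
  then show ?case
    by (rule evaluates_quantifier[where al = True]) simp
qed (simp_all add: evaluates_atom evaluates_Neg)

lemma wp_eval_code: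
  assumes "holds (st aFm) 0 (fm_code \<phi>)"
    and "\<forall>q<fm_length \<phi>. 1 \<le> st aH q \<and> st aH q \<le> h"
  shows "wp (eval_code D k) (\<lambda>n (st', w'). n \<le> (D + 1) * (h + 5) ^ fm_length \<phi> \<and>
    st' vRes 0 = of_bool (rsat (ranges st) (erel D k (st aF)) 0 (st aEnv) \<phi>)) (st, w)"
proof -
  let ?st = "put vMode 0 1 (put vSp 0 0 (put vPos 0 0 st))"
  have "\<exists>st'. reaches D k w ?st ((D + 1) * (h + 5) ^ fm_length \<phi>) st' \<and>
    evaluated ?st st' (0 + fm_length \<phi>) (rsat (ranges ?st) (erel D k (?st aF)) 0 (?st aEnv) \<phi>)"
    by (rule evaluates[unfolded evaluates_def, rule_format])
      (use assms in \<open>auto simp: called_def\<close>)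
  then obtain st' n where "iters eval_guard (eval_step D k) (?st, w) n (st', w)"
    "n \<le> (D + 1) * (h + 5) ^ fm_length \<phi>"
    and ev: "evaluated ?st st' (fm_length \<phi>) (rsat (ranges ?st) (erel D k (?st aF)) 0 (?st aEnv) \<phi>)"
    by (auto simp: reaches_def)
  moreover have "ranges ?st = ranges st"
    by (simp add: ranges_def fun_eq_iff)
  ultimately have "wp (While eval_guard (eval_step D k)) (\<lambda>n (st', w'). n \<le> (D + 1) * (h + 5) ^ fm_length \<phi> \<and>
    st' vRes 0 = of_bool (rsat (ranges st) (erel D k (st aF)) 0 (st aEnv) \<phi>)) (?st, w)"
    unfolding wp_def
    by (intro exI[of _ n] exI[of _ "(st', w)"] conjI exec_While_iters) (auto simp: evaluated_def)
  then show ?thesis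
    by (simp add: eval_code_def)
qed

section \<open>The table of neighbours\<close>

text \<open>A bucket number determines its vertex, relation and direction, so insertions for
  different relations or directions never share a bucket.\<close>

lemma vals_events:
  assumes "i \<le> s" "j \<le> s"
  shows "vals (events s i ps) (2 * (s + 1) * a + 2 * j) =
      (if i = j then map snd (filter (\<lambda>e. fst e = a) ps) else [])"
    and "vals (events s i ps) (2 * (s + 1) * a + (2 * j + 1)) =
      (if i = j then map fst (filter (\<lambda>e. snd e = a) ps) else [])"
proof -
  have less: "2 * i < 2 * (s + 1)" "2 * j < 2 * (s + 1)" "2 * i + 1 < 2 * (s + 1)" "2 * j + 1 < 2 * (s + 1)"
    using assms by simp_all
  have neq: "2 * i + 1 \<noteq> 2 * j" "2 * i \<noteq> 2 * j + 1"
    by presburger+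
  note iffs = mult_add_eq_iff[OF less(1,2)] mult_add_eq_iff[OF less(3,2)]
    mult_add_eq_iff[OF less(1,4)] mult_add_eq_iff[OF less(3,4)]
  have Cons: "events s i ((a', b) # ps) =
      [(2 * (s + 1) * a' + 2 * i, b), (2 * (s + 1) * b + (2 * i + 1), a')] @ events s i ps" for a' b ps
    by (simp add: events_def)
  have Nil: "events s i [] = []"
    by (simp add: events_def)
  show "vals (events s i ps) (2 * (s + 1) * a + 2 * j) =
      (if i = j then map snd (filter (\<lambda>e. fst e = a) ps) else [])"
  proof (induction ps)
    case (Cons e ps)
    then show ?case
      by (cases e) (simp only: \<open>\<And>a' b ps. events s i ((a', b) # ps) = _\<close> vals_simps fst_conv snd_conv
          iffs neq simp_thms if_False append_Cons append_Nil, auto)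
  qed (simp add: Nil)
  show "vals (events s i ps) (2 * (s + 1) * a + (2 * j + 1)) =
      (if i = j then map fst (filter (\<lambda>e. snd e = a) ps) else [])"
  proof (induction ps)
    case (Cons e ps)
    then show ?case
      by (cases e) (simp only: \<open>\<And>a' b ps. events s i ((a', b) # ps) = _\<close> vals_simps fst_conv snd_conv
          iffs neq simp_thms if_False append_Cons append_Nil, auto)
  qed (simp add: Nil)
qed

lemma vals_all_events:
  assumes "j \<le> s"
  shows "vals (all_events s pss (s + 1)) (2 * (s + 1) * a + 2 * j) =
      map snd (filter (\<lambda>e. fst e = a) (pss ! j))"
    and "vals (all_events s pss (s + 1)) (2 * (s + 1) * a + (2 * j + 1)) =
      map fst (filter (\<lambda>e. snd e = a) (pss ! j))"
proof -
  have "vals (all_events s pss m) (2 * (s + 1) * a + 2 * j) =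
        (if j < m then map snd (filter (\<lambda>e. fst e = a) (pss ! j)) else []) \<and>
      vals (all_events s pss m) (2 * (s + 1) * a + (2 * j + 1)) =
        (if j < m then map fst (filter (\<lambda>e. snd e = a) (pss ! j)) else [])"
    if "m \<le> s + 1" for m
    using that
  proof (induction m)
    case 0
    then show ?case
      by (simp add: all_events_def)
  next
    case (Suc m)
    then have "m \<le> s"
      by simp
    with Suc assms show ?case
      by (auto simp only: all_events_Suc vals_simps vals_events less_Suc_eq) auto
  qed
  from this[of "s + 1"] assms
  show "vals (all_events s pss (s + 1)) (2 * (s + 1) * a + 2 * j) =
      map snd (filter (\<lambda>e. fst e = a) (pss ! j))"
    "vals (all_events s pss (s + 1)) (2 * (s + 1) * a + (2 * j + 1)) =
      map fst (filter (\<lambda>e. snd e = a) (pss ! j))"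
    by simp_all
qed

locale pair_lists =
  fixes s D n :: nat and pss :: "(nat \<times> nat) list list"
  assumes D_pos: "0 < D" and length_pss: "length pss = s + 1"
    and pss_less: "ps \<in> set pss \<Longrightarrow> (a, b) \<in> set ps \<Longrightarrow> a < n \<and> b < n \<and> a \<noteq> b"
    and out_le: "ps \<in> set pss \<Longrightarrow> length (filter (\<lambda>e. fst e = a) ps) \<le> D"
    and in_le: "ps \<in> set pss \<Longrightarrow> length (filter (\<lambda>e. snd e = a) ps) \<le> D"
begin

abbreviation "evs \<equiv> all_events s pss (s + 1)"
abbreviation "k \<equiv> 2 * (s + 1) * D"

lemma nth_pss: "j \<le> s \<Longrightarrow> pss ! j \<in> set pss"
  using length_pss by simp

lemma class_cases:
  assumes "c < 2 * (s + 1)"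
  obtains j where "j \<le> s" "c = 2 * j" | j where "j \<le> s" "c = 2 * j + 1"
proof (cases "even c")
  case True
  then obtain j where "c = 2 * j" ..
  with assms that(1) show ?thesis by simp
next
  case False
  then obtain j where "c = 2 * j + 1" ..
  with assms that(2) show ?thesis by simp
qed

lemma length_vals_le: "length (vals evs x) \<le> D"
proof -
  have "x mod (2 * (s + 1)) < 2 * (s + 1)"
    by simp
  moreover have "x = 2 * (s + 1) * (x div (2 * (s + 1))) + x mod (2 * (s + 1))"
    by (rule mult_div_mod_eq[symmetric])
  then obtain v where "x = 2 * (s + 1) * v + x mod (2 * (s + 1))"
    by blast
  ultimately show ?thesis
    by (elim class_cases) (metis vals_all_events length_map nth_pss out_le in_le)+
qed

text \<open>Every pair was inserted twice; the twin of an entry sits at the neighbour, in the bucket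
  of the same relation and the opposite direction.\<close>

lemma vals_back:
  assumes "c < 2 * (s + 1)" and "u \<in> set (vals evs (2 * (s + 1) * v + c))"
  shows "u < n" and "\<exists>c'<2 * (s + 1). v \<in> set (vals evs (2 * (s + 1) * u + c'))"
proof -
  have "u < n \<and> (\<exists>c'<2 * (s + 1). v \<in> set (vals evs (2 * (s + 1) * u + c')))"
    using assms(1)
  proof (cases rule: class_cases)
    case (1 j)
    with assms(2) have "(v, u) \<in> set (pss ! j)"
      by (auto simp only: vals_all_events) auto
    with pss_less[OF nth_pss[OF 1(1)]] 1(1) show ?thesis
      by (intro conjI exI[of _ "2 * j + 1"]) (auto simp only: vals_all_events, force+)
  next
    case (2 j)
    with assms(2) have "(u, v) \<in> set (pss ! j)"
      by (auto simp only: vals_all_events) auto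
    with pss_less[OF nth_pss[OF 2(1)]] 2(1) show ?thesis
      by (intro conjI exI[of _ "2 * j"]) (auto simp only: vals_all_events, force+)
  qed
  then show "u < n" "\<exists>c'<2 * (s + 1). v \<in> set (vals evs (2 * (s + 1) * u + c'))"
    by blast+
qed

context
  fixes st :: store
  assumes table: "table D evs st"
begin

text \<open>Two views of one array: the \<open>2 * (s + 1)\<close> buckets of size \<open>D\<close>
  of a vertex are adjacent and form its row of \<open>k\<close> slots.\<close>

lemma table_entry:
  assumes "i < D"
  shows "st aF (k * v + (D * c + i)) =
    (if i < length (vals evs (2 * (s + 1) * v + c)) then Suc (vals evs (2 * (s + 1) * v + c) ! i) else 0)"
proof -
  have "k * v + (D * c + i) = D * (2 * (s + 1) * v + c) + i"
    by (simp add: algebra_simps)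
  with table assms show ?thesis
    by (simp only: table_def)
qed

lemma slot_fun_entry:
  assumes "i < D"
  shows "slot_fun k (st aF) (D * c + i) v =
    (if i < length (vals evs (2 * (s + 1) * v + c)) then vals evs (2 * (s + 1) * v + c) ! i else v)"
  unfolding slot_fun_def table_entry[OF assms] by simp

lemma slot_cases:
  assumes "i < k"
  obtains c i' where "c < 2 * (s + 1)" "i' < D" "i = D * c + i'"
proof
  show "i div D < 2 * (s + 1)"
    using assms by (simp add: less_mult_imp_div_less)
  show "i mod D < D" "i = D * (i div D) + i mod D"
    using D_pos by simp_all
qed

text \<open>A filled slot is undone by the slot of its twin entry, and an empty slot, being a loop,
  undoes itself.\<close>

lemma functional_table: "functional_structure (slot_fun k (st aF)) k n"
proof
  fix i v
  assume i: "i < k" and v: "v < n"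
  from i obtain c i' where c: "c < 2 * (s + 1)" and i': "i' < D" and eq: "i = D * c + i'"
    by (rule slot_cases)
  let ?vs = "vals evs (2 * (s + 1) * v + c)"
  show "slot_fun k (st aF) i v < n"
    using v vals_back(1)[OF c, of "?vs ! i'" v] unfolding eq slot_fun_entry[OF i'] by simp
  show "\<exists>j<k. slot_fun k (st aF) j (slot_fun k (st aF) i v) = v"
  proof (cases "i' < length ?vs")
    case True
    define u where "u = ?vs ! i'"
    then have "u \<in> set ?vs"
      using True by simp
    from vals_back(2)[OF c this] obtain c' where c': "c' < 2 * (s + 1)"
      and "v \<in> set (vals evs (2 * (s + 1) * u + c'))"
      by blast
    then obtain j where j: "j < length (vals evs (2 * (s + 1) * u + c'))"
      "vals evs (2 * (s + 1) * u + c') ! j = v"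
      by (auto simp only: in_set_conv_nth)
    then have jD: "j < D"
      using length_vals_le[of "2 * (s + 1) * u + c'"] by linarith
    have "D * c' + j < D * Suc c'"
      using jD by simp
    also have "\<dots> \<le> D * (2 * (s + 1))"
      using c' by (intro mult_le_mono2) simp
    finally have "D * c' + j < k"
      by (simp only: mult.commute)
    moreover have "slot_fun k (st aF) i v = u"
      unfolding eq slot_fun_entry[OF i'] u_def using True by simp
    ultimately show ?thesis
      using j slot_fun_entry[OF jD, of c' u] by (metis (no_types, lifting))
  next
    case False
    then have "slot_fun k (st aF) i v = v"
      unfolding eq slot_fun_entry[OF i'] by simp
    with i show ?thesis
      by metis
  qed
qed

lemma erel_iff:
  assumes "j \<le> s"
  shows "erel D k (st aF) j x y \<longleftrightarrow> (x, y) \<in> set (pss ! j)"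
proof -
  let ?vs = "vals evs (2 * (s + 1) * x + 2 * j)"
  have vs: "?vs = map snd (filter (\<lambda>e. fst e = x) (pss ! j))"
    using assms by (rule vals_all_events)
  have "st aF (k * x + (2 * D * j + i)) = (if i < length ?vs then Suc (?vs ! i) else 0)" if "i < D" for i
    using table_entry[OF that, of x "2 * j"] by (simp only: mult.assoc mult.left_commute)
  then have "erel D k (st aF) j x y \<longleftrightarrow> (\<exists>i<D. i < length ?vs \<and> ?vs ! i = y)"
    unfolding erel_def by (metis Zero_not_Suc old.nat.inject)
  also have "\<dots> \<longleftrightarrow> y \<in> set ?vs"
    using length_vals_le[of "2 * (s + 1) * x + 2 * j"] less_le_trans[of _ "length ?vs" D]
    unfolding in_set_conv_nth by blast
  also have "\<dots> \<longleftrightarrow> (x, y) \<in> set (pss ! j)"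
    unfolding vs by force
  finally show ?thesis .
qed

text \<open>Away from \<open>x = y\<close> the loops of empty slots are invisible, and the stored
  relations contain no pair with equal components.\<close>

lemma erel_slots:
  assumes "j \<le> s"
  shows "erel D k (st aF) j x y \<longleftrightarrow>
    x \<noteq> y \<and> (\<exists>i\<in>{2 * D * j + i | i. i < D}. slot_fun k (st aF) i x = y)"
proof -
  have "x \<noteq> y" if "erel D k (st aF) j x y"
    using that pss_less[OF nth_pss[OF assms]] unfolding erel_iff[OF assms] by blast
  moreover have "slot_fun k (st aF) i x = y \<longleftrightarrow> st aF (k * x + i) = Suc y" if "x \<noteq> y" for i
    using that by (auto simp: slot_fun_def)
  ultimately show ?thesis
    unfolding erel_def by (auto simp del: mult_Suc_right)
qed

end

end

text \<open>Allows the ranges in the store, whose lengths are computed only for positions inside the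
  formula, to be replaced by ranges defined at all positions.\<close>

lemma rsat_cong:
  "\<forall>q. p \<le> q \<and> q < p + fm_length \<phi> \<longrightarrow> rg q = rg' q \<Longrightarrow> rsat rg E p \<tau> \<phi> = rsat rg' E p \<tau> \<phi>"
proof (induction \<phi> arbitrary: p \<tau>)
  case (Conj \<phi> \<psi>)
  then show ?case
    using Conj.IH(1)[of "p + 1" \<tau>] Conj.IH(2)[of "p + 1 + fm_length \<phi>" \<tau>] by simp
next
  case (Disj \<phi> \<psi>)
  then show ?case
    using Disj.IH(1)[of "p + 1" \<tau>] Disj.IH(2)[of "p + 1 + fm_length \<phi>" \<tau>] by simp
next
  case (Exists x \<phi>)
  then have "rsat rg E (p + 2) (\<tau>(x := b)) \<phi> = rsat rg' E (p + 2) (\<tau>(x := b)) \<phi>" for b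
    by (intro Exists.IH) simp
  with Exists.prems show ?case
    by simp
next
  case (Forall x \<phi>)
  then have "rsat rg E (p + 2) (\<tau>(x := b)) \<phi> = rsat rg' E (p + 2) (\<tau>(x := b)) \<phi>" for b
    by (intro Forall.IH) simp
  with Forall.prems show ?case
    by simp
qed simp_all

section \<open>Explicit bounds and the complete program\<close>

definition num_words :: "nat \<Rightarrow> nat \<Rightarrow> nat" where
  "num_words k L = (grow k 1 ^^ 3 ^ L) 1"

text \<open>The multiplicity per pattern times the number of patterns, as in
  \<open>length_reps_le\<close>; it does not involve the number of vertices.\<close>

definition max_reps :: "nat \<Rightarrow> nat \<Rightarrow> nat" where
  "max_reps k L = Suc L * num_words k L * 2 ^ (num_words k L * num_words k L)"

text \<open>The \<open>K\<close> representatives are the roots, and every code position adds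
  \<open>3 ^ L\<close> rounds of growth, one for each letter of a word.\<close>

definition range_length :: "nat \<Rightarrow> nat \<Rightarrow> nat \<Rightarrow> nat \<Rightarrow> nat" where
  "range_length k L K p = (grow k K ^^ (p * 3 ^ L)) K"

lemma num_words_pos: "0 < k \<Longrightarrow> 1 \<le> num_words k L"
  unfolding num_words_def by (rule grow_iter_le)

lemma range_length_mono: "0 < k \<Longrightarrow> p \<le> q \<Longrightarrow> range_length k L K p \<le> range_length k L K q"
  unfolding range_length_def by (intro grow_iter_mono mult_le_mono1)

lemma range_length_ge: "0 < k \<Longrightarrow> K \<le> range_length k L K p"
  unfolding range_length_def by (rule grow_iter_le)

context functional_structure
begin

text \<open>The representatives and the initial segments of their unravelling meet all demands of
  the abstract argument. There is at least one representative, since a rejected vertex would require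
  others of its pattern.\<close>

lemma restricted_evaluation_reps:
  fixes G :: "'v graph" and L :: nat and ini :: "nat \<Rightarrow> nat"
  defines "ws \<equiv> reps (Suc L * num_words k L) (num_words k L) n"
  assumes k: "0 < k" and n: "0 < n" and ini: "\<And>j. j < length ws \<Longrightarrow> ini j = ws ! j"
    and "bij_betw \<nu> (verts G) {..<n}"
    and "\<And>j u v. j \<le> length Ss \<Longrightarrow> u \<in> verts G \<Longrightarrow> v \<in> verts G \<Longrightarrow>
      (u, v) \<in> (edges G # Ss) ! j \<longleftrightarrow> E j (\<nu> u) (\<nu> v)"
    and "\<And>j x y. j \<le> length Ss \<Longrightarrow> x < n \<Longrightarrow> y < n \<Longrightarrow>
      E j x y \<longleftrightarrow> x \<noteq> y \<and> (\<exists>i\<in>slots j. f i x = y)"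
    and "\<And>j. j \<le> length Ss \<Longrightarrow> slots j \<subseteq> {..<k}"
  shows "restricted_evaluation f k n G Ss \<nu> E slots
      (\<lambda>p. heap f k (length ws) ini ` {..<range_length k L (length ws) p}) (set ws) (3 ^ L) L"
    and "0 < length ws"
proof -
  let ?N = "num_words k L" and ?K = "length ws"
  have N: "1 \<le> ?N"
    using k by (rule num_words_pos)
  have rich: "Suc L * ?N \<le> card {c\<in>set ws. same_pattern ?N b c}" if "b < n" "b \<notin> set ws" for b
    using reps_complete[of b n "Suc L * ?N" ?N] that unfolding ws_def by simp
  show K: "0 < ?K"
  proof (rule ccontr)
    assume "\<not> 0 < ?K"
    then have "ws = []"
      by simp
    with rich[OF n] N show False
      by simp
  qed
  have ini_less: "ini j < n" if "j < ?K" for j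
    using ini[OF that] nth_mem[OF that] set_reps[of "Suc L * ?N" ?N n] unfolding ws_def by auto
  show "restricted_evaluation f k n G Ss \<nu> E slots
      (\<lambda>p. heap f k ?K ini ` {..<range_length k L ?K p}) (set ws) (3 ^ L) L"
  proof
    fix p
    show "set ws \<subseteq> heap f k ?K ini ` {..<range_length k L ?K p}"
    proof
      fix a
      assume "a \<in> set ws"
      then obtain j where j: "j < ?K" "a = ws ! j"
        by (auto simp: in_set_conv_nth)
      then have "a = heap f k ?K ini j"
        using ini by (simp add: heap_root)
      moreover have "j < range_length k L ?K p"
        using j range_length_ge[OF k, of ?K L p] by simp
      ultimately show "a \<in> heap f k ?K ini ` {..<range_length k L ?K p}"
        by blast
    qed
    show "heap f k ?K ini ` {..<range_length k L ?K p} \<subseteq> {..<n}"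
      using heap_less[OF k ini_less K] by auto
  next
    fix p q b w
    assume pq: "(p::nat) < q" and "b \<in> heap f k ?K ini ` {..<range_length k L ?K p}"
      and w: "w \<in> words k (3 ^ L)"
    then obtain i where i: "i < range_length k L ?K p" "b = heap f k ?K ini i"
      by auto
    from heap_word[OF K k w i(1), of f] obtain i' where
      "i' < (grow k ?K ^^ 3 ^ L) (range_length k L ?K p)"
      "heap f k ?K ini i' = fold f w b"
      using i(2) by auto
    \<comment> \<open>Moving to the next code position is exactly enough growth for one word of
      length \<open>3 ^ L\<close>, which gives the closure of ranges.\<close>
    moreover have "(grow k ?K ^^ 3 ^ L) (range_length k L ?K p) = range_length k L ?K (Suc p)"
      by (simp add: range_length_def funpow_add)
    moreover have "range_length k L ?K (Suc p) \<le> range_length k L ?K q"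
      using k pq by (intro range_length_mono) auto
    ultimately show "fold f w b \<in> heap f k ?K ini ` {..<range_length k L ?K q}"
      by (metis imageI lessThan_iff less_le_trans)
  next
    fix b
    assume b: "b < n" "b \<notin> set ws"
    \<comment> \<open>This is why the multiplicity is \<open>L + 1\<close> times, not
      \<open>L\<close> times, the number of positions.\<close>
    have "L * (grow k 1 ^^ 3 ^ L) 1 < Suc L * ?N"
      using N by (simp add: num_words_def)
    also have "\<dots> \<le> card {c\<in>set ws. same_pattern ?N b c}"
      using b by (rule rich)
    also have "\<dots> \<le> card {c\<in>set ws. same_type (3 ^ L) b c}"
      using same_pattern_same_type[OF k, of "3 ^ L" b]
      by (intro card_mono) (auto simp: num_words_def)
    finally show "L * (grow k 1 ^^ 3 ^ L) 1 < card {c\<in>set ws. same_type (3 ^ L) b c}" .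
  qed (use assms in auto)
qed

end

definition mc_code :: "nat \<Rightarrow> nat \<Rightarrow> com" where
  "mc_code s D = (let k = 2 * (s + 1) * D in
     read_code s D ;; parse_code ;; param_code k ;; reps_code k ;; range_code k ;; eval_code D k)"

text \<open>The sum of the costs of the phases. \<open>T\<close> bounds the lengths of the input
  lists and \<open>K\<close> is the number of representatives, which depends on the structure but is
  bounded by \<open>max_reps\<close>.\<close>

definition mc_ticks :: "nat \<Rightarrow> nat \<Rightarrow> nat \<Rightarrow> nat \<Rightarrow> nat \<Rightarrow> nat \<Rightarrow> nat" where
  "mc_ticks s D L n T K = (let k = 2 * (s + 1) * D; N = num_words k L; h = range_length k L K L in
     (s + 1) * (T + 1) + (L + (L + 3 ^ L + L)) +
     n * (N * (k + 1) + max_reps k L * (N * (k + 1) + N * (N + 1) + 1) + 1) +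
     (L * (3 ^ L + 1) + h * (k + 1) + (D + 1) * (h + 5) ^ L))"

context pair_lists
begin

lemma k_pos: "0 < k"
  using D_pos by simp

text \<open>The phases are chained by their specifications and frames; the final value is turned
  into \<open>models\<close> by Hanf's argument, applied to the functions read off the table after
  the input phase.\<close>

lemma wp_mc_code:
  fixes G :: "'v graph"
  assumes n: "0 < n" and T: "\<And>ps. ps \<in> set pss \<Longrightarrow> length ps \<le> T"
    and \<nu>: "bij_betw \<nu> (verts G) {..<n}" and Ss: "length Ss = s"
    and rel: "\<And>j u v. j \<le> s \<Longrightarrow> u \<in> verts G \<Longrightarrow> v \<in> verts G \<Longrightarrow>
      (u, v) \<in> (edges G # Ss) ! j \<longleftrightarrow> (\<nu> u, \<nu> v) \<in> set (pss ! j)"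
    and \<phi>: "sentence s \<phi>"
  shows "wp (mc_code s D) (\<lambda>t (st', w').
      (\<exists>K\<le>max_reps k (fm_length \<phi>). t \<le> mc_ticks s D (fm_length \<phi>) n T K) \<and>
      (st' vRes 0 \<noteq> 0 \<longleftrightarrow> models G Ss \<phi>))
    (\<lambda>_ _. 0, n # concat (map pairs_code pss) @ fm_code \<phi>)"
proof -
  let ?L = "fm_length \<phi>"
  let ?N = "num_words k ?L"
  let ?Q = "\<lambda>t (st', w'). (\<exists>K\<le>max_reps k ?L. t \<le> mc_ticks s D ?L n T K) \<and>
      (st' vRes 0 \<noteq> 0 \<longleftrightarrow> models G Ss \<phi>)"
  have "wp (read_code s D) (\<lambda>t1. wp parse_code (\<lambda>t2. wp (param_code k) (\<lambda>t3. wp (reps_code k)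
    (\<lambda>t4. wp (range_code k) (\<lambda>t5. wp (eval_code D k) (\<lambda>t6. ?Q (t1 + (t2 + (t3 + (t4 + (t5 + t6))))))))))) 
    (\<lambda>_ _. 0, n # concat (map pairs_code pss) @ fm_code \<phi>)"
  proof (rule wp_frame[OF wp_read_code[OF length_pss length_vals_le T refl refl]], assumption, unfold prod.case, elim conjE)
    fix t1 st1 w1
    assume w1: "w1 = fm_code \<phi>" and t1: "t1 \<le> (s + 1) * (T + 1)" and tab: "table D evs st1" and n1: "st1 vn 0 = n"
    define F where "F = st1 aF"
    define f where "f = slot_fun k F"
    interpret functional_structure f k n
      using functional_table[OF tab] unfolding f_def F_def .
    define ws where "ws = reps (Suc ?L * ?N) ?N n"
    let ?K = "length ws"
    let ?h = "range_length k ?L ?K"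
    have K_le: "?K \<le> max_reps k ?L"
      unfolding ws_def max_reps_def by (rule length_reps_le)
    show "wp parse_code (\<lambda>t2. wp (param_code k) (\<lambda>t3. wp (reps_code k)
      (\<lambda>t4. wp (range_code k) (\<lambda>t5. wp (eval_code D k)
         (\<lambda>t6. ?Q (t1 + (t2 + (t3 + (t4 + (t5 + t6)))))))))) (st1, w1)"
      unfolding w1
    proof (rule wp_frame[OF wp_parse_code], clarify)
      fix t2 st2 w2
      assume t2: "t2 \<le> ?L" and L2: "st2 vLen 0 = ?L" and fm2: "holds (st2 aFm) 0 (fm_code \<phi>)"
        and fr: "agree_off (mods parse_code) st1 st2"
      have fr2: "st2 aF = F" "st2 vn 0 = n"
        using fr n1 by (auto simp: agree_off_def F_def)
      show "wp (param_code k) (\<lambda>t3. wp (reps_code k)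
        (\<lambda>t4. wp (range_code k) (\<lambda>t5. wp (eval_code D k)
          (\<lambda>t6. ?Q (t1 + (t2 + (t3 + (t4 + (t5 + t6))))))))) (st2, w2)"
      proof (rule wp_frame[OF wp_param_code[where st = st2, OF L2]], clarify)
        fix t3 st3 w3
        assume t3: "t3 \<le> ?L + 3 ^ ?L + ?L" and R3: "st3 vR 0 = 3 ^ ?L"
          and "st3 vN 0 = (grow k 1 ^^ 3 ^ ?L) 1" "st3 vM 0 = Suc ?L * (grow k 1 ^^ 3 ^ ?L) 1"
          and fr: "agree_off (mods (param_code k)) st2 st3"
        then have N3: "st3 vN 0 = ?N" and M3: "st3 vM 0 = Suc ?L * ?N"
          by (simp_all only: num_words_def)
        have fr3: "st3 aF = F" "st3 vn 0 = n" "st3 vLen 0 = ?L" "st3 aFm = st2 aFm"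
          using fr fr2 L2 by (auto simp: agree_off_def)
        have K_le': "length (reps (Suc ?L * ?N) ?N n) \<le> max_reps k ?L"
          using K_le unfolding ws_def .
        show "wp (reps_code k) (\<lambda>t4. wp (range_code k) (\<lambda>t5. wp (eval_code D k)
          (\<lambda>t6. ?Q (t1 + (t2 + (t3 + (t4 + (t5 + t6)))))))) (st3, w3)"
        proof (rule wp_frame[OF wp_reps_code[where st = st3, OF k_pos fr3(1) f_def[symmetric] N3 fr3(2) M3 K_le']],
            fold ws_def, clarify)
          fix t4 st4 w4
          assume t4: "t4 \<le> n * (?N * (k + 1) + max_reps k ?L * (?N * (k + 1) + ?N * (?N + 1) + 1) + 1)"
            and K4: "st4 vK 0 = ?K" and U4: "\<forall>j<?K. st4 aU j = ws ! j"
            and fr: "agree_off (mods (reps_code k)) st3 st4"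
          have fr4: "st4 aF = F" "st4 vLen 0 = ?L" "st4 aFm = st2 aFm" "st4 vR 0 = 3 ^ ?L"
            using fr fr3 R3 by (auto simp: agree_off_def)
          let ?E = "erel D k F" and ?sl = "\<lambda>j. {2 * D * j + i | i. i < D}"
          have ini: "st4 aU j = reps (Suc ?L * ?N) ?N n ! j"
            if "j < length (reps (Suc ?L * ?N) ?N n)" for j
            using U4 that unfolding ws_def by blast
          have slots: "?sl j \<subseteq> {..<k}" if "j \<le> length Ss" for j
          proof
            fix x
            assume "x \<in> ?sl j"
            then obtain i where "x = 2 * D * j + i" "i < D"
              by blast
            then have "x < D * (2 * j + 1)"
              by (simp add: algebra_simps)
            also have "\<dots> \<le> D * (2 * (s + 1))"
              using that Ss by (intro mult_le_mono2) simp
            finally show "x \<in> {..<k}"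
              by (simp add: mult.commute)
          qed
          have E1: "(u, v) \<in> (edges G # Ss) ! j \<longleftrightarrow> ?E j (\<nu> u) (\<nu> v)"
            if "j \<le> length Ss" "u \<in> verts G" "v \<in> verts G" for j u v
            using rel[of j u v] erel_iff[OF tab, of j] that Ss unfolding F_def by blast
          have E2: "?E j x y \<longleftrightarrow> x \<noteq> y \<and> (\<exists>i\<in>?sl j. f i x = y)"
            if "j \<le> length Ss" "x < n" "y < n" for j x y
            using erel_slots[OF tab, of j x y] that(1) Ss unfolding F_def f_def by blast
          note re = restricted_evaluation_reps[OF k_pos n ini \<nu> E1 E2 slots, folded ws_def]
          have K_pos: "0 < ?K"
            by (rule re(2))
          interpret re: restricted_evaluation f k n G Ss \<nu> ?E ?sl
            "\<lambda>p. heap f k ?K (st4 aU) ` {..<?h p}" "set ws" "3 ^ ?L" ?L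
            by (rule re(1))
          show "wp (range_code k) (\<lambda>t5. wp (eval_code D k)
            (\<lambda>t6. ?Q (t1 + (t2 + (t3 + (t4 + (t5 + t6))))))) (st4, w4)"
          proof (rule wp_frame[OF wp_range_code[where st = st4, OF fr4(2,4) K4 k_pos K_pos]],
              fold range_length_def, clarify)
            fix t5 st5 w5
            assume t5: "t5 \<le> ?L * (3 ^ ?L + 1) + ?h ?L * (k + 1)"
              and H5: "\<forall>p<?L. st5 aH p = ?h p"
              and U5: "\<forall>q<grow k ?K (?h ?L). st5 aU q = heap (slot_fun k (st4 aF)) k ?K (st4 aU) q"
              and fr: "agree_off (mods (range_code k)) st4 st5"
            have fr5: "st5 aF = F" "st5 aFm = st2 aFm"
              using fr fr4 by (auto simp: agree_off_def)
            have h_le: "?h p \<le> ?h ?L" if "p < ?L" for p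
              using that by (intro range_length_mono[OF k_pos]) simp
            have "ranges st5 p = heap f k ?K (st4 aU) ` {..<?h p}" if "p < ?L" for p
            proof -
              have "?h p \<le> grow k ?K (?h ?L)"
                using h_le[OF that] grow_le[OF k_pos, of "?h ?L" ?K] by linarith
              then have "st5 aU q = heap f k ?K (st4 aU) q" if "q < ?h p" for q
                using U5 that fr4(1) unfolding f_def by simp
              then show ?thesis
                using H5 that unfolding ranges_def by (intro image_cong) auto
            qed
            then have "rsat (ranges st5) ?E 0 (st5 aEnv) \<phi> =
                rsat (\<lambda>p. heap f k ?K (st4 aU) ` {..<?h p}) ?E 0 (st5 aEnv) \<phi>"
              by (intro rsat_cong) simp
            also have "\<dots> = models G Ss \<phi>"
              by (rule re.models_iff_rsat[symmetric]) (use \<phi> Ss n in auto)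
            finally have models: "rsat (ranges st5) (erel D k (st5 aF)) 0 (st5 aEnv) \<phi> = models G Ss \<phi>"
              unfolding fr5 .
            have "1 \<le> ?h p" for p
              using K_pos range_length_ge[OF k_pos, of ?K ?L p] by linarith
            with H5 h_le have H5': "\<forall>q<?L. 1 \<le> st5 aH q \<and> st5 aH q \<le> ?h ?L"
              by metis
            show "wp (eval_code D k) (\<lambda>t6. ?Q (t1 + (t2 + (t3 + (t4 + (t5 + t6)))))) (st5, w5)"
            proof (rule wp_mono[OF wp_eval_code[where st = st5, OF fm2[folded fr5(2)] H5']], clarify)
              fix t6 st6 w6
              assume t6: "t6 \<le> (D + 1) * (?h ?L + 5) ^ ?L"
                and res: "st6 vRes 0 = of_bool (rsat (ranges st5) (erel D k (st5 aF)) 0 (st5 aEnv) \<phi>)"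
              have "t1 + (t2 + (t3 + (t4 + (t5 + t6)))) \<le> mc_ticks s D ?L n T ?K"
                using t1 t2 t3 t4 t5 t6 unfolding mc_ticks_def Let_def by linarith
              with K_le res models show "(\<exists>K\<le>max_reps k ?L.
                t1 + (t2 + (t3 + (t4 + (t5 + t6)))) \<le> mc_ticks s D ?L n T K) \<and>
                (st6 vRes 0 \<noteq> 0 \<longleftrightarrow> models G Ss \<phi>)"
                by auto
            qed
          qed
        qed
      qed
    qed
  qed
  then show ?thesis
    unfolding mc_code_def Let_def wp_Seq .
qed

end

section \<open>Fixed-parameter tractability\<close>

lemma names_mc_code: "names (mc_code s D) \<subseteq> {..<63}"
  by (simp add: mc_code_def Let_def read_code_def push_code_def parse_code_def parse_step_def
      token_code_def param_code_def reps_code_def heap_code_def pattern_code_def range_code_def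
      eval_code_def eval_step_def call_code_def return_code_def rel_code_def)

text \<open>Both degrees are bounded because both directions are stored.\<close>

definition bounded_relation :: "'v set \<Rightarrow> nat \<Rightarrow> ('v \<times> 'v) set \<Rightarrow> bool" where
  "bounded_relation U D R \<longleftrightarrow> finite R \<and> R \<subseteq> U \<times> U \<and> irrefl R \<and>
     (\<forall>v. card {u. (v, u) \<in> R} \<le> D \<and> card {u. (u, v) \<in> R} \<le> D)"

lemma bounded_relation_edges:
  assumes "G \<in> max_degree_class d" and "d \<le> D"
  shows "bounded_relation (verts G) D (edges G)"
proof -
  have G: "finite (verts G)" "edges G \<subseteq> verts G \<times> verts G" "sym (edges G)" "irrefl (edges G)"
    and deg: "\<And>v. v \<in> verts G \<Longrightarrow> card {u. (v, u) \<in> edges G} \<le> d"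
    using assms(1) by (auto simp: max_degree_class_def is_graph_def degree_def)
  have "card {u. (v, u) \<in> edges G} \<le> D" for v
  proof (cases "v \<in> verts G")
    case True
    then show ?thesis
      using deg assms(2) by (metis le_trans)
  next
    case False
    then have "{u. (v, u) \<in> edges G} = {}"
      using G(2) by auto
    then show ?thesis
      by (metis card.empty le0)
  qed
  moreover have "{u. (u, v) \<in> edges G} = {u. (v, u) \<in> edges G}" for v
    using G(3) by (auto dest: symD)
  ultimately show ?thesis
    using G by (auto simp: bounded_relation_def intro: finite_subset[of _ "verts G \<times> verts G"])
qed

text \<open>The vertices on the path are distinct, so each has at most one successor and at most one
  predecessor and no vertex follows itself.\<close>

lemma bounded_relation_successor:
  assumes "successor_relation U S" and "1 \<le> D"
  shows "bounded_relation U D S"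
proof -
  from assms(1) obtain p where p: "distinct p" "set p = U"
    and S: "S = {(p ! i, p ! Suc i) | i. Suc i < length p}"
    by (auto simp: successor_relation_def)
  have "S = (\<lambda>i. (p ! i, p ! Suc i)) ` {i. Suc i < length p}"
    using S by auto
  moreover have "finite {i. Suc i < length p}"
    by (rule finite_subset[of _ "{..<length p}"]) auto
  ultimately have "finite S"
    by simp
  moreover have "S \<subseteq> U \<times> U"
    using p(2) S by auto
  moreover have "irrefl S"
    using p(1) S by (auto simp: irrefl_def nth_eq_iff_index_eq)
  moreover have "card {u. (v, u) \<in> S} \<le> D" "card {u. (u, v) \<in> S} \<le> D" for v
  proof -
    have "is_singleton {u. (v, u) \<in> S} \<or> {u. (v, u) \<in> S} = {}"
      unfolding is_singleton_def S using p(1) by (auto simp: nth_eq_iff_index_eq)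
    then have "card {u. (v, u) \<in> S} \<le> 1"
      by (auto simp: is_singleton_def)
    then show "card {u. (v, u) \<in> S} \<le> D"
      using assms(2) by linarith
    have "is_singleton {u. (u, v) \<in> S} \<or> {u. (u, v) \<in> S} = {}"
      unfolding is_singleton_def S using p(1) by (auto simp: nth_eq_iff_index_eq)
    then have "card {u. (u, v) \<in> S} \<le> 1"
      by (auto simp: is_singleton_def)
    then show "card {u. (u, v) \<in> S} \<le> D"
      using assms(2) by linarith
  qed
  ultimately show ?thesis
    by (auto simp: bounded_relation_def)
qed

text \<open>Carries the degree bounds from sets of vertices to the numbers in the input: the listing
  is free of repetitions and the numbering injective, so lengths of filtered lists are
  degrees.\<close>

lemma bounded_relation_list:
  fixes \<nu> :: "'v \<Rightarrow> nat" and ps :: "('v \<times> 'v) list"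
  assumes R: "bounded_relation U D (set ps)" and "distinct ps" and \<nu>: "bij_betw \<nu> U {..<n}"
  defines "qs \<equiv> map (map_prod \<nu> \<nu>) ps"
  shows "(a, b) \<in> set qs \<Longrightarrow> a < n \<and> b < n \<and> a \<noteq> b"
    and "length (filter (\<lambda>e. fst e = a) qs) \<le> D"
    and "length (filter (\<lambda>e. snd e = a) qs) \<le> D"
    and "u \<in> U \<Longrightarrow> v \<in> U \<Longrightarrow> (u, v) \<in> set ps \<longleftrightarrow> (\<nu> u, \<nu> v) \<in> set qs"
proof -
  have sub: "set ps \<subseteq> U \<times> U" and irr: "irrefl (set ps)"
    and out: "\<And>v. card {u. (v, u) \<in> set ps} \<le> D" and inn: "\<And>v. card {u. (u, v) \<in> set ps} \<le> D"
    using R by (auto simp: bounded_relation_def)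
  have inj: "\<nu> x = \<nu> y \<longleftrightarrow> x = y" if "x \<in> U" "y \<in> U" for x y
    using \<nu> that by (auto simp: bij_betw_def inj_on_def)
  have less: "\<nu> x < n" if "x \<in> U" for x
    using \<nu> that by (auto simp: bij_betw_def)
  show "(a, b) \<in> set qs \<Longrightarrow> a < n \<and> b < n \<and> a \<noteq> b"
    using sub irr less inj by (auto simp: qs_def irrefl_def)
  show "(u, v) \<in> set ps \<longleftrightarrow> (\<nu> u, \<nu> v) \<in> set qs" if "u \<in> U" "v \<in> U"
    using that sub inj by (force simp: qs_def)
  have len: "length (filter P qs) = card {e\<in>set ps. P (map_prod \<nu> \<nu> e)}" for P
  proof -
    have "length (filter P qs) = length (filter (P \<circ> map_prod \<nu> \<nu>) ps)"
      by (simp add: qs_def filter_map)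
    also have "\<dots> = card (set (filter (P \<circ> map_prod \<nu> \<nu>) ps))"
      using \<open>distinct ps\<close> by (intro distinct_card[symmetric]) simp
    finally show ?thesis
      by simp
  qed
  show "length (filter (\<lambda>e. fst e = a) qs) \<le> D"
  proof (cases "{e\<in>set ps. fst (map_prod \<nu> \<nu> e) = a} = {}")
    case True
    then show ?thesis
      unfolding len by (simp only: card.empty le0)
  next
    case False
    then obtain v where v: "v \<in> U" "\<nu> v = a"
      using sub by auto
    then have "{e\<in>set ps. fst (map_prod \<nu> \<nu> e) = a} = Pair v ` {u. (v, u) \<in> set ps}"
      using sub inj by auto
    then show ?thesis
      unfolding len using out[of v] by (simp add: card_image inj_on_def)
  qed
  show "length (filter (\<lambda>e. snd e = a) qs) \<le> D"
  proof (cases "{e\<in>set ps. snd (map_prod \<nu> \<nu> e) = a} = {}")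
    case True
    then show ?thesis
      unfolding len by (simp only: card.empty le0)
  next
    case False
    then obtain v where v: "v \<in> U" "\<nu> v = a"
      using sub by auto
    then have "{e\<in>set ps. snd (map_prod \<nu> \<nu> e) = a} = (\<lambda>u. (u, v)) ` {u. (u, v) \<in> set ps}"
      using sub inj by auto
    then show ?thesis
      unfolding len using inn[of v] by (simp add: card_image inj_on_def)
  qed
qed

lemma relation_codes:
  assumes "list_all2 (relation_code \<nu>) Rs us"
  obtains pss where "length pss = length Rs" "\<And>j. j < length Rs \<Longrightarrow> distinct (pss ! j) \<and> set (pss ! j) = Rs ! j"
    "concat us = concat (map (\<lambda>ps. pairs_code (map (map_prod \<nu> \<nu>) ps)) pss)"
proof -
  from assms have "\<exists>pss. length pss = length Rs \<and> (\<forall>j<length Rs. distinct (pss ! j) \<and> set (pss ! j) = Rs ! j) \<and>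
    concat us = concat (map (\<lambda>ps. pairs_code (map (map_prod \<nu> \<nu>) ps)) pss)"
  proof (induction rule: list_all2_induct)
    case (Cons R Rs u us)
    then obtain ps pss where "distinct ps" "set ps = R" "u = pairs_code (map (map_prod \<nu> \<nu>) ps)"
      "length pss = length Rs" "\<forall>j<length Rs. distinct (pss ! j) \<and> set (pss ! j) = Rs ! j"
      "concat us = concat (map (\<lambda>ps. pairs_code (map (map_prod \<nu> \<nu>) ps)) pss)"
      by (auto simp: relation_code_def)
    then show ?case
      by (intro exI[of _ "ps # pss"]) (auto simp: less_Suc_eq_0_disj)
  qed simp
  then show ?thesis
    using that by blast
qed

text \<open>Summing over all possible \<open>K\<close> gives a bound on each single term that
  depends on the parameter alone.\<close>

definition mc_factor :: "nat \<Rightarrow> nat \<Rightarrow> nat \<Rightarrow> nat" where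
  "mc_factor s D L = (\<Sum>K\<le>max_reps (2 * (s + 1) * D) L. mc_ticks s D L 1 1 K + 1)"

text \<open>For fixed \<open>K\<close> the cost is affine in \<open>n\<close> and \<open>T\<close>,
  and its constant part is absorbed by \<open>z\<close>, which is at least 1.\<close>

lemma mc_ticks_le:
  assumes "n \<le> z" "T \<le> z" "1 \<le> z"
  shows "mc_ticks s D L n T K + 1 \<le> (mc_ticks s D L 1 1 K + 1) * z"
proof -
  have lin: "a * (T + 1) + b + n * c + e + 1 \<le> (a * (1 + 1) + b + 1 * c + e + 1) * z" for a b c e :: nat
  proof -
    have "a * (T + 1) \<le> a * ((1 + 1) * z)" "n * c \<le> z * c" "b * 1 \<le> b * z" "e * 1 \<le> e * z"
      using assms by (intro mult_le_mono; simp)+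
    then have "a * (T + 1) + b + n * c + e + 1 \<le> a * ((1 + 1) * z) + b * z + z * c + e * z + z"
      using assms(3) by linarith
    also have "\<dots> = (a * (1 + 1) + b + 1 * c + e + 1) * z"
      by (simp add: algebra_simps)
    finally show ?thesis .
  qed
  show ?thesis
    unfolding mc_ticks_def Let_def by (rule lin)
qed

text \<open>One program works for the whole class with \<open>s\<close> successor relations, since
  \<open>D\<close> and \<open>s\<close> are built into its text. The dependence on the size of the
  structure is linear, hence the exponent 1.\<close>

theorem bounded_degree_fpt:
  fixes d s :: nat
  shows "fixed_parameter_tractable (MC_FO_succs s (max_degree_class d :: 'v graph set))"
proof -
  \<comment> \<open>At least one slot is required even for edgeless graphs, because a successor
    relation can have degree 1.\<close>
  define D where "D = max d 1"
  let ?c = "mc_code s D"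
  have ans: "answers_within (compile ?c 0) w
      (code_size ?c * mc_factor s D (fm_length \<phi>) * mc_size (G, Ss, \<phi>) ^ 1) (models G Ss \<phi>)"
    if G: "(G :: 'v graph) \<in> max_degree_class d" and Ss: "length Ss = s"
      and succ: "\<forall>S\<in>set Ss. successor_relation (verts G) S" and \<phi>: "sentence s \<phi>"
      and enc: "mc_encodes (G, Ss, \<phi>) w" for G Ss \<phi> w
  proof -
    define n where "n = card (verts G)"
    define z where "z = mc_size (G, Ss, \<phi>)"
    have "finite (verts G)" "verts G \<noteq> {}"
      using G by (auto simp: max_degree_class_def is_graph_def)
    then have n: "0 < n"
      by (simp add: n_def card_gt_0_iff)
    have n_le: "n \<le> z"
      by (simp add: z_def n_def)
    from enc obtain \<nu> e us where \<nu>: "bij_betw \<nu> (verts G) {..<n}"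
      and "relation_code \<nu> (edges G) e" "list_all2 (relation_code \<nu>) Ss us"
      and w: "w = n # e @ concat us @ fm_code \<phi>"
      by (auto simp: n_def)
    then have "list_all2 (relation_code \<nu>) (edges G # Ss) (e # us)"
      by simp
    then obtain pss where len: "length pss = length (edges G # Ss)"
      and nth: "\<And>j. j < length (edges G # Ss) \<Longrightarrow> distinct (pss ! j) \<and> set (pss ! j) = (edges G # Ss) ! j"
      and cat: "concat (e # us) = concat (map (\<lambda>ps. pairs_code (map (map_prod \<nu> \<nu>) ps)) pss)"
      by (rule relation_codes) blast
    define qss where "qss = map (map (map_prod \<nu> \<nu>)) pss"
    have w': "w = n # concat (map pairs_code qss) @ fm_code \<phi>"
      using w cat by (simp add: qss_def comp_def)
    have bounded: "distinct ps \<and> bounded_relation (verts G) D (set ps) \<and> length ps \<le> z"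
      if "ps \<in> set pss" for ps
    proof -
      from that obtain j where j: "j < length pss" "ps = pss ! j"
        by (auto simp: in_set_conv_nth)
      then have ps: "distinct ps" "set ps = (edges G # Ss) ! j"
        using nth[of j] len by auto
      then have "set ps \<in> set (edges G # Ss)"
        using j len nth_mem[of j "edges G # Ss"] by simp
      then consider "set ps = edges G" | "set ps \<in> set Ss"
        by auto
      then have "bounded_relation (verts G) D (set ps) \<and> card (set ps) \<le> z"
      proof cases
        case 1
        then show ?thesis
          using bounded_relation_edges[OF G, of D] by (simp add: D_def z_def)
      next
        case 2
        then have "card (set ps) \<le> (\<Sum>S\<leftarrow>Ss. card S)"
          by (intro member_le_sum_list) auto
        then show ?thesis
          using bounded_relation_successor[of "verts G" "set ps" D] 2 succ by (simp add: D_def z_def)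
      qed
      with ps(1) show ?thesis
        by (simp add: distinct_card)
    qed
    interpret pair_lists s D n qss
    proof
      show "0 < D"
        by (simp add: D_def)
      show "length qss = s + 1"
        using len Ss by (simp add: qss_def)
    next
      fix qs a b
      assume "qs \<in> set qss" "(a, b) \<in> set qs"
      then show "a < n \<and> b < n \<and> a \<noteq> b"
        using bounded_relation_list(1)[OF _ _ \<nu>] bounded unfolding qss_def by fastforce
    next
      fix qs a
      assume "qs \<in> set qss"
      then show "length (filter (\<lambda>e. fst e = a) qs) \<le> D" "length (filter (\<lambda>e. snd e = a) qs) \<le> D"
        using bounded_relation_list(2,3)[OF _ _ \<nu>] bounded unfolding qss_def by fastforce+
    qed
    have rel: "(u, v) \<in> (edges G # Ss) ! j \<longleftrightarrow> (\<nu> u, \<nu> v) \<in> set (qss ! j)"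
      if "j \<le> s" "u \<in> verts G" "v \<in> verts G" for j u v
    proof -
      have j: "j < length pss"
        using that(1) len Ss by simp
      then have "(u, v) \<in> set (pss ! j) \<longleftrightarrow> (\<nu> u, \<nu> v) \<in> set (map (map_prod \<nu> \<nu>) (pss ! j))"
        using bounded[of "pss ! j"] that \<nu> by (intro bounded_relation_list(4)) auto
      then show ?thesis
        using nth[of j] j len by (simp add: qss_def)
    qed
    have "length qs \<le> z" if "qs \<in> set qss" for qs
      using that bounded by (auto simp: qss_def)
    from wp_mc_code[OF n this \<nu> Ss rel \<phi>] obtain t st' w'' K where
      ex: "exec ?c (\<lambda>_ _. 0, w) t (st', w'')" and K: "K \<le> max_reps (2 * (s + 1) * D) (fm_length \<phi>)"
      and t: "t \<le> mc_ticks s D (fm_length \<phi>) n z K" and res: "st' 0 0 \<noteq> 0 \<longleftrightarrow> models G Ss \<phi>"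
      unfolding wp_def w' by auto
    have "t + 1 \<le> (mc_ticks s D (fm_length \<phi>) 1 1 K + 1) * z"
      using t mc_ticks_le[of n z z s D "fm_length \<phi>" K] n n_le by linarith
    also have "mc_ticks s D (fm_length \<phi>) 1 1 K + 1 \<le> mc_factor s D (fm_length \<phi>)"
      unfolding mc_factor_def using K by (intro member_le_sum) auto
    finally have "t + 1 \<le> mc_factor s D (fm_length \<phi>) * z"
      by simp
    then have "code_size ?c * (t + 1) \<le> code_size ?c * mc_factor s D (fm_length \<phi>) * z ^ 1"
      by (metis mult.assoc mult_le_mono2 power_one_right)
    with exec_answers_within[OF ex names_mc_code _ res] show ?thesis
      unfolding z_def by blast
  qed
  show ?thesis
    unfolding fixed_parameter_tractable_def
    by (intro exI[of _ "compile ?c 0"] exI[of _ "\<lambda>L. code_size ?c * mc_factor s D L"] exI[of _ 1])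
      (use ans in \<open>auto simp: MC_FO_succs_def simp del: mc_encodes.simps mc_size.simps\<close>)
qed

theorem theorem3p2:
  shows "(\<forall>d::nat. fixed_parameter_tractable (MC_FO_plus1 (max_degree_class d :: nat graph set))) \<and>
         (\<forall>(d::nat) (s::nat). s \<ge> 1 \<longrightarrow>
            fixed_parameter_tractable (MC_FO_succs s (max_degree_class d :: nat graph set)))"
  unfolding MC_FO_plus1_def using bounded_degree_fpt by blast

end
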